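(* Let $m\ge 1$ and $n\ge 2$ be integers, let $\Omega\subset\mathbb{R}^n$ be an admissible domain (see context), and let $p,q>0$ with $pq>1$. Put $$\alpha=\frac{2m(p+1)}{pq-1},\qquad \beta=\frac{2m(q+1)}{pq-1}.$$ If $\max(\alpha,\beta)<n-m$, then there exist nonnegative bounded functions $a$ and $b$ on $\Omega$ such that the system $$(-\Delta)^m u=a(x)\,v^p\ \text{ in }\Omega,\qquad (-\Delta)^m v=b(x)\,u^q\ \text{ in }\Omega,$$ $$\left(\tfrac{\partial}{\partial\nu}\right)^j u=\left(\tfrac{\partial}{\partial\nu}\right)^j v=0\ \text{ on }\partial\Omega,\quad 0\le j\le m-1,$$ has a non-negative solution $(u,v)$ with $u\notin L^\infty(\Omega)$ and $v\notin L^\infty(\Omega)$.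
   Context: Notation: $\frac{\partial}{\partial\nu}$ is the normal derivative, $d(x)$ is the distance from $x$ to $\partial\Omega$, and $L^1_{d^m}(\Omega)$ is the space of functions with $\int_\Omega |f|\,d^m\,dx<\infty$. Admissible domains: let $B=\{x\in\mathbb{R}^n:|x|<1\}$. If $n\ge 3$, $\Omega=B$. If $n=2$, $\Omega$ is $B$ or a small smooth perturbation of $B$, i.e. $\Omega=g(B)$ with $g:\overline B\to\overline\Omega$ a $C^\infty$ diffeomorphism and $\|g-\mathrm{id}\|_{C^{2m}(\overline B)}\le\varepsilon_0$, where $\varepsilon_0=\varepsilon_0(m)>0$ is fixed so small that for each such $\Omega$ the Green function $G_m$ of $(-\Delta)^m$ in $\Omega$ with Dirichlet conditions $(\partial/\partial\nu)^j u=0$, $0\le j\le m-1$, is positive and satisfies, with some $C=C(\Omega,m)>0$, for all $x\neq y$ in $\Omega$: $G_m(x,y)\ge C\log\big(1+\frac{d(x)d(y)}{|x-y|^2}\big)$ if $m=1$, and $G_m(x,y)\ge C\,d(x)^{m-1}d(y)^{m-1}\min\{1,\frac{d(x)d(y)}{|x-y|^2}\}$ if $m\ge 2$. Solutions: for $f\in L^1_{d^m}(\Omega)$, a solution of $(-\Delta)^m u=f$ in $\Omega$ with $(\partial/\partial\nu)^j u=0$ on $\partial\Omega$, $0\le j\le m-1$, is a function $u\in L^1(\Omega)$ with $\int_\Omega u\,(-\Delta)^m\varphi\,dx=\int_\Omega f\varphi\,dx$ for all $\varphi\in C^{2m}(\overline\Omega)$ with $(\partial/\partial\nu)^j\varphi=0$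 on $\partial\Omega$, $0\le j\le m-1$; equivalently $u(x)=\int_\Omega G_m(x,y)f(y)\,dy$ for a.e. $x$. A non-negative solution $(u,v)$ of the system is a pair $u,v\ge 0$ with $a v^p,\ b u^q\in L^1_{d^m}(\Omega)$ such that both equations hold in this sense. *)

theory Defs
  imports "HOL-Analysis.Analysis"
begin

definition dir_deriv :: "'a::euclidean_space \<Rightarrow> ('a \<Rightarrow> 'b::real_normed_vector) \<Rightarrow> 'a \<Rightarrow> 'b" where
  "dir_deriv v f x = frechet_derivative f (at x) v"

text \<open>Iterated partial derivatives. A multi-index is given by a list of basis vectors.\<close>

definition partials :: "'a::euclidean_space list \<Rightarrow> ('a \<Rightarrow> 'b::real_normed_vector) \<Rightarrow> 'a \<Rightarrow> 'b" where
  "partials bs f = foldr dir_deriv bs f"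

text \<open>The space \<open>C\<^sup>k\<close> of the closure of an open set \<open>S\<close>: all partial derivatives of order at
  most \<open>k\<close> exist in \<open>S\<close> and extend continuously to the closure. Values outside the closure are
  irrelevant.\<close>

definition Ck_closure :: "nat \<Rightarrow> 'a::euclidean_space set \<Rightarrow> ('a \<Rightarrow> 'b::real_normed_vector) \<Rightarrow> bool" where
  "Ck_closure k S f \<longleftrightarrow>
     continuous_on (closure S) f \<and>
     (\<forall>bs. set bs \<subseteq> Basis \<and> length bs < k \<longrightarrow> (\<forall>x\<in>S. partials bs f differentiable (at x))) \<and>
     (\<forall>bs. set bs \<subseteq> Basis \<and> length bs \<le> k \<longrightarrow>
        (\<exists>h. continuous_on (closure S) h \<and> (\<forall>x\<in>S. h x = partials bs f x)))"

text \<open>The supremum over \<open>S\<close> equals the supremum over the closure, by continuity; for bounded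
  \<open>S\<close> and \<open>f\<close> in \<open>C\<^sup>k\<close> of the closure it is finite.\<close>

definition Ck_norm :: "nat \<Rightarrow> 'a::euclidean_space set \<Rightarrow> ('a \<Rightarrow> 'b::real_normed_vector) \<Rightarrow> real" where
  "Ck_norm k S f = Sup {norm (partials bs f x) | bs x. set bs \<subseteq> Basis \<and> length bs \<le> k \<and> x \<in> S}"

definition laplacian :: "('a::euclidean_space \<Rightarrow> real) \<Rightarrow> 'a \<Rightarrow> real" where
  "laplacian f x = (\<Sum>b\<in>Basis. dir_deriv b (dir_deriv b f) x)"

definition polylaplacian :: "nat \<Rightarrow> ('a::euclidean_space \<Rightarrow> real) \<Rightarrow> 'a \<Rightarrow> real" where
  "polylaplacian m = (\<lambda>f x. - laplacian f x) ^^ m"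

text \<open>Up to an arbitrarily narrow cone around the tangent hyperplane, near \<open>x\<close> the set
  \<open>\<Omega>\<close> is the half-space \<open>{y. \<nu> \<bullet> (y - x) < 0}\<close>. At most one unit vector has this property, and on
  the boundary of a \<open>C\<^sup>1\<close> domain it is the outward unit normal.\<close>

definition is_outward_normal :: "'a::euclidean_space set \<Rightarrow> 'a \<Rightarrow> 'a \<Rightarrow> bool" where
  "is_outward_normal \<Omega> x \<nu> \<longleftrightarrow> norm \<nu> = 1 \<and>
     (\<forall>\<epsilon>>0. \<exists>\<delta>>0. \<forall>y\<in>ball x \<delta>.
        (\<nu> \<bullet> (y - x) < - \<epsilon> * norm (y - x) \<longrightarrow> y \<in> \<Omega>) \<and>
        (\<nu> \<bullet> (y - x) > \<epsilon> * norm (y - x) \<longrightarrow> y \<notin> closure \<Omega>))"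

definition outward_normal :: "'a::euclidean_space set \<Rightarrow> 'a \<Rightarrow> 'a" where
  "outward_normal \<Omega> x = (THE \<nu>. is_outward_normal \<Omega> x \<nu>)"

text \<open>The \<open>j\<close>-th normal derivative at a boundary point \<open>x\<close>: differentiate \<open>j\<close> times in the fixed
  direction \<open>\<nu>(x)\<close> inside \<open>\<Omega>\<close> and take the continuous extension to \<open>x\<close>.\<close>

definition normal_deriv :: "'a::euclidean_space set \<Rightarrow> nat \<Rightarrow> ('a \<Rightarrow> real) \<Rightarrow> 'a \<Rightarrow> real" where
  "normal_deriv \<Omega> j \<phi> x = Lim (at x within \<Omega>) ((dir_deriv (outward_normal \<Omega> x) ^^ j) \<phi>)"

definition dirichlet_test :: "nat \<Rightarrow> 'a::euclidean_space set \<Rightarrow> ('a \<Rightarrow> real) set" where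
  "dirichlet_test m \<Omega> =
     {\<phi>. Ck_closure (2 * m) \<Omega> \<phi> \<and> (\<forall>j<m. \<forall>x\<in>frontier \<Omega>. normal_deriv \<Omega> j \<phi> x = 0)}"

definition bdist :: "'a::euclidean_space set \<Rightarrow> 'a \<Rightarrow> real" where
  "bdist \<Omega> x = infdist x (frontier \<Omega>)"

definition L1_weighted :: "nat \<Rightarrow> 'a::euclidean_space set \<Rightarrow> ('a \<Rightarrow> real) set" where
  "L1_weighted m \<Omega> = {f. set_borel_measurable lebesgue \<Omega> f \<and>
     set_integrable lebesgue \<Omega> (\<lambda>x. \<bar>f x\<bar> * bdist \<Omega> x ^ m)}"

definition L_infinity :: "'a::euclidean_space set \<Rightarrow> ('a \<Rightarrow> real) set" where
  "L_infinity \<Omega> = {f. set_borel_measurable lebesgue \<Omega> f \<and>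
     (\<exists>M. AE x in lebesgue. x \<in> \<Omega> \<longrightarrow> \<bar>f x\<bar> \<le> M)}"

text \<open>\<open>u\<close> solves the polyharmonic Dirichlet problem with right-hand side \<open>f\<close>, in the very weak
  sense. The boundary conditions on \<open>u\<close> are encoded in the class of test functions, which need
  not have compact support.\<close>

definition dirichlet_solution ::
  "nat \<Rightarrow> 'a::euclidean_space set \<Rightarrow> ('a \<Rightarrow> real) \<Rightarrow> ('a \<Rightarrow> real) \<Rightarrow> bool" where
  "dirichlet_solution m \<Omega> f u \<longleftrightarrow>
     f \<in> L1_weighted m \<Omega> \<and> set_integrable lebesgue \<Omega> u \<and>
     (\<forall>\<phi>\<in>dirichlet_test m \<Omega>.
        (LINT x:\<Omega>|lebesgue. u x * polylaplacian m \<phi> x) = (LINT x:\<Omega>|lebesgue. f x * \<phi> x))"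

text \<open>For each \<open>y\<close>, \<open>G(\<cdot>,y)\<close> solves the Dirichlet problem, in the same very weak sense, with the
  Dirac mass at \<open>y\<close> as right-hand side. Continuity off the diagonal makes \<open>G\<close> unique there.\<close>

definition is_green_function :: "nat \<Rightarrow> 'a::euclidean_space set \<Rightarrow> ('a \<Rightarrow> 'a \<Rightarrow> real) \<Rightarrow> bool" where
  "is_green_function m \<Omega> G \<longleftrightarrow>
     continuous_on {(x, y). x \<in> \<Omega> \<and> y \<in> \<Omega> \<and> x \<noteq> y} (\<lambda>(x, y). G x y) \<and>
     (\<forall>y\<in>\<Omega>. set_integrable lebesgue \<Omega> (\<lambda>x. G x y) \<and>
        (\<forall>\<phi>\<in>dirichlet_test m \<Omega>. (LINT x:\<Omega>|lebesgue. G x y * polylaplacian m \<phi> x) = \<phi> y))"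

definition green_lower_bound :: "nat \<Rightarrow> 'a::euclidean_space set \<Rightarrow> bool" where
  "green_lower_bound m \<Omega> \<longleftrightarrow>
     (\<exists>G. is_green_function m \<Omega> G \<and>
        (\<forall>x\<in>\<Omega>. \<forall>y\<in>\<Omega>. x \<noteq> y \<longrightarrow> G x y > 0) \<and>
        (\<exists>C>0. \<forall>x\<in>\<Omega>. \<forall>y\<in>\<Omega>. x \<noteq> y \<longrightarrow>
           G x y \<ge> (if m = 1
             then C * ln (1 + bdist \<Omega> x * bdist \<Omega> y / (norm (x - y))\<^sup>2)
             else C * bdist \<Omega> x ^ (m - 1) * bdist \<Omega> y ^ (m - 1)
                    * min 1 (bdist \<Omega> x * bdist \<Omega> y / (norm (x - y))\<^sup>2))))"

definition perturbed_ball :: "nat \<Rightarrow> real \<Rightarrow> 'a::euclidean_space set \<Rightarrow> bool" where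
  "perturbed_ball m \<epsilon> \<Omega> \<longleftrightarrow>
     (\<exists>g h. \<Omega> = g ` ball 0 1 \<and>
        homeomorphism (closure (ball 0 1)) (closure \<Omega>) g h \<and>
        (\<forall>k. Ck_closure k (ball 0 1) g) \<and> (\<forall>k. Ck_closure k \<Omega> h) \<and>
        Ck_norm (2 * m) (ball 0 1) (\<lambda>x. g x - x) \<le> \<epsilon>)"

text \<open>The unit ball is admissible in every dimension. In the plane so is every perturbation of
  size at most \<open>\<epsilon>\<^sub>0\<close>, for any \<open>\<epsilon>\<^sub>0\<close> so small that all perturbations of that size satisfy the
  Green function bounds.\<close>

definition admissible_domain :: "nat \<Rightarrow> 'a::euclidean_space set \<Rightarrow> bool" where
  "admissible_domain m \<Omega> \<longleftrightarrow>
     \<Omega> = ball 0 1 \<or>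
     DIM('a) = 2 \<and>
       (\<exists>\<epsilon>\<^sub>0>0. (\<forall>\<Omega>'::'a set. perturbed_ball m \<epsilon>\<^sub>0 \<Omega>' \<longrightarrow> green_lower_bound m \<Omega>') \<and>
          perturbed_ball m \<epsilon>\<^sub>0 \<Omega>)"

definition nonneg_system_solution ::
  "nat \<Rightarrow> 'a::euclidean_space set \<Rightarrow> real \<Rightarrow> real \<Rightarrow> ('a \<Rightarrow> real) \<Rightarrow> ('a \<Rightarrow> real) \<Rightarrow>
     ('a \<Rightarrow> real) \<Rightarrow> ('a \<Rightarrow> real) \<Rightarrow> bool" where
  "nonneg_system_solution m \<Omega> p q a b u v \<longleftrightarrow>
     (\<forall>x\<in>\<Omega>. 0 \<le> u x) \<and> (\<forall>x\<in>\<Omega>. 0 \<le> v x) \<and>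
     dirichlet_solution m \<Omega> (\<lambda>x. a x * v x powr p) u \<and>
     dirichlet_solution m \<Omega> (\<lambda>x. b x * u x powr q) v"

end

theory Submission
  imports Defs "HOL-Computational_Algebra.Polynomial"
begin

text \<open>Both equations reduce to one linear problem: for \<open>0 < \<gamma> < n - m\<close> find \<open>f, u \<ge> 0\<close> with
  \<open>(-\<Delta>)\<^sup>m u = f\<close>, where near a boundary point \<open>e\<close> the solution \<open>u\<close> behaves like \<open>|x - e|\<close> to
  the power \<open>-\<gamma>\<close> and \<open>f\<close> like \<open>|x - e|\<close> to the power \<open>-(\<gamma> + 2m)\<close>. Since \<open>\<beta>p = \<alpha> + 2m\<close>
  and \<open>\<alpha>q = \<beta> + 2m\<close>, the solutions \<open>(f, u)\<close> for \<open>\<gamma> = \<alpha>\<close> and \<open>(h, v)\<close> for \<open>\<gamma> = \<beta>\<close>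
  give bounded quotients \<open>a = f / v\<^sup>p\<close> and \<open>b = h / u\<^sup>q\<close>.

  On the ball no Green function is needed. With \<open>Q = 1 - 2 x\<cdot>y + |x|\<^sup>2 |y|\<^sup>2\<close> and
  \<open>\<rho> = |x - y|\<^sup>2 / Q\<close>, which is the squared modulus of the Moebius automorphism of the ball taking
  \<open>y\<close> to \<open>0\<close>, conformal covariance turns the polynomial radial solutions \<open>g\<close> of
  \<open>(-\<Delta>)\<^sup>m g = const (1 - \<rho>)\<^sup>N\<close> into explicit positive solutions centred at \<open>y\<close>; these are
  summed over \<open>y = (1 - 1/2\<^sup>k) e\<close>. Taking \<open>N\<close> large makes \<open>f\<close> vanish at the boundary faster
  than \<open>v\<^sup>p\<close>.

  For a perturbed disc the hypothesis on the exponents forces \<open>m = 1\<close>, and \<open>u\<close> is the Green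
  potential of a sum of multiples of indicators of disjoint balls whose radii are comparable to
  their distance from \<open>e\<close>; an explicit supersolution bounds the integrals of the Green function.\<close>

section \<open>Directional derivatives and smoothness up to the boundary\<close>

text \<open>The bound \<gamma> < n - m is exactly what the superposition needs. An explicit solution
  centred at distance t from \<open>e\<close> has size t^-(n - 2m) near its centre, so the weight
  t^(n - 2m - \<gamma>) produces size t^-\<gamma> there. At a fixed distance from \<open>e\<close>
  the same solution is of order t^m, and the weighted sum over dyadic t converges because n - m -
  \<gamma> > 0. The obstacle on the ball is that test functions need not have compact support, while
  the explicit solutions vanish only to order m on the sphere; iterated integration by parts would
  leave boundary terms. The identity is therefore proved for regularised solutions vanishing to
  order 2m, and the limit is controlled by the decay of order m of the test functions. The exponent
  N is free because v^p vanishes on the sphere to order mp: a source not vanishing at least as fast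
  would make f / v^p unbounded. On a perturbed disc the question does not arise, since the sources
  vanish outside balls on which u and v are bounded below by the right powers.\<close>

lemma dir_deriv_eq:
  assumes "(f has_derivative f') (at x)"
  shows "dir_deriv v f x = f' v"
  using frechet_derivative_at[OF assms] by (simp add: dir_deriv_def)

lemma dir_deriv_works:
  assumes "f differentiable (at x)"
  shows "(f has_derivative (\<lambda>v. dir_deriv v f x)) (at x)"
  using assms unfolding frechet_derivative_works dir_deriv_def by simp

lemma has_derivative_cong_open:
  assumes "open S" "x \<in> S" "\<And>y. y \<in> S \<Longrightarrow> f y = g y"
  shows "(f has_derivative D) (at x) \<longleftrightarrow> (g has_derivative D) (at x)"
  using has_derivative_transform_within_open[of f D x UNIV S g]
    has_derivative_transform_within_open[of g D x UNIV S f] assms by auto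

lemma dir_deriv_cong_open:
  assumes "open S" "x \<in> S" "\<And>y. y \<in> S \<Longrightarrow> f y = g y"
  shows "dir_deriv v f x = dir_deriv v g x"
  unfolding dir_deriv_def frechet_derivative_def
  by (subst has_derivative_cong_open[OF assms]) auto

lemma differentiable_cong_open:
  assumes "open S" "x \<in> S" "\<And>y. y \<in> S \<Longrightarrow> f y = g y"
  shows "f differentiable (at x) \<longleftrightarrow> g differentiable (at x)"
  unfolding differentiable_def
  by (subst has_derivative_cong_open[OF assms]) auto

lemma dir_deriv_expand:
  fixes f :: "'a::euclidean_space \<Rightarrow> 'b::real_normed_vector"
  assumes "f differentiable (at x)"
  shows "dir_deriv v f x = (\<Sum>b\<in>Basis. (v \<bullet> b) *\<^sub>R dir_deriv b f x)"
proof -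
  interpret bounded_linear "\<lambda>v. dir_deriv v f x"
    using dir_deriv_works[OF assms] by (rule has_derivative_bounded_linear)
  have "dir_deriv v f x = dir_deriv (\<Sum>b\<in>Basis. (v \<bullet> b) *\<^sub>R b) f x"
    by (simp add: euclidean_representation)
  also have "\<dots> = (\<Sum>b\<in>Basis. (v \<bullet> b) *\<^sub>R dir_deriv b f x)"
    by (simp add: sum scaleR)
  finally show ?thesis .
qed

lemma dir_deriv_add:
  assumes "f differentiable (at x)" "g differentiable (at x)"
  shows "dir_deriv v (\<lambda>x. f x + g x) x = dir_deriv v f x + dir_deriv v g x"
  by (rule dir_deriv_eq) (intro has_derivative_add dir_deriv_works assms)

lemma dir_deriv_sum:
  assumes "\<And>i. i \<in> I \<Longrightarrow> f i differentiable (at x)"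
  shows "dir_deriv v (\<lambda>x. \<Sum>i\<in>I. f i x) x = (\<Sum>i\<in>I. dir_deriv v (f i) x)"
  by (rule dir_deriv_eq[of _ "\<lambda>v. \<Sum>i\<in>I. dir_deriv v (f i) x"])
     (intro has_derivative_sum dir_deriv_works assms)

lemma dir_deriv_scaleR:
  assumes "f differentiable (at x)"
  shows "dir_deriv v (\<lambda>x. c *\<^sub>R f x) x = c *\<^sub>R dir_deriv v f x"
  by (rule dir_deriv_eq[of _ "\<lambda>v. c *\<^sub>R dir_deriv v f x"])
     (intro has_derivative_scaleR_right dir_deriv_works assms)

lemma dir_deriv_inner:
  fixes f g :: "'a::euclidean_space \<Rightarrow> 'b::real_inner"
  assumes "f differentiable (at x)" "g differentiable (at x)"
  shows "dir_deriv v (\<lambda>x. f x \<bullet> g x) x = f x \<bullet> dir_deriv v g x + dir_deriv v f x \<bullet> g x"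
  by (rule dir_deriv_eq[of _ "\<lambda>v. f x \<bullet> dir_deriv v g x + dir_deriv v f x \<bullet> g x"])
     (intro has_derivative_inner dir_deriv_works assms)

lemma dir_deriv_mult:
  fixes f g :: "'a::euclidean_space \<Rightarrow> real"
  assumes "f differentiable (at x)" "g differentiable (at x)"
  shows "dir_deriv v (\<lambda>x. f x * g x) x = f x * dir_deriv v g x + dir_deriv v f x * g x"
  using dir_deriv_inner[OF assms] by simp

lemma dir_deriv_line:
  assumes "f differentiable (at (x + s *\<^sub>R v))"
  shows "((\<lambda>s. f (x + s *\<^sub>R v)) has_vector_derivative dir_deriv v f (x + s *\<^sub>R v)) (at s)"
proof -
  have 1: "((\<lambda>s. x + s *\<^sub>R v) has_derivative (\<lambda>h. h *\<^sub>R v)) (at s)"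
    by (auto intro!: derivative_eq_intros)
  interpret bounded_linear "\<lambda>w. dir_deriv w f (x + s *\<^sub>R v)"
    using dir_deriv_works[OF assms] by (rule has_derivative_bounded_linear)
  have "((\<lambda>s. f (x + s *\<^sub>R v)) has_derivative (\<lambda>h. dir_deriv (h *\<^sub>R v) f (x + s *\<^sub>R v))) (at s)"
    using has_derivative_compose[OF 1 dir_deriv_works[OF assms]] .
  then show ?thesis by (simp add: has_vector_derivative_def scaleR)
qed

text \<open>\<open>Ck_closure\<close> speaks of all multi-indices at once. Removing one derivative
  at a time turns closure under sums, products and \<open>exp\<close> into inductions on
  \<open>k\<close>; \<open>Ck_closure_iff\<close> links the two notions.\<close>

primrec smooth_upto :: "nat \<Rightarrow> 'a::euclidean_space set \<Rightarrow> ('a \<Rightarrow> 'b::real_normed_vector) \<Rightarrow> bool" where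
  "smooth_upto 0 S f \<longleftrightarrow> (\<exists>h. continuous_on (closure S) h \<and> (\<forall>x\<in>S. h x = f x))"
| "smooth_upto (Suc k) S f \<longleftrightarrow> (\<exists>h. continuous_on (closure S) h \<and> (\<forall>x\<in>S. h x = f x)) \<and>
     (\<forall>x\<in>S. f differentiable (at x)) \<and> (\<forall>b\<in>Basis. smooth_upto k S (dir_deriv b f))"

lemma smooth_upto_extends:
  "smooth_upto k S f \<Longrightarrow> \<exists>h. continuous_on (closure S) h \<and> (\<forall>x\<in>S. h x = f x)"
  by (cases k) auto

lemma smooth_upto_continuous_on:
  assumes "smooth_upto k S f" shows "continuous_on S f"
  using smooth_upto_extends[OF assms]
  by (metis closure_subset continuous_on_cong continuous_on_subset)

lemma smooth_upto_bounded:
  fixes f :: "'a::euclidean_space \<Rightarrow> 'b::real_normed_vector"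
  assumes "smooth_upto k S f" "bounded S"
  obtains M where "0 \<le> M" "\<And>x. x \<in> S \<Longrightarrow> norm (f x) \<le> M"
proof -
  obtain h where h: "continuous_on (closure S) h" "\<forall>x\<in>S. h x = f x"
    using smooth_upto_extends[OF assms(1)] by auto
  have "compact (h ` closure S)"
    using assms(2) h(1) by (intro compact_continuous_image) auto
  then have "bounded (h ` closure S)" by (rule compact_imp_bounded)
  then obtain M where "\<And>x. x \<in> closure S \<Longrightarrow> norm (h x) \<le> M" "0 < M"
    unfolding bounded_pos by auto
  then show thesis using h closure_subset[of S] by (intro that[of M]) (auto, metis subsetD)
qed

lemma smooth_upto_differentiable:
  "smooth_upto (Suc k) S f \<Longrightarrow> x \<in> S \<Longrightarrow> f differentiable (at x)" by simp

lemma smooth_upto_dir_deriv: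
  "smooth_upto (Suc k) S f \<Longrightarrow> b \<in> Basis \<Longrightarrow> smooth_upto k S (dir_deriv b f)" by simp

lemma smooth_upto_SucI:
  assumes "\<exists>h. continuous_on (closure S) h \<and> (\<forall>x\<in>S. h x = f x)"
    "\<And>x. x \<in> S \<Longrightarrow> f differentiable (at x)" "\<And>b. b \<in> Basis \<Longrightarrow> smooth_upto k S (dir_deriv b f)"
  shows "smooth_upto (Suc k) S f"
  using assms by simp

lemma smooth_upto_cong:
  assumes "open S" "smooth_upto k S f" "\<And>x. x \<in> S \<Longrightarrow> f x = g x"
  shows "smooth_upto k S g"
  using assms(2,3)
proof (induction k arbitrary: f g)
  case 0 then show ?case by auto
next
  case (Suc k)
  have "smooth_upto k S (dir_deriv b g)" if "b \<in> Basis" for b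
    using Suc.IH[of "dir_deriv b f" "dir_deriv b g"] Suc.prems that
      dir_deriv_cong_open[OF assms(1), of _ f g b] by auto
  moreover have "g differentiable (at x)" if "x \<in> S" for x
    using differentiable_cong_open[OF assms(1) that, of f g] Suc.prems that by auto
  ultimately show ?case
    using smooth_upto_extends[OF Suc.prems(1)] Suc.prems(2)
    by (intro smooth_upto_SucI) auto
qed

lemma smooth_upto_Suc_D: "smooth_upto (Suc k) S f \<Longrightarrow> smooth_upto k S f"
  by (induction k arbitrary: f) auto

lemma smooth_upto_mono: "smooth_upto k S f \<Longrightarrow> l \<le> k \<Longrightarrow> smooth_upto l S f"
  by (induction k) (auto simp: le_Suc_eq simp del: smooth_upto.simps dest: smooth_upto_Suc_D)

lemma smooth_upto_const: "smooth_upto k S (\<lambda>x. c)"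
proof (induction k arbitrary: c)
  case 0 show ?case by (auto intro: exI[of _ "\<lambda>x. c"])
next
  case (Suc k)
  have "dir_deriv b (\<lambda>x. c) = (\<lambda>x. 0)" for b :: 'a
    by (rule ext, rule dir_deriv_eq[of _ "\<lambda>x. 0"]) auto
  then have "smooth_upto k S (dir_deriv b (\<lambda>x. c))" for b using Suc by metis
  then show ?case by (auto intro: exI[of _ "\<lambda>x. c"])
qed

lemma smooth_upto_add:
  assumes "open S" "smooth_upto k S f" "smooth_upto k S g"
  shows "smooth_upto k S (\<lambda>x. f x + g x)"
proof -
  have ext: "\<exists>h. continuous_on (closure S) h \<and> (\<forall>x\<in>S. h x = f x + g x)"
    if fg: "smooth_upto k S f" "smooth_upto k S g" for k and f g :: "'a \<Rightarrow> 'b"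
  proof -
    obtain h1 h2 where "continuous_on (closure S) h1" "\<forall>x\<in>S. h1 x = f x"
        "continuous_on (closure S) h2" "\<forall>x\<in>S. h2 x = g x"
      using fg[THEN smooth_upto_extends] by auto
    then show ?thesis by (intro exI[of _ "\<lambda>x. h1 x + h2 x"]) (auto intro!: continuous_intros)
  qed
  show ?thesis using assms(2,3)
  proof (induction k arbitrary: f g)
    case 0 then show ?case using ext[of 0] by simp
  next
    case (Suc k)
    have "smooth_upto k S (dir_deriv b (\<lambda>x. f x + g x))" if "b \<in> Basis" for b
      by (rule smooth_upto_cong[OF assms(1) Suc.IH[of "dir_deriv b f" "dir_deriv b g"]])
         (use that Suc.prems in \<open>simp_all add: dir_deriv_add\<close>)
    then show ?case using Suc.prems
      by (intro smooth_upto_SucI ext[OF Suc.prems]) (simp_all add: differentiable_add)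
  qed
qed

lemma smooth_upto_inner:
  fixes f g :: "'a::euclidean_space \<Rightarrow> 'b::real_inner"
  assumes "open S" "smooth_upto k S f" "smooth_upto k S g"
  shows "smooth_upto k S (\<lambda>x. f x \<bullet> g x)"
proof -
  have ext: "\<exists>h. continuous_on (closure S) h \<and> (\<forall>x\<in>S. h x = f x \<bullet> g x)"
    if fg: "smooth_upto k S f" "smooth_upto k S g" for k and f g :: "'a \<Rightarrow> 'b"
  proof -
    obtain h1 h2 where "continuous_on (closure S) h1" "\<forall>x\<in>S. h1 x = f x"
        "continuous_on (closure S) h2" "\<forall>x\<in>S. h2 x = g x"
      using fg[THEN smooth_upto_extends] by auto
    then show ?thesis by (intro exI[of _ "\<lambda>x. h1 x \<bullet> h2 x"]) (auto intro!: continuous_intros)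
  qed
  show ?thesis using assms(2,3)
  proof (induction k arbitrary: f g)
    case 0 then show ?case using ext[of 0] by simp
  next
    case (Suc k)
    have "smooth_upto k S (dir_deriv b (\<lambda>x. f x \<bullet> g x))" if b: "b \<in> Basis" for b
    proof (rule smooth_upto_cong[OF assms(1)])
      show "smooth_upto k S (\<lambda>x. f x \<bullet> dir_deriv b g x + dir_deriv b f x \<bullet> g x)"
        using Suc.prems b smooth_upto_Suc_D[of k S f] smooth_upto_Suc_D[of k S g]
        by (intro smooth_upto_add[OF assms(1)] Suc.IH) (simp_all del: smooth_upto.simps add: smooth_upto_dir_deriv)
    qed (use Suc.prems in \<open>simp add: dir_deriv_inner\<close>)
    then show ?case using Suc.prems
      by (intro smooth_upto_SucI ext[OF Suc.prems]) (simp_all add: differentiable_inner)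
  qed
qed

lemma smooth_upto_mult:
  fixes f g :: "'a::euclidean_space \<Rightarrow> real"
  assumes "open S" "smooth_upto k S f" "smooth_upto k S g"
  shows "smooth_upto k S (\<lambda>x. f x * g x)"
  using smooth_upto_inner[OF assms] by simp

lemma smooth_upto_scaleR:
  fixes f :: "'a::euclidean_space \<Rightarrow> 'b::real_normed_vector"
  assumes "open S" "smooth_upto k S f"
  shows "smooth_upto k S (\<lambda>x. c *\<^sub>R f x)"
  using assms(2)
proof (induction k arbitrary: f)
  case 0
  then obtain h where "continuous_on (closure S) h" "\<forall>x\<in>S. h x = f x" by auto
  then show ?case by (auto intro!: exI[of _ "\<lambda>x. c *\<^sub>R h x"] continuous_intros)
next
  case (Suc k)
  then obtain h where "continuous_on (closure S) h" "\<forall>x\<in>S. h x = f x" by auto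
  then have "\<exists>h. continuous_on (closure S) h \<and> (\<forall>x\<in>S. h x = c *\<^sub>R f x)"
    by (auto intro!: exI[of _ "\<lambda>x. c *\<^sub>R h x"] continuous_intros)
  moreover have "smooth_upto k S (dir_deriv b (\<lambda>x. c *\<^sub>R f x))" if "b \<in> Basis" for b
    by (rule smooth_upto_cong[OF assms(1) Suc.IH[of "dir_deriv b f"]])
       (use that Suc.prems in \<open>simp_all add: dir_deriv_scaleR\<close>)
  ultimately show ?case using Suc.prems by (intro smooth_upto_SucI) simp_all
qed

lemma smooth_upto_sum:
  assumes "open S" "finite I" "\<And>i. i \<in> I \<Longrightarrow> smooth_upto k S (f i)"
  shows "smooth_upto k S (\<lambda>x. \<Sum>i\<in>I. f i x)"
  using assms(2,3)
proof (induction I rule: finite_induct)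
  case empty then show ?case by (simp add: smooth_upto_const)
next
  case (insert i I)
  have "smooth_upto k S (\<lambda>x. f i x + (\<Sum>i\<in>I. f i x))"
    by (rule smooth_upto_add[OF assms(1)]) (simp_all add: insert)
  then show ?case by (simp add: insert)
qed

lemma smooth_upto_minus:
  assumes "open S" "smooth_upto k S f"
  shows "smooth_upto k S (\<lambda>x. - f x)"
  using smooth_upto_scaleR[OF assms, of "-1"] by simp

lemma smooth_upto_exp:
  fixes f :: "'a::euclidean_space \<Rightarrow> real"
  assumes "open S" "smooth_upto k S f"
  shows "smooth_upto k S (\<lambda>x. exp (f x))"
  using assms(2)
proof (induction k)
  case 0
  then obtain h where "continuous_on (closure S) h" "\<forall>x\<in>S. h x = f x" by auto
  then show ?case by (auto intro!: exI[of _ "\<lambda>x. exp (h x)"] continuous_intros)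
next
  case (Suc k)
  then obtain h where "continuous_on (closure S) h" "\<forall>x\<in>S. h x = f x" by auto
  then have "\<exists>h. continuous_on (closure S) h \<and> (\<forall>x\<in>S. h x = exp (f x))"
    by (auto intro!: exI[of _ "\<lambda>x. exp (h x)"] continuous_intros)
  moreover have d: "((\<lambda>x. exp (f x)) has_derivative (\<lambda>v. exp (f x) * dir_deriv v f x)) (at x)"
    if "x \<in> S" for x
    using Suc.prems that by (auto intro!: derivative_eq_intros dir_deriv_works)
  moreover have "smooth_upto k S (dir_deriv b (\<lambda>x. exp (f x)))" if "b \<in> Basis" for b
  proof (rule smooth_upto_cong[OF assms(1)])
    show "smooth_upto k S (\<lambda>x. exp (f x) * dir_deriv b f x)"
      using Suc.prems that smooth_upto_Suc_D[OF Suc.prems]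
      by (intro smooth_upto_mult[OF assms(1)] Suc.IH) (simp_all del: smooth_upto.simps add: smooth_upto_dir_deriv)
  qed (use dir_deriv_eq[OF d] in auto)
  ultimately show ?case by (intro smooth_upto_SucI) (auto simp: differentiable_def)
qed

lemma smooth_upto_laplacian:
  assumes "open S" "smooth_upto (Suc (Suc k)) S f"
  shows "smooth_upto k S (laplacian f)"
proof -
  have "smooth_upto k S (\<lambda>x. \<Sum>b\<in>Basis. dir_deriv b (dir_deriv b f) x)"
    using assms(2) by (intro smooth_upto_sum assms(1)) auto
  then show ?thesis by (simp add: laplacian_def[abs_def])
qed

lemma polylaplacian_0 [simp]: "polylaplacian 0 f = f"
  by (simp add: polylaplacian_def)

lemma polylaplacian_Suc: "polylaplacian (Suc m) f = (\<lambda>x. - laplacian (polylaplacian m f) x)"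
  by (simp add: polylaplacian_def)

lemma smooth_upto_polylaplacian:
  assumes "open S" "smooth_upto (k + 2 * l) S f"
  shows "smooth_upto k S (polylaplacian l f)"
  using assms(2)
proof (induction l arbitrary: k)
  case 0 then show ?case by simp
next
  case (Suc l)
  have "smooth_upto (Suc (Suc k)) S (polylaplacian l f)"
    by (rule Suc.IH) (use Suc.prems in \<open>simp del: smooth_upto.simps\<close>)
  from smooth_upto_minus[OF assms(1) smooth_upto_laplacian[OF assms(1) this]]
  show ?case by (simp only: polylaplacian_Suc)
qed

lemma partials_dir_deriv: "partials bs (dir_deriv b f) = partials (bs @ [b]) f"
  by (simp add: partials_def)

text \<open>\<open>foldr\<close> lets the last entry of the list act first, so the derivative peeled
  off by the recursion is the last entry. This is why lists are split as
  \<open>bs @ [b]\<close>.\<close>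

lemma smooth_upto_iff_partials:
  "smooth_upto k S f \<longleftrightarrow>
     (\<forall>bs. set bs \<subseteq> Basis \<and> length bs < k \<longrightarrow> (\<forall>x\<in>S. partials bs f differentiable (at x))) \<and>
     (\<forall>bs. set bs \<subseteq> Basis \<and> length bs \<le> k \<longrightarrow>
        (\<exists>h. continuous_on (closure S) h \<and> (\<forall>x\<in>S. h x = partials bs f x)))"
proof (induction k arbitrary: f)
  case 0 show ?case by (simp add: partials_def)
next
  case (Suc k)
  have split: "(\<forall>bs. set bs \<subseteq> (Basis :: 'a set) \<and> length bs \<le> Suc j \<longrightarrow> P bs) \<longleftrightarrow>
      P [] \<and> (\<forall>b\<in>Basis. \<forall>bs. set bs \<subseteq> Basis \<and> length bs \<le> j \<longrightarrow> P (bs @ [b]))" for P j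
  proof (safe, goal_cases)
    case (3 bs) then show ?case by (cases bs rule: rev_cases) auto
  qed auto
  have split': "(\<forall>bs. set bs \<subseteq> (Basis :: 'a set) \<and> length bs < Suc j \<longrightarrow> P bs) \<longleftrightarrow>
      P [] \<and> (\<forall>b\<in>Basis. \<forall>bs. set bs \<subseteq> Basis \<and> length bs < j \<longrightarrow> P (bs @ [b]))" for P j
  proof (safe, goal_cases)
    case (3 bs) then show ?case by (cases bs rule: rev_cases) auto
  qed auto
  show ?case unfolding split split' smooth_upto.simps Suc.IH partials_dir_deriv[symmetric]
    by (auto simp: partials_def)
qed

lemma Ck_closure_iff: "Ck_closure k S f \<longleftrightarrow> continuous_on (closure S) f \<and> smooth_upto k S f"
  unfolding Ck_closure_def smooth_upto_iff_partials by simp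

lemma smooth_upto_dir_deriv_any:
  assumes "open S" "smooth_upto (Suc k) S f"
  shows "smooth_upto k S (dir_deriv v f)"
proof (rule smooth_upto_cong[OF assms(1)])
  show "smooth_upto k S (\<lambda>x. \<Sum>b\<in>Basis. (v \<bullet> b) *\<^sub>R dir_deriv b f x)"
    using assms by (intro smooth_upto_sum smooth_upto_scaleR) auto
qed (use assms dir_deriv_expand[of f _ v] in auto)

lemma smooth_upto_dir_deriv_funpow:
  assumes "open S" "smooth_upto (k + j) S f"
  shows "smooth_upto k S ((dir_deriv v ^^ j) f)"
  using assms(2)
proof (induction j arbitrary: k)
  case (Suc j)
  have "smooth_upto (Suc k) S ((dir_deriv v ^^ j) f)"
    by (rule Suc.IH) (use Suc.prems in \<open>simp del: smooth_upto.simps\<close>)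
  from smooth_upto_dir_deriv_any[OF assms(1) this] show ?case by simp
qed simp

lemma funpow_dir_deriv_cong:
  assumes "open S" "\<And>x. x \<in> S \<Longrightarrow> f x = g x" "x \<in> S"
  shows "(dir_deriv v ^^ j) f x = (dir_deriv v ^^ j) g x"
  using assms(3)
proof (induction j arbitrary: x)
  case (Suc j) then show ?case
    using dir_deriv_cong_open[OF assms(1), of x "(dir_deriv v ^^ j) f" "(dir_deriv v ^^ j) g" v] by simp
qed (use assms in simp)

lemma funpow_dir_deriv_sum:
  assumes "open S" "finite I" "\<And>i. i \<in> I \<Longrightarrow> smooth_upto j S (f i)" "x \<in> S"
  shows "(dir_deriv v ^^ j) (\<lambda>x. \<Sum>i\<in>I. c i *\<^sub>R f i x) x = (\<Sum>i\<in>I. c i *\<^sub>R (dir_deriv v ^^ j) (f i) x)"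
proof -
  have "l \<le> j \<Longrightarrow> (\<forall>x\<in>S. (dir_deriv v ^^ l) (\<lambda>x. \<Sum>i\<in>I. c i *\<^sub>R f i x) x = (\<Sum>i\<in>I. c i *\<^sub>R (dir_deriv v ^^ l) (f i) x))" for l
  proof (induction l)
    case (Suc l)
    have d: "(dir_deriv v ^^ l) (f i) differentiable (at x)" if "i \<in> I" "x \<in> S" for i x
    proof -
      have "smooth_upto (Suc 0) S ((dir_deriv v ^^ l) (f i))"
        using Suc.prems assms(3)[OF that(1)]
        by (intro smooth_upto_dir_deriv_funpow assms(1)) (auto intro: smooth_upto_mono simp del: smooth_upto.simps)
      then show ?thesis using that by auto
    qed
    have "dir_deriv v ((dir_deriv v ^^ l) (\<lambda>x. \<Sum>i\<in>I. c i *\<^sub>R f i x)) x =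
       (\<Sum>i\<in>I. c i *\<^sub>R dir_deriv v ((dir_deriv v ^^ l) (f i)) x)" if "x \<in> S" for x
    proof -
      have "dir_deriv v ((dir_deriv v ^^ l) (\<lambda>x. \<Sum>i\<in>I. c i *\<^sub>R f i x)) x =
        dir_deriv v (\<lambda>x. \<Sum>i\<in>I. c i *\<^sub>R (dir_deriv v ^^ l) (f i) x) x"
        using Suc by (intro dir_deriv_cong_open[OF assms(1) that]) auto
      also have "\<dots> = (\<Sum>i\<in>I. dir_deriv v (\<lambda>x. c i *\<^sub>R (dir_deriv v ^^ l) (f i) x) x)"
        using d that by (intro dir_deriv_sum differentiable_scaleR) auto
      also have "\<dots> = (\<Sum>i\<in>I. c i *\<^sub>R dir_deriv v ((dir_deriv v ^^ l) (f i)) x)"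
        using d that by (intro sum.cong refl dir_deriv_scaleR) auto
      finally show ?thesis .
    qed
    then show ?case by simp
  qed simp
  then show ?thesis using assms(4) by blast
qed

text \<open>The point is uniformity in the direction \<open>v\<close>, needed when every radius of
  the ball is treated at once. The innermost derivative is expanded in the basis, with coefficients
  of modulus at most 1, and the induction hypothesis bounds the rest.\<close>

lemma funpow_dir_deriv_bounded:
  fixes f :: "'a::euclidean_space \<Rightarrow> 'b::real_normed_vector"
  assumes "open S" "bounded S" "smooth_upto k S f"
  shows "\<exists>M\<ge>0. \<forall>v x. norm v = 1 \<longrightarrow> x \<in> S \<longrightarrow> norm ((dir_deriv v ^^ k) f x) \<le> M"
  using assms(3)
proof (induction k arbitrary: f)
  case 0
  then show ?case using smooth_upto_bounded[OF 0 assms(2)] by (metis funpow_0)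
next
  case (Suc k)
  have "\<exists>M\<ge>0. \<forall>v x. norm v = 1 \<longrightarrow> x \<in> S \<longrightarrow> norm ((dir_deriv v ^^ k) (dir_deriv b f) x) \<le> M"
    if "b \<in> Basis" for b using Suc that by auto
  then obtain M where M: "\<And>b v x. b \<in> Basis \<Longrightarrow> norm v = 1 \<Longrightarrow> x \<in> S \<Longrightarrow>
      norm ((dir_deriv v ^^ k) (dir_deriv b f) x) \<le> M b" "\<And>b. b \<in> Basis \<Longrightarrow> 0 \<le> M b"
    by metis
  have "norm ((dir_deriv v ^^ Suc k) f x) \<le> (\<Sum>b\<in>Basis. M b)" if v: "norm v = 1" and x: "x \<in> S" for v x
  proof -
    have "(dir_deriv v ^^ Suc k) f x = (dir_deriv v ^^ k) (dir_deriv v f) x"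
      by (simp only: funpow_Suc_right o_def)
    also have "\<dots> = (dir_deriv v ^^ k) (\<lambda>x. \<Sum>b\<in>Basis. (v \<bullet> b) *\<^sub>R dir_deriv b f x) x"
      using Suc.prems dir_deriv_expand[of f _ v] by (intro funpow_dir_deriv_cong[OF assms(1) _ x]) auto
    also have "\<dots> = (\<Sum>b\<in>Basis. (v \<bullet> b) *\<^sub>R (dir_deriv v ^^ k) (dir_deriv b f) x)"
      using Suc.prems by (intro funpow_dir_deriv_sum[OF assms(1)] x) auto
    also have "norm \<dots> \<le> (\<Sum>b\<in>Basis. M b)"
    proof (rule sum_norm_le)
      fix b :: 'a assume b: "b \<in> Basis"
      have "\<bar>v \<bullet> b\<bar> \<le> 1" using Basis_le_norm[OF b, of v] v by simp
      then have "\<bar>v \<bullet> b\<bar> * norm ((dir_deriv v ^^ k) (dir_deriv b f) x) \<le> 1 * M b"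
        using M[OF b] v x by (intro mult_mono) auto
      then show "norm ((v \<bullet> b) *\<^sub>R (dir_deriv v ^^ k) (dir_deriv b f) x) \<le> M b" by simp
    qed
    finally show ?thesis .
  qed
  then show ?case using M(2) by (intro exI[of _ "\<Sum>b\<in>Basis. M b"]) (auto intro: sum_nonneg)
qed

section \<open>Test functions on the ball\<close>

lemma is_outward_normal_unit_ball:
  fixes x :: "'a::euclidean_space"
  assumes "norm x = 1"
  shows "is_outward_normal (ball 0 1) x x"
  unfolding is_outward_normal_def
proof (intro conjI allI impI)
  show "norm x = 1" by fact
  fix \<epsilon> :: real assume \<epsilon>: "\<epsilon> > 0"
  have sq: "(norm y)\<^sup>2 = 1 + 2 * (x \<bullet> (y - x)) + (norm (y - x))\<^sup>2" for y
    using assms by (simp add: power2_norm_eq_inner norm_eq_1 algebra_simps inner_commute)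
  show "\<exists>\<delta>>0. \<forall>y\<in>ball x \<delta>. (x \<bullet> (y - x) < - \<epsilon> * norm (y - x) \<longrightarrow> y \<in> ball 0 1) \<and>
      (x \<bullet> (y - x) > \<epsilon> * norm (y - x) \<longrightarrow> y \<notin> closure (ball 0 1))"
  \<comment> \<open>For |y - x| < 2\<epsilon> the quadratic term of \<open>sq\<close> is at most
    2\<epsilon>|y - x|, which the linear term outweighs.\<close>
  proof (intro exI[of _ "2 * \<epsilon>"] conjI ballI impI)
    fix y assume y: "y \<in> ball x (2 * \<epsilon>)" and "x \<bullet> (y - x) < - \<epsilon> * norm (y - x)"
    have "norm (y - x) < 2 * \<epsilon>" using y by (simp add: dist_norm norm_minus_commute)
    then have "norm (y - x) * norm (y - x) \<le> 2 * \<epsilon> * norm (y - x)"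
      by (intro mult_right_mono) auto
    then have "(norm y)\<^sup>2 < 1"
      using sq[of y] \<open>x \<bullet> (y - x) < _\<close> by (simp add: power2_eq_square)
    then show "y \<in> ball 0 1" by (simp add: power_less_one_iff abs_square_less_1)
  next
    fix y assume "x \<bullet> (y - x) > \<epsilon> * norm (y - x)"
    moreover have "\<epsilon> * norm (y - x) \<ge> 0" using \<epsilon> by simp
    ultimately have "(norm y)\<^sup>2 > 1" using sq[of y] zero_le_power2[of "norm (y - x)"] by linarith
    then show "y \<notin> closure (ball 0 1)"
      by (simp add: closure_ball) (metis norm_ge_zero not_less one_power2 power2_le_imp_le power_mono)
  qed (use \<epsilon> in auto)
qed

text \<open>A short step from \<open>x\<close> in the direction \<mu> - \<nu> has negative product
  with \<nu> and positive product with \<mu>. It would end both in \<open>S\<close> and outside its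
  closure.\<close>

lemma is_outward_normal_unique:
  fixes x :: "'a::euclidean_space"
  assumes "is_outward_normal S x \<nu>" "is_outward_normal S x \<mu>"
  shows "\<nu> = \<mu>"
proof (rule ccontr)
  assume ne: "\<nu> \<noteq> \<mu>"
  have n: "norm \<nu> = 1" "norm \<mu> = 1" using assms by (auto simp: is_outward_normal_def)
  define d where "d = \<mu> - \<nu>"
  have d: "norm d > 0" using ne by (simp add: d_def)
  have "(norm d)\<^sup>2 = 2 - 2 * (\<nu> \<bullet> \<mu>)"
    using n by (simp add: d_def power2_norm_eq_inner norm_eq_1 algebra_simps inner_commute)
  moreover have "(norm d)\<^sup>2 > 0" using d by simp
  ultimately have lt: "\<nu> \<bullet> \<mu> < 1" by linarith
  define e where "e = (1 - \<nu> \<bullet> \<mu>) / (2 * norm d)"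
  have e: "e > 0" "e * norm d < 1 - \<nu> \<bullet> \<mu>" using d lt by (auto simp: e_def field_simps)
  obtain \<delta>1 where \<delta>1: "\<delta>1 > 0" "\<And>y. y \<in> ball x \<delta>1 \<Longrightarrow> \<nu> \<bullet> (y - x) < - e * norm (y - x) \<Longrightarrow> y \<in> S"
    using assms(1) e(1) unfolding is_outward_normal_def by blast
  obtain \<delta>2 where \<delta>2: "\<delta>2 > 0" "\<And>y. y \<in> ball x \<delta>2 \<Longrightarrow> \<mu> \<bullet> (y - x) > e * norm (y - x) \<Longrightarrow> y \<notin> closure S"
    using assms(2) e(1) unfolding is_outward_normal_def by blast
  define s where "s = min \<delta>1 \<delta>2 / (2 * norm d)"
  have s: "s > 0" "s * norm d < \<delta>1" "s * norm d < \<delta>2"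
    using \<delta>1(1) \<delta>2(1) d by (auto simp: s_def field_simps min_def)
  define y where "y = x + s *\<^sub>R d"
  have yb: "y \<in> ball x \<delta>1" "y \<in> ball x \<delta>2" using s by (auto simp: y_def dist_norm)
  have ny: "norm (y - x) = s * norm d" using s by (simp add: y_def)
  have "\<nu> \<bullet> (y - x) = - s * (1 - \<nu> \<bullet> \<mu>)" "\<mu> \<bullet> (y - x) = s * (1 - \<nu> \<bullet> \<mu>)"
    using n by (simp_all add: y_def d_def norm_eq_1 algebra_simps inner_commute)
  moreover have "s * (e * norm d) < s * (1 - \<nu> \<bullet> \<mu>)" using s e by simp
  ultimately have "y \<in> S" "y \<notin> closure S"
    using \<delta>1(2)[OF yb(1)] \<delta>2(2)[OF yb(2)] ny by (auto simp: algebra_simps)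
  then show False using closure_subset by blast
qed

lemma outward_normal_unit_ball:
  fixes x :: "'a::euclidean_space"
  assumes "norm x = 1"
  shows "outward_normal (ball 0 1) x = x"
  unfolding outward_normal_def
  using is_outward_normal_unit_ball[OF assms] is_outward_normal_unique by blast

lemma closure_unit_ball: "closure (ball 0 1) = cball (0::'a::euclidean_space) 1"
  by (simp add: closure_ball)

text \<open>Taylor expansion along each radius, from the sphere inwards. The radius in direction
  \<open>v\<close> ends at the boundary point \<open>v\<close>, whose outward normal is
  \<open>v\<close> itself, so all Dirichlet conditions there concern derivatives in this one
  direction. Each use of the mean value theorem lowers the order of the derivative by one and gains
  a factor 1 - s.\<close>

lemma dirichlet_test_decay:
  fixes \<phi> :: "'a::euclidean_space \<Rightarrow> real"
  assumes "\<phi> \<in> dirichlet_test m (ball 0 1)"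
  shows "\<exists>C\<ge>0. \<forall>x\<in>ball 0 1. \<bar>\<phi> x\<bar> \<le> C * (1 - norm x) ^ m"
proof -
  let ?B = "ball (0::'a) 1"
  have su: "smooth_upto (2 * m) ?B \<phi>" and nd: "\<And>j x. j < m \<Longrightarrow> norm x = 1 \<Longrightarrow> normal_deriv ?B j \<phi> x = 0"
    using assms by (auto simp: dirichlet_test_def Ck_closure_iff)
  have "smooth_upto m ?B \<phi>" by (rule smooth_upto_mono[OF su]) simp
  then obtain M where M: "M \<ge> 0" "\<And>v x. norm v = 1 \<Longrightarrow> x \<in> ?B \<Longrightarrow> \<bar>(dir_deriv v ^^ m) \<phi> x\<bar> \<le> M"
    using funpow_dir_deriv_bounded[of ?B m \<phi>] by auto
  have radial: "i \<le> m \<Longrightarrow> 0 \<le> s \<Longrightarrow> s < 1 \<Longrightarrow> \<bar>(dir_deriv v ^^ (m - i)) \<phi> (s *\<^sub>R v)\<bar> \<le> M * (1 - s) ^ i"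
    if v: "norm v = 1" for v :: 'a and s i
  proof (induction i arbitrary: s)
    case 0 then show ?case using M(2)[OF v, of "s *\<^sub>R v"] v by simp
  next
    case (Suc i)
    define j where "j = m - Suc i"
    have j: "j < m" "m - i = Suc j" using Suc.prems by (auto simp: j_def)
    define E where "E = (dir_deriv v ^^ j) \<phi>"
    have suE: "smooth_upto (Suc 0) ?B E" unfolding E_def
      by (rule smooth_upto_dir_deriv_funpow[OF open_ball])
         (rule smooth_upto_mono[OF su], use j in simp)
    obtain h where h: "continuous_on (cball 0 1) h" "\<And>x. x \<in> ?B \<Longrightarrow> h x = E x"
      using smooth_upto_extends[OF suE] by (auto simp: closure_unit_ball)
    \<comment> \<open>As \<open>v\<close> is a limit point of the ball, the \<open>Lim\<close>
      inside \<open>normal_deriv\<close> is the limit of \<open>E\<close>, that is, the value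
      \<open>h v\<close> of its continuous extension.\<close>
    have vB: "v islimpt ?B" using v by (simp add: islimpt_ball)
    have "(h \<longlongrightarrow> h v) (at v within cball 0 1)" using h(1) v by (auto simp: continuous_on_def)
    then have "(h \<longlongrightarrow> h v) (at v within ?B)" by (rule tendsto_within_subset) auto
    then have "(E \<longlongrightarrow> h v) (at v within ?B)"
      by (rule Lim_transform_eventually) (auto simp: eventually_at_filter h(2))
    then have "Lim (at v within ?B) E = h v"
      using vB by (intro tendsto_Lim) (auto simp: trivial_limit_within)
    then have hv: "h v = 0"
      using nd[OF j(1) v] by (simp add: normal_deriv_def outward_normal_unit_ball[OF v] E_def)
    have cont: "continuous_on {s..1} (\<lambda>r. h (r *\<^sub>R v))"
      by (rule continuous_on_compose2[OF h(1)]) (use v Suc.prems in \<open>auto intro!: continuous_intros\<close>)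
    have der: "((\<lambda>r. h (r *\<^sub>R v)) has_derivative (\<lambda>t. t * (dir_deriv v ^^ Suc j) \<phi> (r *\<^sub>R v))) (at r)"
      if r: "s < r" "r < 1" for r
    proof -
      have rB: "r *\<^sub>R v \<in> ?B" using v r Suc.prems by auto
      have "((\<lambda>r. E (0 + r *\<^sub>R v)) has_vector_derivative dir_deriv v E (0 + r *\<^sub>R v)) (at r)"
        by (rule dir_deriv_line) (use suE rB in auto)
      then have d: "((\<lambda>r. E (r *\<^sub>R v)) has_derivative (\<lambda>t. t * (dir_deriv v ^^ Suc j) \<phi> (r *\<^sub>R v))) (at r)"
        by (simp add: has_vector_derivative_def E_def)
      show ?thesis
        by (rule has_derivative_transform_within_open[OF d, of "{s<..<1}"])
           (use r v Suc.prems h(2) in auto)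
    qed
    obtain r where r: "s < r" "r < 1" "h (1 *\<^sub>R v) - h (s *\<^sub>R v) = (1 - s) * (dir_deriv v ^^ Suc j) \<phi> (r *\<^sub>R v)"
      using mvt[OF Suc.prems(3) cont der] by auto
    have "\<bar>(dir_deriv v ^^ (m - i)) \<phi> (r *\<^sub>R v)\<bar> \<le> M * (1 - r) ^ i"
      using Suc.IH[of r] Suc.prems r by auto
    also have "\<dots> \<le> M * (1 - s) ^ i" using M(1) r Suc.prems by (intro mult_left_mono power_mono) auto
    finally have b: "\<bar>(dir_deriv v ^^ Suc j) \<phi> (r *\<^sub>R v)\<bar> \<le> M * (1 - s) ^ i" using j(2) by simp
    have "s *\<^sub>R v \<in> ?B" using v Suc.prems by auto
    then have "\<bar>E (s *\<^sub>R v)\<bar> = \<bar>h (1 *\<^sub>R v) - h (s *\<^sub>R v)\<bar>" using h(2) hv by simp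
    also have "\<dots> = (1 - s) * \<bar>(dir_deriv v ^^ Suc j) \<phi> (r *\<^sub>R v)\<bar>"
      unfolding r(3) abs_mult using Suc.prems by simp
    also have "\<dots> \<le> (1 - s) * (M * (1 - s) ^ i)" using b Suc.prems by (intro mult_left_mono) auto
    finally show ?case by (simp add: E_def j_def mult_ac)
  qed
  \<comment> \<open>The centre lies on every radius, so any unit vector serves there.\<close>
  obtain v0 :: 'a where v0: "norm v0 = 1" using vector_choose_size[of 1] by auto
  have "\<bar>\<phi> x\<bar> \<le> M * (1 - norm x) ^ m" if x: "x \<in> ?B" for x
  proof (cases "x = 0")
    case True then show ?thesis using radial[OF v0, of m 0] by simp
  next
    case False
    then show ?thesis using radial[of "x /\<^sub>R norm x" m "norm x"] x by simp
  qed
  then show ?thesis using M(1) by blast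
qed

text \<open>The difference quotients of the extension of \<open>F\<close> by zero have integral zero, by translation
  invariance.\<close>

lemma integral_dir_deriv_unit_ball:
  fixes F :: "'a::euclidean_space \<Rightarrow> real"
  assumes diff: "\<And>x. x \<in> ball 0 1 \<Longrightarrow> F differentiable (at x)"
    and cont: "continuous_on (ball 0 1) (dir_deriv v F)"
    and L: "\<And>x. x \<in> ball 0 1 \<Longrightarrow> \<bar>dir_deriv v F x\<bar> \<le> L"
    and C: "\<And>x. x \<in> ball 0 1 \<Longrightarrow> \<bar>F x\<bar> \<le> C * (1 - norm x)"
    and v: "norm v = 1"
  shows "(LINT x:ball 0 1|lebesgue. dir_deriv v F x) = 0"
proof -
  let ?B = "ball (0::'a) 1"
  define F0 where "F0 = (\<lambda>x. indicator ?B x * F x)"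
  define g where "g = (\<lambda>x. indicator ?B x * dir_deriv v F x)"
  have contF: "continuous_on ?B F"
    by (intro continuous_at_imp_continuous_on ballI differentiable_imp_continuous_within diff)
  have mF0: "F0 \<in> borel_measurable borel"
    unfolding F0_def using borel_measurable_continuous_on_indicator[of ?B F] contF by simp
  have mg: "g \<in> borel_measurable borel"
    unfolding g_def using borel_measurable_continuous_on_indicator[of ?B "dir_deriv v F"] cont by simp
  have L0: "L \<ge> 0" using L[of 0] by auto
  have C0: "C \<ge> 0" using C[of 0] by auto
  define K where "K = max L C"
  have K: "L \<le> K" "C \<le> K" "0 \<le> K" using L0 by (auto simp: K_def)
  \<comment> \<open>The extension by zero is Lipschitz in the direction \<open>v\<close>: inside the
    ball by the mean value theorem, across the sphere because |F| is at most C times the distance to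
    the sphere, and that distance is at most h. This supplies the majorant of the difference
    quotients.\<close>
  have lip: "\<bar>F0 (x + h *\<^sub>R v) - F0 x\<bar> \<le> K * h" if h: "h > 0" for x h
  proof -
    have out: "\<bar>F y\<bar> \<le> K * h" if y: "y \<in> ?B" "z \<notin> ?B" "norm (z - y) = h" for y z
    proof -
      have "1 - norm y \<le> norm (z - y)" using y norm_triangle_ineq2[of z y] by auto
      then have "C * (1 - norm y) \<le> K * h" using K y by (intro mult_mono) auto
      then show ?thesis using C[OF y(1)] by linarith
    qed
    consider "x \<in> ?B" "x + h *\<^sub>R v \<in> ?B" | "x \<in> ?B" "x + h *\<^sub>R v \<notin> ?B"
      | "x \<notin> ?B" "x + h *\<^sub>R v \<in> ?B" | "x \<notin> ?B" "x + h *\<^sub>R v \<notin> ?B" by blast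
    then show ?thesis
    proof cases
      case 1
      have seg: "x + r *\<^sub>R v \<in> ?B" if "0 \<le> r" "r \<le> h" for r
      proof -
        have "x + r *\<^sub>R v = (1 - r / h) *\<^sub>R x + (r / h) *\<^sub>R (x + h *\<^sub>R v)"
          using h by (simp add: algebra_simps)
        then show ?thesis
          using convexD_alt[OF convex_ball[of 0 1] 1, of "r / h"] that h by (simp add: field_simps)
      qed
      have der: "((\<lambda>r. F (x + r *\<^sub>R v)) has_derivative (\<lambda>t. t * dir_deriv v F (x + r *\<^sub>R v))) (at r)"
        if "0 \<le> r" "r \<le> h" for r
        using dir_deriv_line[OF diff[OF seg[OF that]]] by (simp add: has_vector_derivative_def)
      have "continuous_on {0..h} (\<lambda>r. F (x + r *\<^sub>R v))"
        by (rule continuous_at_imp_continuous_on) (use der in \<open>auto intro!: has_derivative_continuous\<close>)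
      from mvt[OF h this der] obtain r where r: "0 < r" "r < h"
        "F (x + h *\<^sub>R v) - F (x + 0 *\<^sub>R v) = (h - 0) * dir_deriv v F (x + r *\<^sub>R v)" by (auto simp: less_imp_le)
      have "\<bar>dir_deriv v F (x + r *\<^sub>R v)\<bar> \<le> K" using L[OF seg[of r]] r K by auto
      then have "h * \<bar>dir_deriv v F (x + r *\<^sub>R v)\<bar> \<le> h * K" using h by simp
      then show ?thesis using 1 r(3) h by (simp add: F0_def abs_mult mult_ac)
    next
      case 2 then show ?thesis using out[of x "x + h *\<^sub>R v"] h v by (simp add: F0_def)
    next
      case 3 then show ?thesis using out[of "x + h *\<^sub>R v" x] h v by (simp add: F0_def)
    next
      case 4 then show ?thesis using K h by (simp add: F0_def)
    qed
  qed
  define h :: "nat \<Rightarrow> real" where "h k = inverse (real (Suc k))" for k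
  have h: "h k > 0" "h k \<le> 1" for k by (auto simp: h_def field_simps)
  have h0: "h \<longlonglongrightarrow> 0" unfolding h_def by (rule LIMSEQ_inverse_real_of_nat)
  define q where "q k x = (F0 (x + h k *\<^sub>R v) - F0 x) / h k" for k x
  have qb: "norm (q k x) \<le> K * indicator (ball 0 2) x" for k x
  proof (cases "x \<in> ball 0 2")
    case True
    have "\<bar>q k x\<bar> \<le> K * h k / h k"
      unfolding q_def abs_divide using lip[OF h(1)[of k], of x] h(1)[of k]
      by (intro divide_mono) auto
    then show ?thesis using True h(1)[of k] by simp
  next
    case False
    have "norm x \<le> norm (x + h k *\<^sub>R v) + norm (h k *\<^sub>R v)"
      using norm_triangle_ineq4[of "x + h k *\<^sub>R v" "h k *\<^sub>R v"] by simp
    then have "norm (x + h k *\<^sub>R v) \<ge> 1" using False v h[of k] by auto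
    then show ?thesis using False by (simp add: q_def F0_def)
  qed
  have intI: "integrable lborel (\<lambda>x. c * indicator (ball (0::'a) r) x :: real)" for c r :: real
    by (intro integrable_mult_right integrable_real_indicator emeasure_bounded_finite) auto
  have intF: "integrable lborel F0"
  proof (rule Bochner_Integration.integrable_bound[OF intI[of C 1]])
    show "AE x in lborel. norm (F0 x) \<le> norm (C * indicator ?B x)"
    proof (rule AE_I2)
      fix x :: 'a
      have "C * (1 - norm x) \<le> C" using C0 by (simp add: algebra_simps)
      then show "norm (F0 x) \<le> norm (C * indicator ?B x)"
        using C[of x] C0 by (auto simp: F0_def split: split_indicator)
    qed
  qed (use mF0 in simp)
  have shift: "integrable lborel (\<lambda>x. F0 (x + c))" "(\<integral>x. F0 (x + c) \<partial>lborel) = (\<integral>x. F0 x \<partial>lborel)" for c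
  proof -
    have c: "(\<lambda>x. x + c) = (+) c" by (auto simp: add.commute)
    have d: "distr lborel borel (\<lambda>x. x + c) = (lborel :: 'a measure)"
      unfolding c by (rule lborel_distr_plus)
    have m: "(\<lambda>x. x + c) \<in> borel_measurable (lborel :: 'a measure)" by simp
    show "integrable lborel (\<lambda>x. F0 (x + c))"
      using integrable_distr_eq[OF m, of F0] intF mF0 unfolding d by simp
    show "(\<integral>x. F0 (x + c) \<partial>lborel) = (\<integral>x. F0 x \<partial>lborel)"
      using integral_distr[OF m, of F0] mF0 unfolding d by simp
  qed
  have q0: "(\<integral>x. q k x \<partial>lborel) = 0" for k
    unfolding q_def using shift[of "h k *\<^sub>R v"] intF by simp
  have mq: "q k \<in> borel_measurable lborel" for k
    unfolding q_def using mF0 by measurable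
  have sphere: "AE x in lborel. x \<notin> sphere (0::'a) 1"
    using negligible_sphere[of "0::'a" 1]
    by (intro AE_not_in) (simp add: negligible_iff_null_sets null_sets_completion_iff)
  have lim: "(\<lambda>k. q k x) \<longlonglongrightarrow> g x" if x: "x \<notin> sphere 0 1" for x
  proof -
    have sh: "(\<lambda>k. x + h k *\<^sub>R v) \<longlonglongrightarrow> x" using tendsto_add[OF tendsto_const tendsto_scaleR[OF h0 tendsto_const]] by simp
    consider "x \<in> ?B" | "x \<in> - cball 0 1" using x by fastforce
    then show ?thesis
    proof cases
      case 1
      have "((\<lambda>s. F (x + s *\<^sub>R v)) has_vector_derivative dir_deriv v F x) (at 0)"
        using dir_deriv_line[of F x 0 v] diff[OF 1] by simp
      then have "((\<lambda>s. F (x + s *\<^sub>R v)) has_real_derivative dir_deriv v F x) (at 0)"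
        by (simp add: has_real_derivative_iff_has_vector_derivative)
      then have "((\<lambda>s. (F (x + s *\<^sub>R v) - F x) / s) \<longlongrightarrow> dir_deriv v F x) (at 0)"
        by (simp add: DERIV_def)
      moreover have "filterlim h (at 0) sequentially"
        using h0 h(1) by (auto simp: filterlim_at less_imp_neq[symmetric])
      ultimately have "(\<lambda>k. (F (x + h k *\<^sub>R v) - F x) / h k) \<longlonglongrightarrow> dir_deriv v F x"
        by (rule filterlim_compose)
      moreover have "\<forall>\<^sub>F k in sequentially. x + h k *\<^sub>R v \<in> ?B"
        using topological_tendstoD[OF sh open_ball 1] .
      then have "\<forall>\<^sub>F k in sequentially. (F (x + h k *\<^sub>R v) - F x) / h k = q k x"
        by eventually_elim (use 1 in \<open>simp add: q_def F0_def\<close>)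
      ultimately show ?thesis using 1 by (simp add: g_def Lim_transform_eventually)
    next
      case 2
      have "\<forall>\<^sub>F k in sequentially. x + h k *\<^sub>R v \<in> - cball 0 1"
        using topological_tendstoD[OF sh _ 2] by blast
      then have "\<forall>\<^sub>F k in sequentially. 0 = q k x"
        by eventually_elim (use 2 in \<open>simp add: q_def F0_def\<close>)
      from Lim_transform_eventually[OF tendsto_const this] show ?thesis using 2 by (simp add: g_def)
    qed
  qed
  have "(\<lambda>k. \<integral>x. q k x \<partial>lborel) \<longlonglongrightarrow> (\<integral>x. g x \<partial>lborel)"
  proof (rule integral_dominated_convergence[OF _ mq intI[of K 2]])
    show "AE x in lborel. (\<lambda>k. q k x) \<longlonglongrightarrow> g x" using sphere by eventually_elim (rule lim)
  qed (use mg qb in auto)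
  then have "(\<integral>x. g x \<partial>lborel) = 0" using q0 LIMSEQ_unique[OF tendsto_const] by (simp add: LIMSEQ_const_iff)
  then show ?thesis unfolding set_lebesgue_integral_def
    using integral_completion[of g lborel] mg by (simp add: g_def)
qed

section \<open>Integration by parts on the ball\<close>

lemma smooth_upto_set_integrable:
  fixes f :: "'a::euclidean_space \<Rightarrow> real"
  assumes "open S" "bounded S" "smooth_upto k S f"
  shows "set_integrable lebesgue S f"
proof -
  obtain M where M: "0 \<le> M" "\<And>x. x \<in> S \<Longrightarrow> norm (f x) \<le> M"
    using smooth_upto_bounded[OF assms(3,2)] by blast
  have m: "(\<lambda>x. indicator S x *\<^sub>R f x) \<in> borel_measurable borel"
    using assms(1) smooth_upto_continuous_on[OF assms(3)]
    by (intro borel_measurable_continuous_on_indicator) auto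
  have "integrable lborel (\<lambda>x. indicator S x *\<^sub>R f x)"
  proof (rule Bochner_Integration.integrable_bound)
    show "integrable lborel (\<lambda>x. M * indicator S x :: real)"
      using assms by (intro integrable_mult_right integrable_real_indicator emeasure_bounded_finite) auto
  qed (use m M in \<open>auto split: split_indicator\<close>)
  then show ?thesis unfolding set_integrable_def using m by (simp add: integrable_completion)
qed

lemma set_integral_sum:
  fixes f :: "'i \<Rightarrow> 'a \<Rightarrow> real"
  assumes "finite I" "\<And>i. i \<in> I \<Longrightarrow> set_integrable M A (f i)"
  shows "(LINT x:A|M. \<Sum>i\<in>I. f i x) = (\<Sum>i\<in>I. LINT x:A|M. f i x)"
  using assms unfolding set_lebesgue_integral_def set_integrable_def scaleR_sum_right
  by (intro Bochner_Integration.integral_sum)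

lemma integration_by_parts_unit_ball:
  fixes f g :: "'a::euclidean_space \<Rightarrow> real"
  assumes f: "smooth_upto 1 (ball 0 1) f" and g: "smooth_upto 1 (ball 0 1) g"
    and C: "\<And>x. x \<in> ball 0 1 \<Longrightarrow> \<bar>f x\<bar> \<le> C * (1 - norm x)" and b: "b \<in> Basis"
  shows "(LINT x:ball 0 1|lebesgue. f x * dir_deriv b g x) = - (LINT x:ball 0 1|lebesgue. dir_deriv b f x * g x)"
proof -
  let ?B = "ball (0::'a) 1"
  have fg: "smooth_upto (Suc 0) ?B f" "smooth_upto (Suc 0) ?B g" using f g by simp_all
  have dfg: "smooth_upto 0 ?B (dir_deriv b f)" "smooth_upto 0 ?B (dir_deriv b g)"
    using smooth_upto_dir_deriv[OF fg(1) b] smooth_upto_dir_deriv[OF fg(2) b] .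
  have fg0: "smooth_upto 0 ?B f" "smooth_upto 0 ?B g" using fg smooth_upto_Suc_D by blast+
  have p: "smooth_upto (Suc 0) ?B (\<lambda>x. f x * g x)" using fg by (rule smooth_upto_mult[OF open_ball])
  have dp: "smooth_upto 0 ?B (dir_deriv b (\<lambda>x. f x * g x))" using smooth_upto_dir_deriv[OF p b] .
  obtain M where M: "0 \<le> M" "\<And>x. x \<in> ?B \<Longrightarrow> norm (g x) \<le> M"
    using smooth_upto_bounded[OF g bounded_ball] by blast
  obtain L where L: "0 \<le> L" "\<And>x. x \<in> ?B \<Longrightarrow> norm (dir_deriv b (\<lambda>x. f x * g x) x) \<le> L"
    using smooth_upto_bounded[OF dp bounded_ball] by blast
  have "(LINT x:?B|lebesgue. dir_deriv b (\<lambda>x. f x * g x) x) = 0"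
  proof (rule integral_dir_deriv_unit_ball)
    show "\<bar>f x * g x\<bar> \<le> (C * M) * (1 - norm x)" if "x \<in> ?B" for x
      using mult_mono[OF C[OF that] M(2)[OF that]] C[OF that] abs_ge_zero[of "f x"] by (simp add: abs_mult mult_ac)
  qed (use p L b smooth_upto_continuous_on[OF dp] in auto)
  moreover have "(LINT x:?B|lebesgue. dir_deriv b (\<lambda>x. f x * g x) x) =
      (LINT x:?B|lebesgue. f x * dir_deriv b g x + dir_deriv b f x * g x)"
    using fg by (intro set_lebesgue_integral_cong) (auto simp: dir_deriv_mult)
  moreover have "\<dots> = (LINT x:?B|lebesgue. f x * dir_deriv b g x) + (LINT x:?B|lebesgue. dir_deriv b f x * g x)"
    by (intro set_integral_add smooth_upto_set_integrable[OF open_ball bounded_ball, where k=0] smooth_upto_mult[OF open_ball] fg0 dfg)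
  ultimately show ?thesis by simp
qed

text \<open>Two integrations by parts. The boundary term of the first is removed by the decay of
  \<open>U\<close>, that of the second by the decay of its first derivatives, so \<Phi> may be
  arbitrary on the sphere.\<close>

lemma laplacian_by_parts_unit_ball:
  fixes U \<Phi> :: "'a::euclidean_space \<Rightarrow> real"
  assumes U: "smooth_upto 2 (ball 0 1) U" and \<Phi>: "smooth_upto 2 (ball 0 1) \<Phi>"
    and C: "\<And>x. x \<in> ball 0 1 \<Longrightarrow> \<bar>U x\<bar> \<le> C * (1 - norm x)"
    and D: "\<And>b x. b \<in> Basis \<Longrightarrow> x \<in> ball 0 1 \<Longrightarrow> \<bar>dir_deriv b U x\<bar> \<le> D b * (1 - norm x)"
  shows "(LINT x:ball 0 1|lebesgue. U x * laplacian \<Phi> x) = (LINT x:ball 0 1|lebesgue. laplacian U x * \<Phi> x)"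
proof -
  let ?B = "ball (0::'a) 1"
  have 2: "smooth_upto (Suc 1) ?B U" "smooth_upto (Suc 1) ?B \<Phi>" using U \<Phi> by (simp_all add: numeral_2_eq_2)
  have d: "smooth_upto 1 ?B (dir_deriv b U)" "smooth_upto 1 ?B (dir_deriv b \<Phi>)" if "b \<in> Basis" for b
    using 2 that smooth_upto_dir_deriv by blast+
  have dd: "smooth_upto 0 ?B (dir_deriv b (dir_deriv b U))" "smooth_upto 0 ?B (dir_deriv b (dir_deriv b \<Phi>))" if "b \<in> Basis" for b
    using d[OF that] that by (auto simp del: smooth_upto.simps simp: smooth_upto_dir_deriv)
  have z: "smooth_upto 0 ?B U" "smooth_upto 0 ?B \<Phi>" "smooth_upto 1 ?B U" "smooth_upto 1 ?B \<Phi>"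
    using smooth_upto_mono[OF U] smooth_upto_mono[OF \<Phi>] by (simp_all del: smooth_upto.simps)
  have e: "(LINT x:?B|lebesgue. U x * dir_deriv b (dir_deriv b \<Phi>) x) =
      (LINT x:?B|lebesgue. dir_deriv b (dir_deriv b U) x * \<Phi> x)" if b: "b \<in> Basis" for b
    using integration_by_parts_unit_ball[OF z(3) d(2)[OF b] C b]
      integration_by_parts_unit_ball[OF d(1)[OF b] z(4) D[OF b] b] by simp
  have "(LINT x:?B|lebesgue. U x * laplacian \<Phi> x) = (\<Sum>b\<in>Basis. LINT x:?B|lebesgue. U x * dir_deriv b (dir_deriv b \<Phi>) x)"
    unfolding laplacian_def sum_distrib_left
    by (intro set_integral_sum finite_Basis smooth_upto_set_integrable[OF open_ball bounded_ball, where k=0]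
          smooth_upto_mult[OF open_ball] z dd)
  also have "\<dots> = (\<Sum>b\<in>Basis. LINT x:?B|lebesgue. dir_deriv b (dir_deriv b U) x * \<Phi> x)"
    using e by simp
  also have "\<dots> = (LINT x:?B|lebesgue. laplacian U x * \<Phi> x)"
    unfolding laplacian_def sum_distrib_right
    by (intro set_integral_sum[symmetric] finite_Basis smooth_upto_set_integrable[OF open_ball bounded_ball, where k=0]
          smooth_upto_mult[OF open_ball] z dd)
  finally show ?thesis .
qed

text \<open>The chain \<open>V\<close> stands for the iterated negative Laplacians of
  \<open>V 0\<close>. Stating it as a given sequence lets the decay of every member and of its
  gradient be read off explicit formulas, while \<phi> is only asked to be smooth.\<close>

lemma polylaplacian_by_parts_unit_ball:
  fixes V :: "nat \<Rightarrow> 'a::euclidean_space \<Rightarrow> real"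
  assumes V: "\<And>l. l < m \<Longrightarrow> smooth_upto 2 (ball 0 1) (V l)"
    and C: "\<And>l. l < m \<Longrightarrow> \<exists>C. \<forall>x\<in>ball 0 1. \<bar>V l x\<bar> \<le> C * (1 - norm x)"
    and D: "\<And>l b. l < m \<Longrightarrow> b \<in> Basis \<Longrightarrow> \<exists>C. \<forall>x\<in>ball 0 1. \<bar>dir_deriv b (V l) x\<bar> \<le> C * (1 - norm x)"
    and step: "\<And>l x. l < m \<Longrightarrow> x \<in> ball 0 1 \<Longrightarrow> V (Suc l) x = - laplacian (V l) x"
    and \<phi>: "smooth_upto (2 * m) (ball 0 1) \<phi>"
  shows "(LINT x:ball 0 1|lebesgue. V 0 x * polylaplacian m \<phi> x) = (LINT x:ball 0 1|lebesgue. V m x * \<phi> x)"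
proof -
  let ?B = "ball (0::'a) 1"
  have "l \<le> m \<Longrightarrow> (LINT x:?B|lebesgue. V 0 x * polylaplacian m \<phi> x) = (LINT x:?B|lebesgue. V l x * polylaplacian (m - l) \<phi> x)" for l
  proof (induction l)
    case (Suc l)
    then have l: "l < m" "m - l = Suc (m - Suc l)" by auto
    let ?\<Phi> = "polylaplacian (m - Suc l) \<phi>"
    obtain C' where C': "\<And>x. x \<in> ?B \<Longrightarrow> \<bar>V l x\<bar> \<le> C' * (1 - norm x)" using C[OF l(1)] by blast
    obtain D' where D': "\<And>b x. b \<in> Basis \<Longrightarrow> x \<in> ?B \<Longrightarrow> \<bar>dir_deriv b (V l) x\<bar> \<le> D' b * (1 - norm x)"
      using D[OF l(1)] by metis
    have \<Phi>: "smooth_upto 2 ?B ?\<Phi>"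
      by (rule smooth_upto_polylaplacian[OF open_ball], rule smooth_upto_mono[OF \<phi>]) (use l in auto)
    have "(LINT x:?B|lebesgue. V 0 x * polylaplacian m \<phi> x) = (LINT x:?B|lebesgue. V l x * polylaplacian (m - l) \<phi> x)"
      using Suc by simp
    also have "\<dots> = - (LINT x:?B|lebesgue. V l x * laplacian ?\<Phi> x)"
      unfolding l(2) polylaplacian_Suc set_lebesgue_integral_def by simp
    also have "\<dots> = - (LINT x:?B|lebesgue. laplacian (V l) x * ?\<Phi> x)"
      using laplacian_by_parts_unit_ball[OF V[OF l(1)] \<Phi> C' D'] by simp
    also have "\<dots> = (LINT x:?B|lebesgue. - (laplacian (V l) x * ?\<Phi> x))"
      unfolding set_lebesgue_integral_def by simp
    also have "\<dots> = (LINT x:?B|lebesgue. V (Suc l) x * ?\<Phi> x)"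
      using step[OF l(1)] by (intro set_lebesgue_integral_cong) auto
    finally show ?case .
  qed simp
  from this[of m] show ?thesis by simp
qed

section \<open>Moebius factors and the family of functions they generate\<close>

definition moebQ :: "'a::euclidean_space \<Rightarrow> 'a \<Rightarrow> real" where
  "moebQ y x = 1 - 2 * (x \<bullet> y) + (norm x)\<^sup>2 * (norm y)\<^sup>2"

definition moebr :: "'a::euclidean_space \<Rightarrow> 'a \<Rightarrow> real" where
  "moebr y x = (norm (x - y))\<^sup>2 / moebQ y x"

text \<open>The conformal factor of the automorphism is (1 - |y|^2) / Q, so \<open>c\<close> is a
  conformal weight. For y \<noteq> 0 one has Q = |y|^2 |x - y/|y|^2|^2; the polynomial form of
  \<open>moebQ\<close> avoids the reflected point and includes the case y = 0.\<close>

definition moebU :: "'a::euclidean_space \<Rightarrow> real \<Rightarrow> real poly \<Rightarrow> 'a \<Rightarrow> real" where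
  "moebU y c g x = moebQ y x powr (- c) * poly g (moebr y x)"

lemma moebQ_eq: "moebQ y x = (norm (x - y))\<^sup>2 + (1 - (norm x)\<^sup>2) * (1 - (norm y)\<^sup>2)"
  by (simp add: moebQ_def power2_norm_eq_inner algebra_simps inner_commute)

lemma moebQ_ge: "(1 - norm x * norm y)\<^sup>2 \<le> moebQ y x"
proof -
  have "x \<bullet> y \<le> norm x * norm y" by (rule norm_cauchy_schwarz)
  then show ?thesis by (simp add: moebQ_def power2_diff power_mult_distrib)
qed

lemma moebQ_pos:
  assumes "norm x \<le> 1" "norm y < 1" shows "moebQ y x > 0"
proof -
  have "norm x * norm y < 1" using assms by (metis mult_left_le_one_le norm_ge_zero order.strict_trans1)
  then have "(1 - norm x * norm y)\<^sup>2 > 0" by simp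
  then show ?thesis using moebQ_ge[of x y] by linarith
qed

lemma one_minus_moebr:
  assumes "norm x \<le> 1" "norm y < 1"
  shows "1 - moebr y x = (1 - (norm x)\<^sup>2) * (1 - (norm y)\<^sup>2) / moebQ y x"
  using moebQ_pos[OF assms] moebQ_eq[of y x] by (simp add: moebr_def field_simps)

lemma moebr_range:
  assumes "norm x \<le> 1" "norm y < 1"
  shows "0 \<le> moebr y x" "moebr y x \<le> 1"
proof -
  show "0 \<le> moebr y x" using moebQ_pos[OF assms] by (simp add: moebr_def)
  have "(norm x)\<^sup>2 \<le> 1" "(norm y)\<^sup>2 \<le> 1" using assms by (auto simp: power_le_one)
  then have "0 \<le> 1 - moebr y x"
    unfolding one_minus_moebr[OF assms] using moebQ_pos[OF assms] by (intro divide_nonneg_nonneg mult_nonneg_nonneg) auto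
  then show "moebr y x \<le> 1" by simp
qed

lemma moebr_less_1:
  assumes "norm x < 1" "norm y < 1" shows "moebr y x < 1"
proof -
  have "(norm x)\<^sup>2 < 1" "(norm y)\<^sup>2 < 1" using assms by (auto simp: power_less_one_iff abs_square_less_1)
  then have "0 < 1 - moebr y x"
    using one_minus_moebr[of x y] moebQ_pos[of x y] assms by (auto intro!: divide_pos_pos mult_pos_pos)
  then show ?thesis by simp
qed

text \<open>Differentiation stays within the family: it raises the weight by one and brings in
  factors affine in \<open>x\<close>. The first summand comes from the gradient of Q, the second
  from that of |x - y|^2. Smoothness of every order then follows by induction.\<close>

lemma has_derivative_moebU:
  fixes x y :: "'a::euclidean_space"
  assumes "moebQ y x > 0"
  shows "(moebU y c g has_derivative (\<lambda>v.
     2 * ((norm y)\<^sup>2 * (x \<bullet> v) - y \<bullet> v) * moebU y (c + 1) (- smult c g - pCons 0 (pderiv g)) x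
     + 2 * ((x - y) \<bullet> v) * moebU y (c + 1) (pderiv g) x)) (at x)"
proof -
  let ?Q = "moebQ y x"
  have dQ: "(moebQ y has_derivative (\<lambda>v. 2 * ((norm y)\<^sup>2 * (x \<bullet> v) - y \<bullet> v))) (at x)"
    unfolding moebQ_def[abs_def] power2_norm_eq_inner
    by (auto intro!: derivative_eq_intros simp: inner_commute algebra_simps)
  have dN: "((\<lambda>x. (norm (x - y))\<^sup>2) has_derivative (\<lambda>v. 2 * ((x - y) \<bullet> v))) (at x)"
    unfolding power2_norm_eq_inner
    by (auto intro!: derivative_eq_intros simp: inner_commute algebra_simps)
  have dP: "((\<lambda>x. moebQ y x powr (- c)) has_derivative
      (\<lambda>v. - c * ?Q powr (- c - 1) * (2 * ((norm y)\<^sup>2 * (x \<bullet> v) - y \<bullet> v)))) (at x)"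
    by (rule has_derivative_eq_rhs[OF has_derivative_powr[OF dQ has_derivative_const[of "- c"] assms UNIV_I]])
       (use assms in \<open>auto simp: fun_eq_iff powr_diff field_simps\<close>)
  have dr: "(moebr y has_derivative (\<lambda>v. (2 * ((x - y) \<bullet> v) - moebr y x * (2 * ((norm y)\<^sup>2 * (x \<bullet> v) - y \<bullet> v))) / ?Q)) (at x)"
    unfolding moebr_def[abs_def] using assms
    by (rule_tac has_derivative_eq_rhs[OF has_derivative_divide'[OF dN dQ]])
       (auto simp: field_simps power2_eq_square)
  have dg: "((\<lambda>x. poly g (moebr y x)) has_derivative (\<lambda>v. poly (pderiv g) (moebr y x) *
      ((2 * ((x - y) \<bullet> v) - moebr y x * (2 * ((norm y)\<^sup>2 * (x \<bullet> v) - y \<bullet> v))) / ?Q))) (at x)"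
    using has_derivative_compose[OF dr poly_DERIV[of g "moebr y x", unfolded has_field_derivative_def]] by simp
  have pw: "?Q powr (- c - 1) = ?Q powr (-c) / ?Q" using assms by (simp add: powr_diff)
  have pw': "?Q powr (- (c + 1)) = ?Q powr (-c) / ?Q" "?Q powr (- 1 - c) = ?Q powr (-c) / ?Q"
    using pw by (simp_all add: minus_diff_commute)
  show ?thesis
    unfolding moebU_def[abs_def]
    by (rule has_derivative_eq_rhs[OF has_derivative_mult[OF dP dg]])
       (use assms in \<open>auto simp: fun_eq_iff pw pw' field_simps\<close>)
qed

lemma smooth_upto_inner_const: "smooth_upto k S (\<lambda>x. x \<bullet> v)"
proof (cases k)
  case 0 then show ?thesis by (auto intro!: exI[of _ "\<lambda>x. x \<bullet> v"] continuous_intros)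
next
  case (Suc l)
  have d: "((\<lambda>x. x \<bullet> v) has_derivative (\<lambda>h. h \<bullet> v)) (at x)" for x :: 'a
    by (auto intro!: derivative_eq_intros)
  then have "dir_deriv b (\<lambda>x. x \<bullet> v) = (\<lambda>x. b \<bullet> v)" for b
    using dir_deriv_eq by blast
  then show ?thesis unfolding Suc
    by (intro smooth_upto_SucI) (use d in \<open>auto simp: smooth_upto_const differentiable_def intro!: exI[of _ "\<lambda>x. x \<bullet> v"] continuous_intros\<close>)
qed

lemma smooth_upto_moebU:
  fixes y :: "'a::euclidean_space"
  assumes y: "norm y < 1"
  shows "smooth_upto k (ball 0 1) (moebU y c g)"
proof (induction k arbitrary: c g)
  have Q: "moebQ y x > 0" if "x \<in> cball 0 1" for x using moebQ_pos y that by auto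
  have d: "moebU y c g differentiable (at x)" if "x \<in> cball 0 1" for x c g
    using has_derivative_moebU[OF Q[OF that]] unfolding differentiable_def by blast
  then have ext: "\<exists>h. continuous_on (closure (ball 0 1)) h \<and> (\<forall>x\<in>ball 0 1. h x = moebU y c g x)" for c g
    by (intro exI[of _ "moebU y c g"] conjI continuous_at_imp_continuous_on ballI differentiable_imp_continuous_within)
       (auto simp: closure_unit_ball)
  case 0 show ?case using ext by simp
  case (Suc k)
  show ?case
  proof (rule smooth_upto_SucI[OF ext])
    fix b :: 'a assume b: "b \<in> Basis"
    have "smooth_upto k (ball 0 1) (\<lambda>x. (2 * (norm y)\<^sup>2 * (x \<bullet> b) + - 2 * (y \<bullet> b)) * moebU y (c + 1) (- smult c g - pCons 0 (pderiv g)) x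
        + (2 * (x \<bullet> b) + - 2 * (y \<bullet> b)) * moebU y (c + 1) (pderiv g) x)"
      by (intro smooth_upto_add[OF open_ball] smooth_upto_mult[OF open_ball] smooth_upto_const smooth_upto_inner_const Suc)
    then show "smooth_upto k (ball 0 1) (dir_deriv b (moebU y c g))"
      by (rule smooth_upto_cong[OF open_ball])
         (subst dir_deriv_eq[OF has_derivative_moebU[OF Q]], auto simp: algebra_simps)
  qed (use d in auto)
qed

section \<open>Conformal covariance of the iterated Laplacian\<close>

text \<open>For c = n/2 - 1, four times this operator is the Laplacian on radial functions g(|z|^2),
  written in the variable t = |z|^2.\<close>

definition Aop :: "real \<Rightarrow> real poly \<Rightarrow> real poly" where
  "Aop c g = pCons 0 (pderiv (pderiv g)) + smult (c + 1) (pderiv g)"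

text \<open>The part of the Laplacian that the Moebius transformation does not intertwine. It enters
  with the factor c + 1 - n/2, hence drops out for m = 1; for m \<ge> 2 it is present in
  intermediate steps and disappears only from the final one.\<close>

definition Bop :: "real \<Rightarrow> real \<Rightarrow> real poly \<Rightarrow> real poly" where
  "Bop \<eta> c g = smult \<eta> (smult c g + pCons 0 (pderiv g)) - pderiv g"

lemma dir_deriv_moebU:
  assumes "norm x < 1" "norm y < 1"
  shows "dir_deriv v (moebU y c g) x =
     2 * (((norm y)\<^sup>2 *\<^sub>R x - y) \<bullet> v) * moebU y (c + 1) (- smult c g - pCons 0 (pderiv g)) x
     + 2 * ((x - y) \<bullet> v) * moebU y (c + 1) (pderiv g) x"
  by (subst dir_deriv_eq[OF has_derivative_moebU[OF moebQ_pos]])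
     (use assms in \<open>auto simp: inner_diff_left algebra_simps\<close>)

lemma laplacian_moebU:
  fixes x y :: "'a::euclidean_space"
  assumes x: "norm x < 1" and y: "norm y < 1"
  shows "laplacian (moebU y c g) x =
     4 * (1 - (norm y)\<^sup>2)\<^sup>2 * moebU y (c + 2) (Aop c g) x
     + 4 * (c + 1 - real DIM('a) / 2) * moebU y (c + 1) (Bop ((norm y)\<^sup>2) c g) x"
proof -
  let ?B = "ball (0::'a) 1"
  define \<eta> where "\<eta> = (norm y)\<^sup>2"
  define D where "D c g = (- smult c g - pCons 0 (pderiv g) :: real poly)" for c g
  define q where "q x = 2 *\<^sub>R (\<eta> *\<^sub>R x - y)" for x :: 'a
  define r where "r x = 2 *\<^sub>R (x - y)" for x :: 'a
  have dM: "dir_deriv b (moebU y c g) z = (q z \<bullet> b) * moebU y (c + 1) (D c g) z + (r z \<bullet> b) * moebU y (c + 1) (pderiv g) z"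
    if "norm z < 1" for z b c g
    using dir_deriv_moebU[OF that y] by (simp add: q_def r_def \<eta>_def D_def)
  have diffM: "moebU y c g differentiable (at x)" for c g
    using smooth_upto_moebU[OF y, of "Suc 0" c g] x by simp
  have dq: "((\<lambda>z. q z \<bullet> b) has_derivative (\<lambda>v. 2 * \<eta> * (v \<bullet> b))) (at x)"
       "((\<lambda>z. r z \<bullet> b) has_derivative (\<lambda>v. 2 * (v \<bullet> b))) (at x)" for b
    unfolding q_def r_def by (auto intro!: derivative_eq_intros simp: algebra_simps)
  let ?M = "\<lambda>g. moebU y (c + 2) g x"
  have second: "dir_deriv b (dir_deriv b (moebU y c g)) x =
      2 * \<eta> * moebU y (c + 1) (D c g) x + 2 * moebU y (c + 1) (pderiv g) x
      + (q x \<bullet> b) * (q x \<bullet> b) * ?M (D (c + 1) (D c g))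
      + (q x \<bullet> b) * (r x \<bullet> b) * (?M (pderiv (D c g)) + ?M (D (c + 1) (pderiv g)))
      + (r x \<bullet> b) * (r x \<bullet> b) * ?M (pderiv (pderiv g))" if b: "b \<in> Basis" for b
  proof -
    have "dir_deriv b (dir_deriv b (moebU y c g)) x =
      dir_deriv b (\<lambda>z. (q z \<bullet> b) * moebU y (c + 1) (D c g) z + (r z \<bullet> b) * moebU y (c + 1) (pderiv g) z) x"
      by (rule dir_deriv_cong_open[of ?B]) (use x dM in auto)
    also have "\<dots> = (q x \<bullet> b) * dir_deriv b (moebU y (c + 1) (D c g)) x + 2 * \<eta> * moebU y (c + 1) (D c g) x
        + ((r x \<bullet> b) * dir_deriv b (moebU y (c + 1) (pderiv g)) x + 2 * moebU y (c + 1) (pderiv g) x)"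
      by (rule dir_deriv_eq[of _ "\<lambda>v. (q x \<bullet> b) * dir_deriv v (moebU y (c + 1) (D c g)) x + 2 * \<eta> * (v \<bullet> b) * moebU y (c + 1) (D c g) x
        + ((r x \<bullet> b) * dir_deriv v (moebU y (c + 1) (pderiv g)) x + 2 * (v \<bullet> b) * moebU y (c + 1) (pderiv g) x)", THEN trans])
        (use b in \<open>auto intro!: has_derivative_add has_derivative_mult dq dir_deriv_works diffM\<close>)
    also have "\<dots> = (q x \<bullet> b) * ((q x \<bullet> b) * ?M (D (c + 1) (D c g)) + (r x \<bullet> b) * ?M (pderiv (D c g))) + 2 * \<eta> * moebU y (c + 1) (D c g) x
        + ((r x \<bullet> b) * ((q x \<bullet> b) * ?M (D (c + 1) (pderiv g)) + (r x \<bullet> b) * ?M (pderiv (pderiv g))) + 2 * moebU y (c + 1) (pderiv g) x)"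
      using dM[OF x, of b "c + 1"] by (simp add: add.assoc)
    finally show ?thesis by (simp add: algebra_simps)
  qed
  define n where "n = real DIM('a)"
  define Q where "Q = moebQ y x"
  define \<rho> where "\<rho> = moebr y x"
  define P where "P = Q powr (- (c + 2))"
  have Q: "Q > 0" unfolding Q_def using moebQ_pos[of x y] x y by simp
  have P1: "moebU y (c + 1) g x = P * Q * poly g \<rho>" for g
    using Q by (simp add: moebU_def P_def Q_def \<rho>_def powr_mult_base[symmetric] powr_add[symmetric])
       (simp add: powr_diff field_simps powr_minus powr_add power2_eq_square)
  have P2: "moebU y (c + 2) g x = P * poly g \<rho>" for g
    by (simp add: moebU_def P_def Q_def \<rho>_def)
  have \<rho>Q: "\<rho> * Q = (norm (x - y))\<^sup>2" using Q by (simp add: \<rho>_def moebr_def Q_def)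
  have e1: "q x \<bullet> q x = 4 * \<eta> * Q"
    by (simp add: q_def Q_def moebQ_def \<eta>_def power2_norm_eq_inner algebra_simps inner_commute)
  have e2: "r x \<bullet> r x = 4 * \<rho> * Q"
    using \<rho>Q by (simp add: r_def power2_norm_eq_inner algebra_simps inner_commute)
  \<comment> \<open>The constant -2(1 - \<eta>)^2 is the only contribution without a factor Q. It
    multiplies the sum of the two mixed terms, which is -2 \<open>Aop c g\<close>; this gives the
    first term of the formula, and everything else collects into the second.\<close>
  have e3: "q x \<bullet> r x = 2 * Q + 2 * \<eta> * (\<rho> * Q) - 2 * (1 - \<eta>)\<^sup>2"
  proof -
    have yy: "y \<bullet> y = \<eta>" by (simp add: \<eta>_def power2_norm_eq_inner)
    have 1: "q x \<bullet> r x = 4 * (\<eta> * (x \<bullet> x) - \<eta> * (x \<bullet> y) - x \<bullet> y + y \<bullet> y)"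
      by (simp add: q_def r_def algebra_simps inner_commute)
    have 2: "Q = 1 - 2 * (x \<bullet> y) + (x \<bullet> x) * \<eta>"
      by (simp add: Q_def moebQ_def \<eta>_def power2_norm_eq_inner)
    have 3: "\<rho> * Q = x \<bullet> x - 2 * (x \<bullet> y) + y \<bullet> y"
      unfolding \<rho>Q by (simp add: power2_norm_eq_inner algebra_simps inner_commute)
    show ?thesis unfolding 1 3 unfolding 2 yy by (simp add: algebra_simps power2_eq_square)
  qed
  have "laplacian (moebU y c g) x = (\<Sum>b\<in>Basis. 2 * \<eta> * moebU y (c + 1) (D c g) x + 2 * moebU y (c + 1) (pderiv g) x
      + (q x \<bullet> b) * (q x \<bullet> b) * ?M (D (c + 1) (D c g))
      + (q x \<bullet> b) * (r x \<bullet> b) * (?M (pderiv (D c g)) + ?M (D (c + 1) (pderiv g)))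
      + (r x \<bullet> b) * (r x \<bullet> b) * ?M (pderiv (pderiv g)))"
    unfolding laplacian_def by (intro sum.cong refl second)
  also have "\<dots> = n * (2 * \<eta> * moebU y (c + 1) (D c g) x + 2 * moebU y (c + 1) (pderiv g) x)
      + (q x \<bullet> q x) * ?M (D (c + 1) (D c g))
      + (q x \<bullet> r x) * (?M (pderiv (D c g)) + ?M (D (c + 1) (pderiv g)))
      + (r x \<bullet> r x) * ?M (pderiv (pderiv g))"
    by (simp add: sum.distrib sum_distrib_right[symmetric] euclidean_inner[symmetric] n_def)
  also have "\<dots> = 4 * (1 - \<eta>)\<^sup>2 * moebU y (c + 2) (Aop c g) x
     + 4 * (c + 1 - n / 2) * moebU y (c + 1) (Bop \<eta> c g) x"
    unfolding P1 P2 e1 e2 e3 D_def Aop_def Bop_def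
    by (simp add: pderiv_minus pderiv_diff pderiv_smult pderiv_pCons) algebra
  finally show ?thesis by (simp add: \<eta>_def n_def)
qed

lemma coeff_Aop: "coeff (Aop c g) k = (real k + 1) * (real k + 1 + c) * coeff g (Suc k)"
  by (cases k) (auto simp: Aop_def coeff_pderiv coeff_pCons algebra_simps)

lemma coeff_Bop: "coeff (Bop \<eta> c g) k = \<eta> * (real k + c) * coeff g k - (real k + 1) * coeff g (Suc k)"
  by (cases k) (auto simp: Bop_def coeff_pderiv coeff_pCons algebra_simps)

text \<open>Both operators act on coefficients by explicit factors, so the identity is a comparison
  of coefficients. It allows every product of A's and B's produced by repeated Laplacians to be
  sorted into one normal form.\<close>

lemma Aop_Bop_commute: "Aop (c + 1) (Bop \<eta> c g) = Bop \<eta> (c + 2) (Aop c g)"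
  by (rule poly_eqI) (simp add: coeff_Aop coeff_Bop algebra_simps)

primrec Aiter :: "nat \<Rightarrow> real \<Rightarrow> real poly \<Rightarrow> real poly" where
  "Aiter 0 c g = g" | "Aiter (Suc i) c g = Aop (c + 2 * real i) (Aiter i c g)"

primrec Biter :: "real \<Rightarrow> nat \<Rightarrow> real \<Rightarrow> real poly \<Rightarrow> real poly" where
  "Biter \<eta> 0 c g = g" | "Biter \<eta> (Suc j) c g = Bop \<eta> (c + real j) (Biter \<eta> j c g)"

lemma Bop_Aiter: "Bop \<eta> (c + 2 * real i) (Aiter i c g) = Aiter i (c + 1) (Bop \<eta> c g)"
proof (induction i)
  case (Suc i)
  have "Bop \<eta> (c + 2 * real i + 2) (Aop (c + 2 * real i) (Aiter i c g)) =
     Aop (c + 2 * real i + 1) (Bop \<eta> (c + 2 * real i) (Aiter i c g))"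
    by (rule Aop_Bop_commute[symmetric])
  then show ?case unfolding Suc by (simp add: algebra_simps)
qed simp

definition falling :: "real \<Rightarrow> nat \<Rightarrow> real" where "falling z j = (\<Prod>i<j. z - real i)"

lemma falling_Suc: "falling z (Suc j) = falling z j * (z - real j)"
  by (simp add: falling_def)

lemma falling_shift: "falling (z + 1) (Suc j) = (z + 1) * falling z j"
  unfolding falling_def prod.lessThan_Suc_shift by simp

text \<open>Here \<open>s\<close> is c + 1 - n/2, the factor with which B first enters. For c = n/2
  - m and l = m the argument of the falling factorial is 0.\<close>

definition lapcoeff :: "real \<Rightarrow> nat \<Rightarrow> nat \<Rightarrow> real" where
  "lapcoeff s l j = real (l choose j) * falling (s + real l - 1) j"

lemma lapcoeff_0: "lapcoeff s l 0 = 1" by (simp add: lapcoeff_def falling_def)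

lemma lapcoeff_big: "j > l \<Longrightarrow> lapcoeff s l j = 0" by (simp add: lapcoeff_def)

text \<open>A weighted Pascal rule: the pure A-step keeps \<open>j\<close>, the B-step raises it and
  contributes its own factor. After multiplication by j + 1 every term becomes a multiple of
  \<open>l choose j\<close> times \<open>falling z j\<close>.\<close>

lemma lapcoeff_Suc:
  "lapcoeff s (Suc l) (Suc j) = lapcoeff s l (Suc j) + (s + 2 * real l - real j) * lapcoeff s l j"
proof -
  define z where "z = s + real l - 1"
  have a: "real (Suc j) * real (Suc l choose Suc j) = real (Suc l) * real (l choose j)"
    by (metis Suc_times_binomial of_nat_mult)
  have b: "real (Suc j) * real (l choose Suc j) = (real l - real j) * real (l choose j)"
  proof (cases "j \<le> l")
    case True then show ?thesis using a by (simp add: algebra_simps)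
  qed (simp add: binomial_eq_0)
  have z1: "s + real (Suc l) - 1 = z + 1" "s + 2 * real l - real j = z + 1 + real l - real j" by (auto simp: z_def)
  have "real (Suc j) * lapcoeff s (Suc l) (Suc j) = real (Suc l) * real (l choose j) * ((z + 1) * falling z j)"
    unfolding lapcoeff_def z1 falling_shift using a by (simp add: mult_ac)
  also have "\<dots> = (real (Suc j) * real (l choose Suc j)) * (falling z j * (z - real j)) + real (Suc j) * ((z + 1 + real l - real j) * (real (l choose j) * falling z j))"
    unfolding b by (simp add: algebra_simps)
  also have "\<dots> = real (Suc j) * (lapcoeff s l (Suc j) + (s + 2 * real l - real j) * lapcoeff s l j)"
    unfolding lapcoeff_def z_def[symmetric] z1 falling_Suc by (simp add: algebra_simps)
  finally show ?thesis by simp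
qed

text \<open>The summand with index \<open>j\<close> is \<open>A\<^sup>l\<^sup>-\<^sup>jB\<^sup>j\<close>; as \<open>A\<close> and \<open>B\<close> commute up to a shift of the
  parameter, the iterated Laplacian has a binomial expansion.\<close>

definition moebV :: "'a::euclidean_space \<Rightarrow> real \<Rightarrow> real poly \<Rightarrow> nat \<Rightarrow> 'a \<Rightarrow> real" where
  "moebV y c g l x = (\<Sum>j\<le>l. ((- 4) ^ l * lapcoeff (c + 1 - real DIM('a) / 2) l j * (1 - (norm y)\<^sup>2) ^ (2 * (l - j))) *
     moebU y (c + 2 * real l - real j) (Aiter (l - j) (c + real j) (Biter ((norm y)\<^sup>2) j c g)) x)"

lemma moebV_0: "moebV y c g 0 = moebU y c g"
  by (rule ext) (simp add: moebV_def lapcoeff_0)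

lemma moebV_Suc:
  fixes x y :: "'a::euclidean_space"
  assumes x: "norm x < 1" and y: "norm y < 1"
  shows "moebV y c g (Suc l) x = - laplacian (moebV y c g l) x"
proof -
  let ?B = "ball (0::'a) 1"
  define s where "s = c + 1 - real DIM('a) / 2"
  define \<tau> where "\<tau> = 1 - (norm y)\<^sup>2"
  define \<eta> where "\<eta> = (norm y)\<^sup>2"
  define T where "T l j = Aiter (l - j) (c + real j) (Biter \<eta> j c g)" for l j
  define k where "k l j = (- 4) ^ l * lapcoeff s l j * \<tau> ^ (2 * (l - j))" for l j
  define W where "W l j = moebU y (c + 2 * real l - real j) (T l j) x" for l j
  have su: "smooth_upto (Suc (Suc 0)) ?B (moebU y c g)" for c g by (rule smooth_upto_moebU[OF y])
  have V: "moebV y c g l = (\<lambda>x. \<Sum>j\<le>l. k l j *\<^sub>R moebU y (c + 2 * real l - real j) (T l j) x)" for l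
    by (rule ext) (simp add: moebV_def k_def T_def s_def \<tau>_def \<eta>_def)
  have lin: "laplacian (\<lambda>x. \<Sum>j\<le>l. k l j *\<^sub>R f j x) x = (\<Sum>j\<le>l. k l j *\<^sub>R laplacian (f j) x)"
    if f: "\<And>j. smooth_upto (Suc (Suc 0)) ?B (f j)" for f
  proof -
    have "dir_deriv b (dir_deriv b (\<lambda>x. \<Sum>j\<le>l. k l j *\<^sub>R f j x)) x = (\<Sum>j\<le>l. k l j *\<^sub>R dir_deriv b (dir_deriv b (f j)) x)"
      if b: "b \<in> Basis" for b
    proof -
      have f1: "smooth_upto (Suc 0) ?B (dir_deriv b (f j))" for j
        using smooth_upto_dir_deriv[OF f b] .
      have "dir_deriv b (\<lambda>x. \<Sum>j\<le>l. k l j *\<^sub>R f j x) z = (\<Sum>j\<le>l. k l j *\<^sub>R dir_deriv b (f j) z)" if "z \<in> ?B" for z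
        using smooth_upto_differentiable[OF f that]
        by (subst dir_deriv_sum) (auto simp: dir_deriv_scaleR[where 'b=real, unfolded real_scaleR_def])
      then have "dir_deriv b (dir_deriv b (\<lambda>x. \<Sum>j\<le>l. k l j *\<^sub>R f j x)) x = dir_deriv b (\<lambda>z. \<Sum>j\<le>l. k l j *\<^sub>R dir_deriv b (f j) z) x"
        using x by (intro dir_deriv_cong_open[of ?B]) auto
      also have "\<dots> = (\<Sum>j\<le>l. k l j *\<^sub>R dir_deriv b (dir_deriv b (f j)) x)"
        using smooth_upto_differentiable[OF f1, of x] x
        by (subst dir_deriv_sum) (auto simp: dir_deriv_scaleR[where 'b=real, unfolded real_scaleR_def])
      finally show ?thesis .
    qed
    then have "laplacian (\<lambda>x. \<Sum>j\<le>l. k l j *\<^sub>R f j x) x = (\<Sum>b\<in>Basis. \<Sum>j\<le>l. k l j *\<^sub>R dir_deriv b (dir_deriv b (f j)) x)"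
      unfolding laplacian_def by simp
    also have "\<dots> = (\<Sum>j\<le>l. k l j *\<^sub>R laplacian (f j) x)"
      unfolding laplacian_def scaleR_sum_right by (rule sum.swap)
    finally show ?thesis .
  qed
  have lap: "laplacian (moebU y (c + 2 * real l - real j) (T l j)) x =
      4 * \<tau>\<^sup>2 * W (Suc l) j + 4 * (s + 2 * real l - real j) * W (Suc l) (Suc j)" if "j \<le> l" for j
  proof -
    have c: "c + 2 * real l - real j = (c + real j) + 2 * real (l - j)" using that by simp
    have 1: "Aop (c + 2 * real l - real j) (T l j) = T (Suc l) j"
      unfolding c T_def using that by (simp add: Suc_diff_le)
    have 2: "Bop \<eta> (c + 2 * real l - real j) (T l j) = T (Suc l) (Suc j)"
      unfolding c T_def Bop_Aiter using that by (simp add: add_ac)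
    have 3: "c + 2 * real l - real j + 2 = c + 2 * real (Suc l) - real j" "c + 2 * real l - real j + 1 = c + 2 * real (Suc l) - real (Suc j)"
      "c + 2 * real l - real j + 1 - real DIM('a) / 2 = s + 2 * real l - real j" by (simp_all add: s_def)
    show ?thesis using laplacian_moebU[OF x y, of "c + 2 * real l - real j" "T l j"]
      unfolding \<eta>_def[symmetric] 1 2 unfolding 3 W_def by (simp add: \<tau>_def \<eta>_def s_def)
  qed
  have "- laplacian (moebV y c g l) x = - (\<Sum>j\<le>l. k l j * (4 * \<tau>\<^sup>2 * W (Suc l) j + 4 * (s + 2 * real l - real j) * W (Suc l) (Suc j)))"
    unfolding V using lap by (subst lin[OF su]) simp
  also have "\<dots> = (\<Sum>j\<le>l. (-4 * k l j * \<tau>\<^sup>2) * W (Suc l) j) + (\<Sum>j\<le>l. (-4 * k l j * (s + 2 * real l - real j)) * W (Suc l) (Suc j))"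
    unfolding sum.distrib[symmetric] sum_negf[symmetric] by (intro sum.cong) (auto simp: algebra_simps)
  \<comment> \<open>The added top term has coefficient zero by \<open>lapcoeff_big\<close>. With it
    the sum can be split at index 0 and its remainder matched with the shifted second sum.\<close>
  also have "(\<Sum>j\<le>l. (-4 * k l j * \<tau>\<^sup>2) * W (Suc l) j) = (\<Sum>j\<le>Suc l. ((-4) ^ Suc l * lapcoeff s l j * \<tau> ^ (2 * (Suc l - j))) * W (Suc l) j)"
    by (simp add: lapcoeff_big)
       (intro sum.cong, auto simp: k_def Suc_diff_le power_add power2_eq_square)
  also have "\<dots> = (-4) ^ Suc l * \<tau> ^ (2 * Suc l) * W (Suc l) 0 +
      (\<Sum>j\<le>l. ((-4) ^ Suc l * lapcoeff s l (Suc j) * \<tau> ^ (2 * (l - j))) * W (Suc l) (Suc j))"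
    unfolding sum.atMost_Suc_shift by (simp add: lapcoeff_0)
  also have "\<dots> + (\<Sum>j\<le>l. (-4 * k l j * (s + 2 * real l - real j)) * W (Suc l) (Suc j)) =
      (-4) ^ Suc l * \<tau> ^ (2 * Suc l) * W (Suc l) 0 + (\<Sum>j\<le>l. k (Suc l) (Suc j) * W (Suc l) (Suc j))"
    unfolding add.assoc sum.distrib[symmetric] k_def lapcoeff_Suc
    by (intro arg_cong2[where f="(+)"] refl sum.cong) (auto simp: algebra_simps)
  also have "\<dots> = (\<Sum>j\<le>Suc l. k (Suc l) j * W (Suc l) j)"
    unfolding sum.atMost_Suc_shift by (simp add: lapcoeff_0 k_def)
  also have "\<dots> = moebV y c g (Suc l) x" unfolding V W_def by simp
  finally show ?thesis ..
qed

lemma falling_zero: "falling (real i) j = 0" if "i < j"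
  using that by (auto simp: falling_def)

text \<open>This is the conformal covariance of the m-th power of the Laplacian: at c = n/2 - m and
  l = m the coefficients are falling factorials of 0, so all summands with j \<ge> 1 vanish and only
  the pure A-term survives.\<close>

lemma moebV_top:
  fixes x y :: "'a::euclidean_space"
  shows "moebV y (real DIM('a) / 2 - real m) g m x =
    (- 4) ^ m * (1 - (norm y)\<^sup>2) ^ (2 * m) * moebU y (real DIM('a) / 2 + real m) (Aiter m (real DIM('a) / 2 - real m) g) x"
proof -
  have z: "lapcoeff (1 - real m) m j = 0" if "j \<noteq> 0" for j
    using falling_zero[of 0 j] that by (simp add: lapcoeff_def)
  have "moebV y (real DIM('a) / 2 - real m) g m x = (\<Sum>j\<in>{0}. ((- 4) ^ m * lapcoeff (1 - real m) m j * (1 - (norm y)\<^sup>2) ^ (2 * (m - j))) *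
     moebU y (real DIM('a) / 2 - real m + 2 * real m - real j) (Aiter (m - j) (real DIM('a) / 2 - real m + real j) (Biter ((norm y)\<^sup>2) j (real DIM('a) / 2 - real m) g)) x)"
    unfolding moebV_def by (rule sum.mono_neutral_cong_right) (auto simp: z add.commute)
  then show ?thesis by (simp add: lapcoeff_0 add.commute)
qed

section \<open>The radial problem\<close>

definition Eop :: "real \<Rightarrow> real poly \<Rightarrow> real poly" where
  "Eop a p = pCons 0 (pderiv p) + smult a p"

lemma coeff_Eop: "coeff (Eop a p) k = (real k + a) * coeff p k"
  by (cases k) (auto simp: Eop_def coeff_pderiv coeff_pCons algebra_simps)

text \<open>Monomials are eigenvectors with eigenvalues k + a > 0, so the equation can be solved
  coefficient by coefficient.\<close>

lemma Eop_surj: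
  assumes "a > 0" shows "\<exists>q. Eop a q = r"
  using assms
proof (induction r arbitrary: a)
  case 0 then show ?case by (intro exI[of _ 0]) (simp add: Eop_def)
next
  case (pCons b r)
  obtain q where q: "Eop (a + 1) q = r" using pCons.IH[of "a + 1"] pCons.prems by auto
  have "Eop a (pCons (b / a) q) = pCons b r"
  proof (rule poly_eqI)
    fix k show "coeff (Eop a (pCons (b / a) q)) k = coeff (pCons b r) k"
      using pCons.prems q[symmetric] by (cases k) (auto simp: coeff_Eop algebra_simps)
  qed
  then show ?case by blast
qed

lemma pderiv_surj_root: "\<exists>P. pderiv P = p \<and> poly P 1 = (0::real)"
proof -
  obtain q where q: "Eop 1 q = p" using Eop_surj[of 1 p] by auto
  have "pderiv (pCons 0 q) = p" using q by (simp add: pderiv_pCons Eop_def add.commute)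
  then show ?thesis by (intro exI[of _ "pCons (- poly q 1) q"]) (simp add: pderiv_pCons)
qed

text \<open>With the integrating factor t^a the equation reads (t^a q)' = t^(a-1) r, so t^a q
  increases from 0. At t = 0 the equation itself gives a q(0) = r(0).\<close>

lemma Eop_solution_pos:
  assumes a: "a > 0" and eq: "Eop a q = r" and r: "\<And>t. 0 \<le> t \<Longrightarrow> t < 1 \<Longrightarrow> poly r t > 0"
    and t: "0 \<le> t" "t \<le> 1"
  shows "poly q t > 0"
proof (cases "t = 0")
  case True
  have "a * poly q 0 = poly r 0" using eq[symmetric] by (simp add: Eop_def)
  then show ?thesis using r[of 0] a True by (metis less_numeral_extra(1) order_refl zero_less_mult_pos)
next
  case False
  then have t0: "0 < t" using t by simp
  define f where "f x = x powr a * poly q x" for x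
  have cont: "continuous_on {0..t} f" unfolding f_def
    by (intro continuous_intros continuous_on_powr') (use a in auto)
  have der: "(f has_derivative (\<lambda>h. h * (x powr (a - 1) * poly r x))) (at x)" if x: "0 < x" "x < t" for x
  proof -
    have "(f has_real_derivative (a * x powr (a - 1)) * poly q x + poly (pderiv q) x * x powr a) (at x)"
      unfolding f_def using x by (auto intro!: derivative_eq_intros)
    moreover have "(a * x powr (a - 1)) * poly q x + poly (pderiv q) x * x powr a = x powr (a - 1) * poly r x"
      using eq[symmetric] x powr_mult_base[of x "a - 1"] by (simp add: Eop_def algebra_simps)
    ultimately show ?thesis by (simp add: has_field_derivative_def mult.commute[of _ "_ * poly r x"])
  qed
  obtain x where x: "0 < x" "x < t" "f t - f 0 = (t - 0) * (x powr (a - 1) * poly r x)"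
    using mvt[OF t0 cont der] by auto
  have "f t > 0" using x t0 t a r[of x] by (simp add: f_def)
  then show ?thesis using t0 by (simp add: f_def zero_less_mult_iff)
qed

primrec Eiter :: "nat \<Rightarrow> real \<Rightarrow> real poly \<Rightarrow> real poly" where
  "Eiter 0 a p = p" | "Eiter (Suc i) a p = Eop (a + real i) (Eiter i a p)"

text \<open>The source (1 - t)^N may vanish at 1, so positivity is assumed on [0,1) only. Inverting
  a single Euler operator already makes it strict at 1, and the resulting positive minimum on [0,1]
  is what the later lower bounds rest on.\<close>

lemma Eiter_solution_pos:
  assumes a: "a > 0" and r: "\<And>t. 0 \<le> t \<Longrightarrow> t < 1 \<Longrightarrow> poly r t > 0"
  shows "\<exists>p. Eiter (Suc m) a p = r \<and> (\<forall>t. 0 \<le> t \<longrightarrow> t \<le> 1 \<longrightarrow> poly p t > 0)"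
  using r
proof (induction m arbitrary: r)
  case 0
  obtain q where "Eop a q = r" using Eop_surj[OF a] by blast
  then show ?case using Eop_solution_pos[OF a _ 0] by (intro exI[of _ q]) auto
next
  case (Suc m)
  have a': "a + real (Suc m) > 0" using a by simp
  obtain q where q: "Eop (a + real (Suc m)) q = r" using Eop_surj[OF a'] by blast
  have "poly q t > 0" if "0 \<le> t" "t < 1" for t
    using Eop_solution_pos[OF a' q Suc.prems, of t] that by simp
  from Suc.IH[OF this] obtain p where "Eiter (Suc m) a p = q" "\<forall>t. 0 \<le> t \<longrightarrow> t \<le> 1 \<longrightarrow> poly p t > 0" by blast
  then show ?case using q by (intro exI[of _ p]) (auto simp: add_ac)
qed

lemma Aop_eq_Eop: "Aop c g = Eop (c + 1) (pderiv g)"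
  by (rule poly_eqI) (simp add: coeff_Aop coeff_Eop coeff_pderiv algebra_simps)

lemma pderiv_Eop: "pderiv (Eop a p) = Eop (a + 1) (pderiv p)"
  by (rule poly_eqI) (simp add: coeff_Eop coeff_pderiv)

lemma pderiv_Eiter: "pderiv (Eiter i a p) = Eiter i (a + 1) (pderiv p)"
  by (induction i) (simp_all add: pderiv_Eop add_ac)

text \<open>On monomials, \<open>A\<close> acts as an Euler operator after a differentiation; moving all
  differentiations to the right reduces the radial problem to first order equations.\<close>

lemma Aiter_eq_Eiter: "Aiter m c g = Eiter m (c + real m) ((pderiv ^^ m) g)"
proof (induction m)
  case (Suc m) then show ?case by (simp add: Aop_eq_Eop pderiv_Eiter add_ac)
qed simp

lemma dvd_antiderivative:
  fixes P :: "real poly"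
  assumes "[:-1, 1:] ^ i dvd pderiv P" "poly P 1 = 0"
  shows "[:-1, 1:] ^ Suc i dvd P"
proof (cases "P = 0")
  case False
  then have o: "order 1 P = Suc (order 1 (pderiv P))" using order_pderiv assms(2) by blast
  have "pderiv P \<noteq> 0"
  proof
    assume "pderiv P = 0"
    then obtain c where "P = [:c:]" using pderiv_iszero by blast
    then show False using assms(2) False by simp
  qed
  then have "i \<le> order 1 (pderiv P)" using assms(1) order_divides[of 1 i] by auto
  then show ?thesis using o order_divides[of 1 "Suc i" P] by auto
qed simp

lemma dvd_pderiv:
  fixes P :: "real poly"
  assumes "[:-1, 1:] ^ Suc i dvd P" shows "[:-1, 1:] ^ i dvd pderiv P"
proof -
  obtain h where h: "P = [:-1, 1:] ^ Suc i * h" using assms by blast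
  have "pderiv P = [:-1, 1:] ^ i * ([:-1, 1:] * pderiv h + h * smult (of_nat (Suc i)) (pderiv [:-1, 1:]))"
    unfolding h pderiv_mult pderiv_power_Suc by (simp add: algebra_simps)
  then show ?thesis by simp
qed

text \<open>Each antiderivative is -g integrated from the endpoint 1, so it vanishes there, stays
  nonnegative on [0,1] and flips one sign; this is the origin of (-1)^i. Vanishing to order i at 1
  is the polynomial form of the Dirichlet conditions.\<close>

lemma iterated_antiderivative:
  fixes p :: "real poly"
  assumes p: "\<And>t. 0 \<le> t \<Longrightarrow> t \<le> 1 \<Longrightarrow> poly p t \<ge> c" and c: "c > 0"
  shows "\<exists>g d. d > 0 \<and> (pderiv ^^ i) g = smult ((- 1) ^ i) p \<and> [:-1, 1:] ^ i dvd g \<and>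
           (\<forall>t. 0 \<le> t \<longrightarrow> t \<le> 1 \<longrightarrow> d * (1 - t) ^ i \<le> poly g t)"
proof (induction i)
  case 0 then show ?case using p c by (intro exI[of _ p] exI[of _ c]) auto
next
  case (Suc i)
  then obtain g d where g: "d > 0" "(pderiv ^^ i) g = smult ((- 1) ^ i) p" "[:-1, 1:] ^ i dvd g"
    "\<And>t. 0 \<le> t \<Longrightarrow> t \<le> 1 \<Longrightarrow> d * (1 - t) ^ i \<le> poly g t" by blast
  obtain P where P: "pderiv P = - g" "poly P 1 = 0" using pderiv_surj_root by blast
  have "(pderiv ^^ Suc i) P = (pderiv ^^ i) (smult (-1) g)"
    using P by (simp add: funpow_swap1)
  also have "\<dots> = smult ((- 1) ^ Suc i) p" unfolding higher_pderiv_smult g by simp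
  finally have 1: "(pderiv ^^ Suc i) P = smult ((- 1) ^ Suc i) p" .
  have 2: "[:-1, 1:] ^ Suc i dvd P" by (rule dvd_antiderivative) (use P g in auto)
  have 3: "d / real (Suc i) * (1 - t) ^ Suc i \<le> poly P t" if t: "0 \<le> t" "t \<le> 1" for t
  proof -
    define D where "D x = poly P x - d / real (Suc i) * (1 - x) ^ Suc i" for x
    have der: "(D has_real_derivative (- poly g x + d * (1 - x) ^ i)) (at x)" for x
    proof -
      have "(poly P has_real_derivative - poly g x) (at x)" using poly_DERIV[of P x] P(1) by simp
      moreover have "((\<lambda>x. d / real (Suc i) * (1 - x) ^ Suc i) has_real_derivative - (d * (1 - x) ^ i)) (at x)"
        by (auto intro!: derivative_eq_intros simp del: power_Suc)
      ultimately show ?thesis unfolding D_def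
        by (rule DERIV_cong[OF DERIV_diff]) simp
    qed
    have "D 1 \<le> D t"
    proof (rule DERIV_nonpos_imp_nonincreasing[OF t(2)])
      fix x assume "t \<le> x" "x \<le> 1"
      then show "\<exists>y. (D has_real_derivative y) (at x) \<and> y \<le> 0"
        using der[of x] g(4)[of x] t by (intro exI[of _ "- poly g x + d * (1 - x) ^ i"]) auto
    qed
    then show ?thesis using P(2) by (simp add: D_def)
  qed
  show ?case using 1 2 3 g(1) by (intro exI[of _ P] exI[of _ "d / real (Suc i)"]) auto
qed

text \<open>The parameter a - m is chosen so that the Euler operators start at a = n/2 > 0. They are
  inverted first, giving a positive polynomial with positive minimum on [0,1]; its m-fold
  antiderivative then has order m at 1 and a matching lower bound.\<close>

lemma radial_polynomial_solution:
  assumes m: "m \<ge> 1" and a: "a > 0"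
  shows "\<exists>g d. d > 0 \<and> Aiter m (a - real m) g = smult ((- 1) ^ m) ([:1, -1:] ^ N) \<and> [:-1, 1:] ^ m dvd g \<and>
           (\<forall>t. 0 \<le> t \<longrightarrow> t \<le> 1 \<longrightarrow> d * (1 - t) ^ m \<le> poly g t)"
proof -
  obtain i where i: "m = Suc i" using m by (cases m) auto
  obtain p where p: "Eiter m a p = [:1, -1:] ^ N" "\<And>t. 0 \<le> t \<Longrightarrow> t \<le> 1 \<Longrightarrow> poly p t > 0"
    using Eiter_solution_pos[OF a, of "[:1, -1:] ^ N" i] unfolding i by auto
  have "compact {0..1::real}" "continuous_on {0..1} (\<lambda>t. poly p t)" "{0..1::real} \<noteq> {}"
    by (simp_all add: continuous_on_poly)
  from continuous_attains_inf[OF this(1,3,2)]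
  obtain t0 where t0: "t0 \<in> {0..1}" "\<And>t. t \<in> {0..1} \<Longrightarrow> poly p t0 \<le> poly p t" by blast
  obtain g d where g: "d > 0" "(pderiv ^^ m) g = smult ((- 1) ^ m) p" "[:-1, 1:] ^ m dvd g"
    "\<forall>t. 0 \<le> t \<longrightarrow> t \<le> 1 \<longrightarrow> d * (1 - t) ^ m \<le> poly g t"
    using iterated_antiderivative[of "poly p t0" p m] p(2)[of t0] t0 by (metis atLeastAtMost_iff)
  have sm: "Eiter j b (smult e q) = smult e (Eiter j b q)" for j b e q
    by (induction j) (auto simp: Eop_def pderiv_smult smult_add_right mult.commute)
  show ?thesis using g p(1) by (intro exI[of _ g] exI[of _ d]) (auto simp: Aiter_eq_Eiter sm)
qed

text \<open>Sequences of polynomials of size \<open>(1 - t)\<^sup>s\<^sup>-\<^sup>e\<close>, uniformly in the index, each derivative costing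
  one power of \<open>1 - t\<close>.\<close>

definition weighted_bounded :: "nat \<Rightarrow> nat \<Rightarrow> (nat \<Rightarrow> real poly) \<Rightarrow> bool" where
  "weighted_bounded e s P \<longleftrightarrow>
     (\<forall>i. \<exists>C. \<forall>k t. 0 \<le> t \<longrightarrow> t \<le> 1 \<longrightarrow> \<bar>poly ((pderiv ^^ i) (P k)) t\<bar> * (1 - t) ^ (i + e) \<le> C * (1 - t) ^ s)"

lemma weighted_bounded_pderiv:
  assumes "weighted_bounded e s P" shows "weighted_bounded (Suc e) s (\<lambda>k. pderiv (P k))"
  unfolding weighted_bounded_def
proof
  fix i
  show "\<exists>C. \<forall>k t. 0 \<le> t \<longrightarrow> t \<le> 1 \<longrightarrow> \<bar>poly ((pderiv ^^ i) (pderiv (P k))) t\<bar> * (1 - t) ^ (i + Suc e) \<le> C * (1 - t) ^ s"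
    using assms[unfolded weighted_bounded_def, rule_format, of "Suc i"] by (simp add: funpow_swap1)
qed

lemma weighted_bounded_add:
  assumes "weighted_bounded e s P" "weighted_bounded e s R" shows "weighted_bounded e s (\<lambda>k. P k + R k)"
  unfolding weighted_bounded_def
proof
  fix i
  obtain C D where C: "\<And>k t. 0 \<le> t \<Longrightarrow> t \<le> 1 \<Longrightarrow> \<bar>poly ((pderiv ^^ i) (P k)) t\<bar> * (1 - t) ^ (i + e) \<le> C * (1 - t) ^ s"
    and D: "\<And>k t. 0 \<le> t \<Longrightarrow> t \<le> 1 \<Longrightarrow> \<bar>poly ((pderiv ^^ i) (R k)) t\<bar> * (1 - t) ^ (i + e) \<le> D * (1 - t) ^ s"
    using assms unfolding weighted_bounded_def by metis
  show "\<exists>C. \<forall>k t. 0 \<le> t \<longrightarrow> t \<le> 1 \<longrightarrow> \<bar>poly ((pderiv ^^ i) (P k + R k)) t\<bar> * (1 - t) ^ (i + e) \<le> C * (1 - t) ^ s"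
  proof (intro exI[of _ "C + D"] allI impI)
    fix k :: nat and t :: real assume t: "0 \<le> t" "t \<le> 1"
    have "\<bar>poly ((pderiv ^^ i) (P k + R k)) t\<bar> * (1 - t) ^ (i + e) \<le>
       (\<bar>poly ((pderiv ^^ i) (P k)) t\<bar> + \<bar>poly ((pderiv ^^ i) (R k)) t\<bar>) * (1 - t) ^ (i + e)"
      unfolding higher_pderiv_add poly_add using t by (intro mult_right_mono abs_triangle_ineq) auto
    then show "\<bar>poly ((pderiv ^^ i) (P k + R k)) t\<bar> * (1 - t) ^ (i + e) \<le> (C + D) * (1 - t) ^ s"
      using C[OF t, of k] D[OF t, of k] by (simp add: algebra_simps)
  qed
qed

text \<open>Leibniz' rule, one derivative at a time. The exponents \<open>e1\<close> and
  \<open>e2\<close> vary in the induction because each derivative charges its lost power of 1 - t to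
  the factor it falls on.\<close>

lemma weighted_bounded_mult:
  assumes "weighted_bounded e1 s1 P" "weighted_bounded e2 s2 R"
  shows "weighted_bounded (e1 + e2) (s1 + s2) (\<lambda>k. P k * R k)"
proof -
  have "\<exists>C. \<forall>k t. 0 \<le> t \<longrightarrow> t \<le> 1 \<longrightarrow>
      \<bar>poly ((pderiv ^^ i) (P k * R k)) t\<bar> * (1 - t) ^ (i + (e1 + e2)) \<le> C * (1 - t) ^ (s1 + s2)" for i
    using assms
  proof (induction i arbitrary: e1 e2 P R)
    case 0
    obtain C D where C: "\<And>k t. 0 \<le> t \<Longrightarrow> t \<le> 1 \<Longrightarrow> \<bar>poly (P k) t\<bar> * (1 - t) ^ e1 \<le> C * (1 - t) ^ s1"
      and D: "\<And>k t. 0 \<le> t \<Longrightarrow> t \<le> 1 \<Longrightarrow> \<bar>poly (R k) t\<bar> * (1 - t) ^ e2 \<le> D * (1 - t) ^ s2"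
      using 0[unfolded weighted_bounded_def, rule_format, of 0] by auto
    show ?case
    proof (intro exI[of _ "C * D"] allI impI)
      fix k :: nat and t :: real assume t: "0 \<le> t" "t \<le> 1"
      have "(\<bar>poly (P k) t\<bar> * (1 - t) ^ e1) * (\<bar>poly (R k) t\<bar> * (1 - t) ^ e2) \<le> (C * (1 - t) ^ s1) * (D * (1 - t) ^ s2)"
        by (rule mult_mono[OF C[OF t] D[OF t]]) (use t in \<open>auto intro: order_trans[OF _ C[OF t, of k]]\<close>)
      then show "\<bar>poly ((pderiv ^^ 0) (P k * R k)) t\<bar> * (1 - t) ^ (0 + (e1 + e2)) \<le> C * D * (1 - t) ^ (s1 + s2)"
        by (simp add: abs_mult power_add mult_ac)
    qed
  next
    case (Suc i)
    obtain C D where C: "\<And>k t. 0 \<le> t \<Longrightarrow> t \<le> 1 \<Longrightarrow>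
        \<bar>poly ((pderiv ^^ i) (P k * pderiv (R k))) t\<bar> * (1 - t) ^ (i + (e1 + Suc e2)) \<le> C * (1 - t) ^ (s1 + s2)"
      and D: "\<And>k t. 0 \<le> t \<Longrightarrow> t \<le> 1 \<Longrightarrow>
        \<bar>poly ((pderiv ^^ i) (pderiv (P k) * R k)) t\<bar> * (1 - t) ^ (i + (Suc e1 + e2)) \<le> D * (1 - t) ^ (s1 + s2)"
      using Suc.IH[OF Suc.prems(1) weighted_bounded_pderiv[OF Suc.prems(2)]]
        Suc.IH[OF weighted_bounded_pderiv[OF Suc.prems(1)] Suc.prems(2)] by blast
    show ?case
    proof (intro exI[of _ "C + D"] allI impI)
      fix k :: nat and t :: real assume t: "0 \<le> t" "t \<le> 1"
      have e: "(pderiv ^^ Suc i) (P k * R k) = (pderiv ^^ i) (P k * pderiv (R k)) + (pderiv ^^ i) (pderiv (P k) * R k)"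
        by (simp only: funpow_Suc_right o_def pderiv_mult higher_pderiv_add mult.commute)
      have "\<bar>poly ((pderiv ^^ Suc i) (P k * R k)) t\<bar> * (1 - t) ^ (Suc i + (e1 + e2)) \<le>
         (\<bar>poly ((pderiv ^^ i) (P k * pderiv (R k))) t\<bar> + \<bar>poly ((pderiv ^^ i) (pderiv (P k) * R k)) t\<bar>) * (1 - t) ^ (Suc i + (e1 + e2))"
        unfolding e poly_add using t by (intro mult_right_mono abs_triangle_ineq) auto
      then show "\<bar>poly ((pderiv ^^ Suc i) (P k * R k)) t\<bar> * (1 - t) ^ (Suc i + (e1 + e2)) \<le> (C + D) * (1 - t) ^ (s1 + s2)"
        using C[OF t, of k] D[OF t, of k] by (simp add: distrib_right)
    qed
  qed
  then show ?thesis unfolding weighted_bounded_def by blast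
qed

lemma weighted_bounded_const: "weighted_bounded 0 0 (\<lambda>k. p)"
  unfolding weighted_bounded_def
proof
  fix i
  have "continuous_on {0..1} (\<lambda>t. poly ((pderiv ^^ i) p) t)" by (intro continuous_intros)
  then have "compact (poly ((pderiv ^^ i) p) ` {0..1})" by (intro compact_continuous_image) auto
  then have "bounded (poly ((pderiv ^^ i) p) ` {0..1})" by (rule compact_imp_bounded)
  then obtain M where M: "\<And>t. t \<in> {0..1} \<Longrightarrow> \<bar>poly ((pderiv ^^ i) p) t\<bar> \<le> M" "0 < M"
    unfolding bounded_pos by (auto simp del: atLeastAtMost_iff)
  show "\<exists>C. \<forall>k t. 0 \<le> t \<longrightarrow> t \<le> 1 \<longrightarrow> \<bar>poly ((pderiv ^^ i) p) t\<bar> * (1 - t) ^ (i + 0) \<le> C * (1 - t) ^ 0"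
  proof (intro exI[of _ M] allI impI)
    fix k :: nat and t :: real assume t: "0 \<le> t" "t \<le> 1"
    have "\<bar>poly ((pderiv ^^ i) p) t\<bar> * (1 - t) ^ i \<le> M * 1"
      using M(1)[of t] M(2) t by (intro mult_mono power_le_one) auto
    then show "\<bar>poly ((pderiv ^^ i) p) t\<bar> * (1 - t) ^ (i + 0) \<le> M * (1 - t) ^ 0" by simp
  qed
qed

lemma weighted_bounded_mono:
  assumes "weighted_bounded e s P" shows "weighted_bounded (Suc e) s P"
  unfolding weighted_bounded_def
proof
  fix i
  obtain C where C: "\<And>k t. 0 \<le> t \<Longrightarrow> t \<le> 1 \<Longrightarrow> \<bar>poly ((pderiv ^^ i) (P k)) t\<bar> * (1 - t) ^ (i + e) \<le> C * (1 - t) ^ s"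
    using assms unfolding weighted_bounded_def by metis
  show "\<exists>C. \<forall>k t. 0 \<le> t \<longrightarrow> t \<le> 1 \<longrightarrow> \<bar>poly ((pderiv ^^ i) (P k)) t\<bar> * (1 - t) ^ (i + Suc e) \<le> C * (1 - t) ^ s"
  proof (intro exI[of _ C] allI impI)
    fix k :: nat and t :: real assume t: "0 \<le> t" "t \<le> 1"
    have "\<bar>poly ((pderiv ^^ i) (P k)) t\<bar> * (1 - t) ^ (i + Suc e) \<le> \<bar>poly ((pderiv ^^ i) (P k)) t\<bar> * (1 - t) ^ (i + e)"
      using t by (intro mult_left_mono power_decreasing) auto
    then show "\<bar>poly ((pderiv ^^ i) (P k)) t\<bar> * (1 - t) ^ (i + Suc e) \<le> C * (1 - t) ^ s" using C[OF t, of k] by linarith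
  qed
qed

lemma weighted_bounded_linear: "weighted_bounded 0 1 (\<lambda>k. [:-1, 1::real:])"
  unfolding weighted_bounded_def
proof
  fix i
  have "(pderiv ^^ Suc (Suc j)) [:-1, 1::real:] = 0" for j
    by (simp only: funpow_Suc_right o_def) (simp add: pderiv_pCons)
  then have "i \<ge> 2 \<Longrightarrow> (pderiv ^^ i) [:-1, 1::real:] = 0"
    by (metis Suc_le_D add_2_eq_Suc le_add_diff_inverse)
  then have "(i = 0 \<or> i = 1) \<or> (pderiv ^^ i) [:-1, 1::real:] = 0" by linarith
  then have "\<bar>poly ((pderiv ^^ i) [:-1, 1::real:]) t\<bar> * (1 - t) ^ i \<le> 1 * (1 - t)" if "0 \<le> t" "t \<le> 1" for t :: real
    using that by (auto simp: pderiv_pCons)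
  then show "\<exists>C. \<forall>k t. 0 \<le> t \<longrightarrow> t \<le> 1 \<longrightarrow> \<bar>poly ((pderiv ^^ i) [:-1, 1::real:]) t\<bar> * (1 - t) ^ (i + 0) \<le> C * (1 - t) ^ 1"
    by (intro exI[of _ 1]) auto
qed

lemma higher_pderiv_monom_1: "(pderiv ^^ i) (monom (1::real) k) = monom (fact i * real (k choose i)) (k - i)"
proof (induction i)
  case (Suc i)
  have "real (k - i) * real (k choose i) = real (Suc i) * real (k choose Suc i)"
    by (metis binomial_absorb_comp of_nat_mult Suc_times_binomial_add binomial_absorption mult.commute)
  then show ?case using Suc by (simp add: pderiv_monom algebra_simps)
qed (simp add: monom_0)

text \<open>A single term in the expansion of ((1 - t) + t)^k. Since the i-th derivative of t^k is
  i! times \<open>k choose i\<close> times t^(k-i), this bounds it, weighted by (1 - t)^i, uniformly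
  in \<open>k\<close>.\<close>

lemma binomial_term_le_1:
  fixes t :: real assumes "0 \<le> t" "t \<le> 1"
  shows "real (k choose i) * t ^ (k - i) * (1 - t) ^ i \<le> 1"
proof (cases "i \<le> k")
  case True
  have "real (k choose i) * (1 - t) ^ i * t ^ (k - i) \<le> (\<Sum>j\<le>k. real (k choose j) * (1 - t) ^ j * t ^ (k - j))"
    using True assms by (intro member_le_sum[of i _ "\<lambda>j. real (k choose j) * (1 - t) ^ j * t ^ (k - j)"]) auto
  also have "\<dots> = 1" using binomial_ring[of "1 - t" t k] by simp
  finally show ?thesis by (simp add: mult_ac)
qed (simp add: binomial_eq_0)

lemma weighted_bounded_monom: "weighted_bounded 0 0 (\<lambda>k. - monom 1 k)"
  unfolding weighted_bounded_def
proof
  fix i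
  show "\<exists>C. \<forall>k t. 0 \<le> t \<longrightarrow> t \<le> 1 \<longrightarrow> \<bar>poly ((pderiv ^^ i) (- monom (1::real) k)) t\<bar> * (1 - t) ^ (i + 0) \<le> C * (1 - t) ^ 0"
  proof (intro exI[of _ "fact i :: real"] allI impI)
    fix k :: nat and t :: real assume t: "0 \<le> t" "t \<le> 1"
    have "poly ((pderiv ^^ i) (- monom (1::real) k)) t = - (fact i * (real (k choose i) * t ^ (k - i)))"
      using higher_pderiv_smult[of i "-1" "monom (1::real) k"] by (simp add: higher_pderiv_monom_1 poly_monom)
    then have "\<bar>poly ((pderiv ^^ i) (- monom (1::real) k)) t\<bar> * (1 - t) ^ i = fact i * (real (k choose i) * t ^ (k - i) * (1 - t) ^ i)"
      using t by (simp add: abs_mult mult_ac)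
    also have "\<dots> \<le> fact i * 1" using binomial_term_le_1[OF t, of k i] by (intro mult_left_mono) auto
    finally show "\<bar>poly ((pderiv ^^ i) (- monom (1::real) k)) t\<bar> * (1 - t) ^ (i + 0) \<le> fact i * (1 - t) ^ 0"
      by simp
  qed
qed

lemma weighted_bounded_power:
  "weighted_bounded 0 s P \<Longrightarrow> weighted_bounded 0 (n * s) (\<lambda>k. P k ^ n)"
proof (induction n)
  case 0 then show ?case using weighted_bounded_const[of 1] by simp
next
  case (Suc n) then show ?case using weighted_bounded_mult[of 0 s P 0 "n * s"] by simp
qed

lemma weighted_bounded_Aop:
  assumes "weighted_bounded e s P" shows "weighted_bounded (e + 2) s (\<lambda>k. Aop c (P k))"
proof -
  have "weighted_bounded (e + 2) s (\<lambda>k. [:0, 1:] * pderiv (pderiv (P k)) + [:c + 1:] * pderiv (P k))"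
    using weighted_bounded_mult[OF weighted_bounded_const weighted_bounded_pderiv[OF weighted_bounded_pderiv[OF assms]], of "[:0, 1:]"]
      weighted_bounded_mult[OF weighted_bounded_const weighted_bounded_mono[OF weighted_bounded_pderiv[OF assms]], of "[:c + 1:]"]
    by (intro weighted_bounded_add) simp_all
  then show ?thesis by (simp add: Aop_def)
qed

lemma weighted_bounded_Aiter:
  "weighted_bounded e s P \<Longrightarrow> weighted_bounded (e + 2 * i) s (\<lambda>k. Aiter i c (P k))"
proof (induction i)
  case (Suc i) then show ?case using weighted_bounded_Aop[of "e + 2 * i" s] by simp
qed simp

text \<open>All derivatives are included because A differentiates. The point 1 is excluded: 1 - t^k
  vanishes there for k \<ge> 1 but tends to 1 everywhere else on the interval.\<close>

definition derivs_tendsto :: "(nat \<Rightarrow> real poly) \<Rightarrow> real poly \<Rightarrow> bool" where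
  "derivs_tendsto P p \<longleftrightarrow>
     (\<forall>i t. 0 \<le> t \<longrightarrow> t < 1 \<longrightarrow> (\<lambda>k. poly ((pderiv ^^ i) (P k)) t) \<longlonglongrightarrow> poly ((pderiv ^^ i) p) t)"

lemma derivs_tendsto_const: "derivs_tendsto (\<lambda>k. p) p"
  by (simp add: derivs_tendsto_def)

lemma derivs_tendsto_add:
  "derivs_tendsto P p \<Longrightarrow> derivs_tendsto R r \<Longrightarrow> derivs_tendsto (\<lambda>k. P k + R k) (p + r)"
  by (auto simp: derivs_tendsto_def higher_pderiv_add intro!: tendsto_add)

lemma derivs_tendsto_pderiv:
  assumes "derivs_tendsto P p" shows "derivs_tendsto (\<lambda>k. pderiv (P k)) (pderiv p)"
  unfolding derivs_tendsto_def
proof (intro allI impI)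
  fix i and t :: real assume "0 \<le> t" "t < 1"
  then show "(\<lambda>k. poly ((pderiv ^^ i) (pderiv (P k))) t) \<longlonglongrightarrow> poly ((pderiv ^^ i) (pderiv p)) t"
    using assms[unfolded derivs_tendsto_def, rule_format, of t "Suc i"] by (simp add: funpow_swap1)
qed

lemma derivs_tendsto_mult:
  assumes "derivs_tendsto P p" "derivs_tendsto R r" shows "derivs_tendsto (\<lambda>k. P k * R k) (p * r)"
proof -
  have "(\<lambda>k. poly ((pderiv ^^ i) (P k * R k)) t) \<longlonglongrightarrow> poly ((pderiv ^^ i) (p * r)) t" if "0 \<le> t" "t < 1" for i t
    using assms
  proof (induction i arbitrary: P p R r)
    case 0 then show ?case
      using that 0[unfolded derivs_tendsto_def, rule_format, of t 0] by (auto intro: tendsto_mult)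
  next
    case (Suc i)
    have e: "(pderiv ^^ Suc i) (f * g) = (pderiv ^^ i) (f * pderiv g) + (pderiv ^^ i) (pderiv f * g)" for f g :: "real poly"
      by (simp only: funpow_Suc_right o_def pderiv_mult higher_pderiv_add mult.commute)
    show ?case unfolding e poly_add
      by (intro tendsto_add Suc.IH derivs_tendsto_pderiv Suc.prems)
  qed
  then show ?thesis unfolding derivs_tendsto_def by blast
qed

lemma derivs_tendsto_monom: "derivs_tendsto (\<lambda>k. - monom 1 k) 0"
  unfolding derivs_tendsto_def
proof (intro allI impI)
  fix i and t :: real assume t: "0 \<le> t" "t < 1"
  \<comment> \<open>A point strictly between t and 1: the binomial bound at r costs only the fixed
    factor (1 - r)^-i, while passing from r to t gains (t/r)^(k-i), which tends to 0.\<close>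
  define r where "r = (1 + t) / 2"
  have r: "t < r" "r < 1" "0 < r" using t by (auto simp: r_def)
  have e: "poly ((pderiv ^^ i) (- monom (1::real) k)) t = - (fact i * (real (k choose i) * t ^ (k - i)))" for k
    using higher_pderiv_smult[of i "-1" "monom (1::real) k"] by (simp add: higher_pderiv_monom_1 poly_monom)
  have b: "norm (poly ((pderiv ^^ i) (- monom (1::real) k)) t) \<le> fact i / (1 - r) ^ i * (t / r) ^ (k - i)" for k
  proof -
    have "real (k choose i) * r ^ (k - i) \<le> 1 / (1 - r) ^ i"
      using binomial_term_le_1[of r k i] r by (simp add: field_simps)
    then have "(real (k choose i) * r ^ (k - i)) * (t / r) ^ (k - i) \<le> 1 / (1 - r) ^ i * (t / r) ^ (k - i)"
      using r t by (intro mult_right_mono) auto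
    then have "real (k choose i) * t ^ (k - i) \<le> 1 / (1 - r) ^ i * (t / r) ^ (k - i)"
      using r by (simp add: power_divide)
    then have "fact i * (real (k choose i) * t ^ (k - i)) \<le> fact i * (1 / (1 - r) ^ i * (t / r) ^ (k - i))"
      by (intro mult_left_mono) auto
    then show ?thesis unfolding e using t by (simp add: abs_mult)
  qed
  have "(\<lambda>k. (t / r) ^ k) \<longlonglongrightarrow> 0" using r t by (intro LIMSEQ_realpow_zero) auto
  then have "(\<lambda>k. (t / r) ^ (k + i - i)) \<longlonglongrightarrow> 0" by simp
  then have "(\<lambda>k. (t / r) ^ (k - i)) \<longlonglongrightarrow> 0" by (rule LIMSEQ_offset)
  then have "(\<lambda>k. fact i / (1 - r) ^ i * (t / r) ^ (k - i)) \<longlonglongrightarrow> 0" by (rule tendsto_mult_right_zero)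
  then have "(\<lambda>k. poly ((pderiv ^^ i) (- monom (1::real) k)) t) \<longlonglongrightarrow> 0"
    by (rule Lim_null_comparison[rotated]) (use b in auto)
  then show "(\<lambda>k. poly ((pderiv ^^ i) (- monom (1::real) k)) t) \<longlonglongrightarrow> poly ((pderiv ^^ i) 0) t" by simp
qed

lemma derivs_tendsto_power: "derivs_tendsto P p \<Longrightarrow> derivs_tendsto (\<lambda>k. P k ^ n) (p ^ n)"
  by (induction n) (auto intro: derivs_tendsto_mult derivs_tendsto_const)

lemma derivs_tendsto_Aop:
  assumes "derivs_tendsto P p" shows "derivs_tendsto (\<lambda>k. Aop c (P k)) (Aop c p)"
proof -
  have "derivs_tendsto (\<lambda>k. [:0, 1:] * pderiv (pderiv (P k)) + [:c + 1:] * pderiv (P k)) ([:0, 1:] * pderiv (pderiv p) + [:c + 1:] * pderiv p)"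
    by (intro derivs_tendsto_add derivs_tendsto_mult derivs_tendsto_const derivs_tendsto_pderiv assms)
  then show ?thesis by (simp add: Aop_def)
qed

lemma derivs_tendsto_Aiter: "derivs_tendsto P p \<Longrightarrow> derivs_tendsto (\<lambda>k. Aiter i c (P k)) (Aiter i c p)"
  by (induction i) (auto intro: derivs_tendsto_Aop)

text \<open>Replacing \<open>g\<close> by \<open>g (1 - t\<^sup>k)\<^sup>m\<close> doubles the order of vanishing at \<open>1\<close> while keeping all
  bounds uniform in \<open>k\<close>.\<close>

lemma boundary_regularization:
  fixes g :: "real poly" and c :: real
  assumes "[:-1, 1:] ^ m dvd g"
  obtains G C D where "\<And>k. k \<ge> 1 \<Longrightarrow> [:-1, 1:] ^ (2 * m) dvd G k"
    "\<And>k t. 0 \<le> t \<Longrightarrow> t < 1 \<Longrightarrow> \<bar>poly (G k) t\<bar> \<le> C"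
    "\<And>k t. 0 \<le> t \<Longrightarrow> t < 1 \<Longrightarrow> \<bar>poly (Aiter m c (G k)) t\<bar> * (1 - t) ^ m \<le> D"
    "\<And>t. 0 \<le> t \<Longrightarrow> t < 1 \<Longrightarrow> (\<lambda>k. poly (G k) t) \<longlonglongrightarrow> poly g t"
    "\<And>t. 0 \<le> t \<Longrightarrow> t < 1 \<Longrightarrow> (\<lambda>k. poly (Aiter m c (G k)) t) \<longlonglongrightarrow> poly (Aiter m c g) t"
proof -
  obtain h where h: "g = [:-1, 1:] ^ m * h" using assms by blast
  define G where "G k = [:-1, 1:] ^ m * (h * (1 + - monom 1 k) ^ m)" for k
  have wb: "weighted_bounded 0 m G"
  proof -
    have 1: "weighted_bounded 0 m (\<lambda>k. [:-1, 1:] ^ m)" using weighted_bounded_power[OF weighted_bounded_linear, of m] by simp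
    have 2: "weighted_bounded 0 0 (\<lambda>k. (1 + - monom 1 k) ^ m)"
      using weighted_bounded_power[OF weighted_bounded_add[OF weighted_bounded_const[of 1] weighted_bounded_monom], of m] by simp
    show ?thesis unfolding G_def
      using weighted_bounded_mult[OF 1 weighted_bounded_mult[OF weighted_bounded_const[of h] 2]] by simp
  qed
  have dt: "derivs_tendsto G g"
  proof -
    have "derivs_tendsto G ([:-1, 1:] ^ m * (h * (1 + 0) ^ m))" unfolding G_def
      by (intro derivs_tendsto_mult derivs_tendsto_const derivs_tendsto_power derivs_tendsto_add derivs_tendsto_monom)
    then show ?thesis by (simp add: h)
  qed
  have dvd: "[:-1, 1:] ^ (2 * m) dvd G k" if "k \<ge> 1" for k
  proof -
    have "[:-1, 1:] dvd (1 + - monom (1::real) k)"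
      using poly_eq_0_iff_dvd[of "1 + - monom (1::real) k" 1] by (simp add: poly_monom)
    then have "[:-1, 1:] ^ m * [:-1, 1:] ^ m dvd G k" unfolding G_def
      by (intro mult_dvd_mono dvd_refl dvd_mult dvd_power_same)
    then show ?thesis by (simp add: power_add[symmetric] mult_2)
  qed
  obtain C where C: "\<And>k t. 0 \<le> t \<Longrightarrow> t \<le> 1 \<Longrightarrow> \<bar>poly (G k) t\<bar> \<le> C * (1 - t) ^ m"
    using wb[unfolded weighted_bounded_def, rule_format, of 0] by auto
  have C0: "C \<ge> 0" using C[of 0 undefined] abs_ge_zero order_trans by force
  have b1: "\<bar>poly (G k) t\<bar> \<le> C" if "0 \<le> t" "t < 1" for k t
  proof -
    have "C * (1 - t) ^ m \<le> C * 1" using C0 that by (intro mult_left_mono power_le_one) auto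
    then show ?thesis using C[of t k] that by simp
  qed
  \<comment> \<open>The m-fold A costs 2m powers of 1 - t and \<open>G\<close> supplies only m. The
    remaining (1 - t)^-m is left to be absorbed by the decay of the test function.\<close>
  obtain D where D: "\<And>k t. 0 \<le> t \<Longrightarrow> t \<le> 1 \<Longrightarrow> \<bar>poly (Aiter m c (G k)) t\<bar> * (1 - t) ^ (2 * m) \<le> D * (1 - t) ^ m"
    using weighted_bounded_Aiter[OF wb, of m c, unfolded weighted_bounded_def, rule_format, of 0] by auto
  have b2: "\<bar>poly (Aiter m c (G k)) t\<bar> * (1 - t) ^ m \<le> D" if "0 \<le> t" "t < 1" for k t
  proof -
    have "(\<bar>poly (Aiter m c (G k)) t\<bar> * (1 - t) ^ m) * (1 - t) ^ m \<le> D * (1 - t) ^ m"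
      using D[of t k] that unfolding mult_2 power_add mult.assoc by simp
    then show ?thesis by (rule mult_right_le_imp_le) (use that in simp)
  qed
  have l1: "(\<lambda>k. poly (G k) t) \<longlonglongrightarrow> poly g t" if "0 \<le> t" "t < 1" for t
    using dt[unfolded derivs_tendsto_def, rule_format, of t 0] that by simp
  have l2: "(\<lambda>k. poly (Aiter m c (G k)) t) \<longlonglongrightarrow> poly (Aiter m c g) t" if "0 \<le> t" "t < 1" for t
    using derivs_tendsto_Aiter[OF dt, of m c, unfolded derivs_tendsto_def, rule_format, of t 0] that by simp
  show thesis using dvd b1 b2 l1 l2 by (rule that)
qed

section \<open>Green's identity for the explicit solutions\<close>

lemma dvd_Aop:
  assumes "[:-1, 1:] ^ (k + 2) dvd g" shows "[:-1, 1:] ^ k dvd Aop c g"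
proof -
  have 1: "[:-1, 1:] ^ Suc k dvd pderiv g" using assms by (intro dvd_pderiv) simp
  then have "[:-1, 1:] ^ k dvd pderiv g" by (rule power_le_dvd) simp
  moreover have "[:-1, 1:] ^ k dvd pderiv (pderiv g)" using 1 by (rule dvd_pderiv)
  then have "[:-1, 1:] ^ k dvd [:0, 1:] * pderiv (pderiv g)" by (rule dvd_mult)
  then have "[:-1, 1:] ^ k dvd pCons 0 (pderiv (pderiv g))" by simp
  ultimately show ?thesis unfolding Aop_def by (intro dvd_add dvd_smult)
qed

lemma dvd_Bop:
  assumes "[:-1, 1:] ^ (k + 1) dvd g" shows "[:-1, 1:] ^ k dvd Bop \<eta> c g"
proof -
  have 1: "[:-1, 1:] ^ k dvd pderiv g" using assms by (intro dvd_pderiv) simp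
  have 2: "[:-1, 1:] ^ k dvd g" using assms by (rule power_le_dvd) simp
  have "[:-1, 1:] ^ k dvd [:0, 1:] * pderiv g" using 1 by (rule dvd_mult)
  then have "[:-1, 1:] ^ k dvd pCons 0 (pderiv g)" by simp
  then show ?thesis unfolding Bop_def using 1 2 by (intro dvd_diff dvd_add dvd_smult)
qed

lemma dvd_Aiter: "[:-1, 1:] ^ (k + 2 * i) dvd g \<Longrightarrow> [:-1, 1:] ^ k dvd Aiter i c g"
proof (induction i arbitrary: k)
  case (Suc i)
  have "[:-1, 1:] ^ (k + 2) dvd Aiter i c g" by (rule Suc.IH) (use Suc.prems in \<open>simp add: add_ac\<close>)
  then show ?case unfolding Aiter.simps by (rule dvd_Aop)
qed simp

lemma dvd_Biter: "[:-1, 1:] ^ (k + j) dvd g \<Longrightarrow> [:-1, 1:] ^ k dvd Biter \<eta> j c g"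
proof (induction j arbitrary: k)
  case (Suc j)
  have "[:-1, 1:] ^ (k + 1) dvd Biter \<eta> j c g" by (rule Suc.IH) (use Suc.prems in \<open>simp add: add_ac\<close>)
  then show ?case unfolding Biter.simps by (rule dvd_Bop)
qed simp

lemma moebU_bounded:
  fixes y :: "'a::euclidean_space"
  assumes "norm y < 1"
  obtains M where "M \<ge> 0" "\<And>x. norm x < 1 \<Longrightarrow> \<bar>moebU y c g x\<bar> \<le> M"
  using smooth_upto_bounded[OF smooth_upto_moebU[OF assms, of 0 c g] bounded_ball] by (metis mem_ball_0 real_norm_def)

text \<open>Because 1 - \<rho> = (1 - |x|^2)(1 - |y|^2) / Q, a factor t - 1 of the polynomial can be
  traded for the distance to the sphere at the price of raising the weight by one.\<close>

lemma moebU_decay: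
  fixes y :: "'a::euclidean_space"
  assumes y: "norm y < 1" and g: "[:-1, 1:] dvd g"
  shows "\<exists>C. \<forall>x\<in>ball 0 1. \<bar>moebU y c g x\<bar> \<le> C * (1 - norm x)"
proof -
  obtain h where h: "g = [:-1, 1:] * h" using g by blast
  obtain M where M: "M \<ge> 0" "\<And>x. norm x < 1 \<Longrightarrow> \<bar>moebU y (c + 1) h x\<bar> \<le> M"
    using moebU_bounded[OF y, of "c + 1" h] by blast
  show ?thesis
  proof (intro exI[of _ "2 * M"] ballI)
    fix x :: 'a assume "x \<in> ball 0 1"
    then have x: "norm x < 1" by simp
    have Q: "moebQ y x > 0" using moebQ_pos x y by (metis less_imp_le)
    have "moebU y c g x = - ((1 - moebr y x) * moebQ y x) * moebU y (c + 1) h x"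
      using Q by (simp add: moebU_def h powr_diff powr_minus field_simps powr_add)
    also have "(1 - moebr y x) * moebQ y x = (1 - (norm x)\<^sup>2) * (1 - (norm y)\<^sup>2)"
      using one_minus_moebr[of x y] x y Q by simp
    finally have e: "\<bar>moebU y c g x\<bar> = \<bar>(1 - (norm x)\<^sup>2) * (1 - (norm y)\<^sup>2)\<bar> * \<bar>moebU y (c + 1) h x\<bar>"
      by (simp add: abs_mult)
    have sq: "(norm x)\<^sup>2 < 1" "(norm y)\<^sup>2 < 1" using x y by (auto simp: power_less_one_iff abs_square_less_1)
    have "1 - (norm x)\<^sup>2 = (1 - norm x) * (1 + norm x)" by (simp add: power2_eq_square algebra_simps)
    also have "\<dots> \<le> (1 - norm x) * 2" using x by (intro mult_left_mono) auto
    finally have 1: "1 - (norm x)\<^sup>2 \<le> 2 * (1 - norm x)" by simp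
    have "\<bar>(1 - (norm x)\<^sup>2) * (1 - (norm y)\<^sup>2)\<bar> = (1 - (norm x)\<^sup>2) * (1 - (norm y)\<^sup>2)"
      using sq by (simp add: abs_mult)
    also have "\<dots> \<le> (2 * (1 - norm x)) * 1" using 1 sq x by (intro mult_mono) auto
    finally have "\<bar>moebU y c g x\<bar> \<le> (2 * (1 - norm x)) * M" unfolding e
      using M(2)[OF x] x by (intro mult_mono) auto
    then show "\<bar>moebU y c g x\<bar> \<le> 2 * M * (1 - norm x)" by (simp add: mult_ac)
  qed
qed

lemma dir_deriv_moebU_decay:
  fixes y :: "'a::euclidean_space"
  assumes y: "norm y < 1" and g: "[:-1, 1:] ^ 2 dvd g" and b: "b \<in> Basis"
  shows "\<exists>C. \<forall>x\<in>ball 0 1. \<bar>dir_deriv b (moebU y c g) x\<bar> \<le> C * (1 - norm x)"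
proof -
  have d1: "[:-1, 1:] dvd pderiv g" using dvd_pderiv[of 1 g] g by (simp add: numeral_2_eq_2)
  have d0: "[:-1, 1:] dvd g" using power_le_dvd[OF g, of 1] by simp
  have "[:-1, 1:] dvd [:0, 1:] * pderiv g" using d1 by (rule dvd_mult)
  then have d2: "[:-1, 1:] dvd - smult c g - pCons 0 (pderiv g)" using d0
    by (intro dvd_diff) (auto intro: dvd_smult)
  obtain C where C: "\<And>x. x \<in> ball 0 1 \<Longrightarrow> \<bar>moebU y (c + 1) (- smult c g - pCons 0 (pderiv g)) x\<bar> \<le> C * (1 - norm x)"
    using moebU_decay[OF y d2] by blast
  obtain D where D: "\<And>x. x \<in> ball 0 1 \<Longrightarrow> \<bar>moebU y (c + 1) (pderiv g) x\<bar> \<le> D * (1 - norm x)"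
    using moebU_decay[OF y d1] by blast
  show ?thesis
  proof (intro exI[of _ "4 * C + 4 * D"] ballI)
    fix x :: 'a assume xb: "x \<in> ball 0 1"
    then have x: "norm x < 1" by simp
    have n1: "\<bar>2 * (((norm y)\<^sup>2 *\<^sub>R x - y) \<bullet> b)\<bar> \<le> 4"
    proof -
      have "(norm y)\<^sup>2 \<le> 1" using y by (simp add: power_le_one)
      then have "(norm y)\<^sup>2 * norm x \<le> 1 * 1" using x by (intro mult_mono) auto
      then have "norm ((norm y)\<^sup>2 *\<^sub>R x - y) \<le> 2" using norm_triangle_ineq4[of "(norm y)\<^sup>2 *\<^sub>R x" y] y by simp
      then show ?thesis using Basis_le_norm[OF b, of "(norm y)\<^sup>2 *\<^sub>R x - y"] by simp
    qed
    have n2: "\<bar>2 * ((x - y) \<bullet> b)\<bar> \<le> 4"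
      using Basis_le_norm[OF b, of "x - y"] norm_triangle_ineq4[of x y] x y by simp
    have "\<bar>dir_deriv b (moebU y c g) x\<bar> \<le>
        \<bar>2 * (((norm y)\<^sup>2 *\<^sub>R x - y) \<bullet> b)\<bar> * \<bar>moebU y (c + 1) (- smult c g - pCons 0 (pderiv g)) x\<bar>
        + \<bar>2 * ((x - y) \<bullet> b)\<bar> * \<bar>moebU y (c + 1) (pderiv g) x\<bar>"
      unfolding dir_deriv_moebU[OF x y] by (simp only: abs_mult[symmetric] abs_triangle_ineq)
    also have "\<dots> \<le> 4 * (C * (1 - norm x)) + 4 * (D * (1 - norm x))"
      by (intro add_mono mult_mono n1 n2 C D xb) auto
    finally show "\<bar>dir_deriv b (moebU y c g) x\<bar> \<le> (4 * C + 4 * D) * (1 - norm x)" by (simp add: algebra_simps)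
  qed
qed

lemma decay_sum:
  fixes f :: "nat \<Rightarrow> 'a::euclidean_space \<Rightarrow> real"
  assumes "\<And>j. j \<le> l \<Longrightarrow> \<exists>C. \<forall>x\<in>ball 0 1. \<bar>f j x\<bar> \<le> C * (1 - norm x)"
  shows "\<exists>C. \<forall>x\<in>ball 0 1. \<bar>\<Sum>j\<le>l. k j * f j x\<bar> \<le> C * (1 - norm x)"
proof -
  obtain C where C: "\<And>j x. j \<le> l \<Longrightarrow> x \<in> ball 0 1 \<Longrightarrow> \<bar>f j x\<bar> \<le> C j * (1 - norm x)"
    using assms by metis
  show ?thesis
  proof (intro exI[of _ "\<Sum>j\<le>l. \<bar>k j\<bar> * C j"] ballI)
    fix x :: 'a assume x: "x \<in> ball 0 1"
    have "\<bar>\<Sum>j\<le>l. k j * f j x\<bar> \<le> (\<Sum>j\<le>l. \<bar>k j\<bar> * (C j * (1 - norm x)))"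
      by (rule order_trans[OF sum_abs]) (use C x in \<open>auto simp: abs_mult intro!: sum_mono mult_left_mono\<close>)
    then show "\<bar>\<Sum>j\<le>l. k j * f j x\<bar> \<le> (\<Sum>j\<le>l. \<bar>k j\<bar> * C j) * (1 - norm x)"
      by (simp add: sum_distrib_right mult.assoc)
  qed
qed

text \<open>Every A costs two orders of vanishing at 1 and every B one. With order 2m at the start,
  at least order 2 is left after l < m steps, so the l-th member of the chain and its gradient both
  vanish on the sphere.\<close>

lemma green_identity_regular:
  fixes y :: "'a::euclidean_space"
  assumes y: "norm y < 1" and g: "[:-1, 1:] ^ (2 * m) dvd g" and \<phi>: "smooth_upto (2 * m) (ball 0 1) \<phi>"
  shows "(LINT x:ball 0 1|lebesgue. moebU y c g x * polylaplacian m \<phi> x) =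
         (LINT x:ball 0 1|lebesgue. moebV y c g m x * \<phi> x)"
proof -
  have "(LINT x:ball 0 1|lebesgue. moebV y c g 0 x * polylaplacian m \<phi> x) =
         (LINT x:ball 0 1|lebesgue. moebV y c g m x * \<phi> x)"
  proof (rule polylaplacian_by_parts_unit_ball)
    fix l assume l: "l < m"
    define T where "T j = Aiter (l - j) (c + real j) (Biter ((norm y)\<^sup>2) j c g)" for j
    define k where "k j = (- 4) ^ l * lapcoeff (c + 1 - real DIM('a) / 2) l j * (1 - (norm y)\<^sup>2) ^ (2 * (l - j))" for j
    define c' where "c' j = c + 2 * real l - real j" for j
    have V: "moebV y c g l = (\<lambda>x. \<Sum>j\<le>l. k j * moebU y (c' j) (T j) x)"
      by (rule ext) (simp add: moebV_def k_def T_def c'_def)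
    have T: "[:-1, 1:] ^ 2 dvd T j" if "j \<le> l" for j
      unfolding T_def by (intro dvd_Aiter dvd_Biter power_le_dvd[OF g]) (use l that in auto)
    have T1: "[:-1, 1:] dvd T j" if "j \<le> l" for j
      using power_le_dvd[OF T[OF that], of 1] by simp
    show "smooth_upto 2 (ball 0 1) (moebV y c g l)" unfolding V
      by (intro smooth_upto_sum open_ball smooth_upto_mult smooth_upto_const smooth_upto_moebU y) auto
    show "\<exists>C. \<forall>x\<in>ball 0 1. \<bar>moebV y c g l x\<bar> \<le> C * (1 - norm x)" unfolding V
      by (intro decay_sum moebU_decay y T1)
    fix b :: 'a assume b: "b \<in> Basis"
    have "\<exists>C. \<forall>x\<in>ball 0 1. \<bar>\<Sum>j\<le>l. k j * dir_deriv b (moebU y (c' j) (T j)) x\<bar> \<le> C * (1 - norm x)"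
      by (intro decay_sum dir_deriv_moebU_decay y T b)
    moreover have "dir_deriv b (moebV y c g l) x = (\<Sum>j\<le>l. k j * dir_deriv b (moebU y (c' j) (T j)) x)" if "x \<in> ball 0 1" for x
      using smooth_upto_differentiable[OF smooth_upto_moebU[OF y, of "Suc 0"] that] unfolding V
      by (subst dir_deriv_sum) (auto simp: dir_deriv_scaleR[where 'b=real, unfolded real_scaleR_def])
    ultimately show "\<exists>C. \<forall>x\<in>ball 0 1. \<bar>dir_deriv b (moebV y c g l) x\<bar> \<le> C * (1 - norm x)" by simp
  next
    fix l and x :: 'a assume "x \<in> ball 0 1"
    then show "moebV y c g (Suc l) x = - laplacian (moebV y c g l) x"
      using moebV_Suc y by auto
  qed (rule \<phi>)
  then show ?thesis by (simp add: moebV_0)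
qed

text \<open>As \<open>g\<close> vanishes only to order m, the identity is taken from the regularised
  polynomials by dominated convergence. On the left these are uniformly bounded; on the right the
  bound may blow up like (1 - \<rho>)^-m, which the decay of \<phi> compensates.\<close>

lemma green_identity:
  fixes y :: "'a::euclidean_space"
  assumes y: "norm y < 1" and g: "[:-1, 1:] ^ m dvd g" and \<phi>: "\<phi> \<in> dirichlet_test m (ball 0 1)"
  shows "(LINT x:ball 0 1|lebesgue. moebU y (real DIM('a) / 2 - real m) g x * polylaplacian m \<phi> x) =
         (LINT x:ball 0 1|lebesgue. (- 4) ^ m * (1 - (norm y)\<^sup>2) ^ (2 * m) *
            moebU y (real DIM('a) / 2 + real m) (Aiter m (real DIM('a) / 2 - real m) g) x * \<phi> x)"
proof -
  let ?B = "ball (0::'a) 1"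
  define n where "n = real DIM('a) / 2"
  define \<tau> where "\<tau> = 1 - (norm y)\<^sup>2"
  have \<tau>: "\<tau> > 0" using y by (simp add: \<tau>_def power_less_one_iff abs_square_less_1)
  have su: "smooth_upto (2 * m) ?B \<phi>" using \<phi> by (auto simp: dirichlet_test_def Ck_closure_iff)
  have su0: "smooth_upto 0 ?B \<phi>" by (rule smooth_upto_mono[OF su]) simp
  have sp: "smooth_upto 0 ?B (polylaplacian m \<phi>)" using su by (intro smooth_upto_polylaplacian open_ball) (simp del: smooth_upto.simps)
  obtain L where L: "0 \<le> L" "\<And>x. x \<in> ?B \<Longrightarrow> norm (polylaplacian m \<phi> x) \<le> L"
    using smooth_upto_bounded[OF sp bounded_ball] by blast
  obtain K where K: "K \<ge> 0" "\<And>x. x \<in> ?B \<Longrightarrow> \<bar>\<phi> x\<bar> \<le> K * (1 - norm x) ^ m"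
    using dirichlet_test_decay[OF \<phi>] by blast
  obtain G C D where G: "\<And>k. k \<ge> 1 \<Longrightarrow> [:-1, 1:] ^ (2 * m) dvd G k"
    and C: "\<And>k t. 0 \<le> t \<Longrightarrow> t < 1 \<Longrightarrow> \<bar>poly (G k) t\<bar> \<le> C"
    and D: "\<And>k t. 0 \<le> t \<Longrightarrow> t < 1 \<Longrightarrow> \<bar>poly (Aiter m (n - real m) (G k)) t\<bar> * (1 - t) ^ m \<le> D"
    and lim: "\<And>t. 0 \<le> t \<Longrightarrow> t < 1 \<Longrightarrow> (\<lambda>k. poly (G k) t) \<longlonglongrightarrow> poly g t"
    and limA: "\<And>t. 0 \<le> t \<Longrightarrow> t < 1 \<Longrightarrow> (\<lambda>k. poly (Aiter m (n - real m) (G k)) t) \<longlonglongrightarrow> poly (Aiter m (n - real m) g) t"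
    by (rule boundary_regularization[OF g, of "n - real m"]) (rule that)
  have r: "0 \<le> moebr y x" "moebr y x < 1" if "x \<in> ?B" for x
    using moebr_range[of x y] moebr_less_1[of x y] that y by auto
  define A where "A = (\<lambda>k. Aiter m (n - real m) (G (Suc k)))"
  define f where "f k x = indicator ?B x *\<^sub>R (moebU y (n - real m) (G (Suc k)) x * polylaplacian m \<phi> x)" for k x
  define h where "h k x = indicator ?B x *\<^sub>R ((- 4) ^ m * \<tau> ^ (2 * m) * moebU y (n + real m) (A k) x * \<phi> x)" for k x
  define f' where "f' x = indicator ?B x *\<^sub>R (moebU y (n - real m) g x * polylaplacian m \<phi> x)" for x
  define h' where "h' x = indicator ?B x *\<^sub>R ((- 4) ^ m * \<tau> ^ (2 * m) * moebU y (n + real m) (Aiter m (n - real m) g) x * \<phi> x)" for x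
  have int: "integrable lebesgue (f k)" "integrable lebesgue (h k)" "integrable lebesgue f'" "integrable lebesgue h'" for k
    unfolding f_def[abs_def] h_def[abs_def] f'_def[abs_def] h'_def[abs_def] set_integrable_def[symmetric]
    by (intro smooth_upto_set_integrable[OF open_ball bounded_ball, where k=0] smooth_upto_mult[OF open_ball]
          smooth_upto_moebU y sp su0 smooth_upto_const)+
  have eq: "integral\<^sup>L lebesgue (f k) = integral\<^sup>L lebesgue (h k)" for k
    using green_identity_regular[OF y G[of "Suc k"] su, of "n - real m"]
    unfolding f_def[abs_def] h_def[abs_def] set_lebesgue_integral_def A_def n_def \<tau>_def moebV_top by simp
  have intI: "integrable lebesgue (\<lambda>x. M * indicator ?B x :: real)" for M
    using emeasure_lborel_ball_finite[of "0::'a" 1]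
    by (intro integrable_mult_right integrable_real_indicator) auto
  obtain M1 where M1: "M1 \<ge> 0" "\<And>x. norm x < 1 \<Longrightarrow> \<bar>moebU y (n - real m) 1 x\<bar> \<le> M1"
    using moebU_bounded[OF y, of "n - real m" 1] by blast
  obtain M2 where M2: "M2 \<ge> 0" "\<And>x. norm x < 1 \<Longrightarrow> \<bar>moebU y n 1 x\<bar> \<le> M2"
    using moebU_bounded[OF y, of n 1] by blast
  have C0: "C \<ge> 0" "D \<ge> 0" using C[of 0 0] D[of 0 0] by (auto intro: order_trans[OF abs_ge_zero])
  have bf: "norm (f k x) \<le> (M1 * C * L) * indicator ?B x" for k x
  proof (cases "x \<in> ?B")
    case True
    have "\<bar>moebQ y x powr (- (n - real m))\<bar> \<le> M1" using M1(2)[of x] True by (simp add: moebU_def)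
    then have "\<bar>moebQ y x powr (- (n - real m))\<bar> * \<bar>poly (G (Suc k)) (moebr y x)\<bar> * \<bar>polylaplacian m \<phi> x\<bar> \<le> M1 * C * L"
      using C[OF r[OF True], of "Suc k"] L(2)[OF True] C0 M1(1) L(1) by (intro mult_mono) auto
    then show ?thesis using True by (simp add: f_def moebU_def abs_mult)
  qed (simp add: f_def)
  have bh: "norm (h k x) \<le> (4 ^ m * \<tau> ^ m * M2 * D * K) * indicator ?B x" for k x
  proof (cases "x \<in> ?B")
    case True
    then have x: "norm x < 1" by simp
    have Q: "moebQ y x > 0" using moebQ_pos x y by (metis less_imp_le)
    \<comment> \<open>The decay of \<phi> is rewritten through 1 - |x| \<le> 1 - |x|^2 = (1 -
      \<rho>) Q / \<tau>, so that it matches the weight (1 - \<rho>)^m in the bound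
      \<open>D\<close>.\<close>
    have "1 - norm x \<le> 1 - (norm x)\<^sup>2" using x by (simp add: power2_eq_square mult_left_le_one_le)
    also have "\<dots> = (1 - moebr y x) * moebQ y x / \<tau>" using one_minus_moebr[of x y] x y Q \<tau> by (simp add: \<tau>_def)
    finally have "(1 - norm x) ^ m \<le> ((1 - moebr y x) * moebQ y x / \<tau>) ^ m" using x by (intro power_mono) auto
    then have "K * (1 - norm x) ^ m \<le> K * ((1 - moebr y x) * moebQ y x / \<tau>) ^ m" using K(1) by (rule mult_left_mono)
    then have \<phi>b: "\<bar>\<phi> x\<bar> \<le> K * ((1 - moebr y x) * moebQ y x / \<tau>) ^ m" using K(2)[OF True] by linarith
    have pq: "moebQ y x powr (- (n + real m)) * moebQ y x ^ m = moebQ y x powr (- n)"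
      using Q by (simp add: powr_realpow[symmetric] powr_add[symmetric])
    have "norm (h k x) = 4 ^ m * \<tau> ^ (2 * m) * (moebQ y x powr (- (n + real m)) * \<bar>poly (A k) (moebr y x)\<bar> * \<bar>\<phi> x\<bar>)"
      using True \<tau> by (simp add: h_def moebU_def abs_mult power_abs mult.assoc)
    also have "\<dots> \<le> 4 ^ m * \<tau> ^ (2 * m) * (moebQ y x powr (- (n + real m)) * \<bar>poly (A k) (moebr y x)\<bar> *
        (K * ((1 - moebr y x) * moebQ y x / \<tau>) ^ m))"
      using \<phi>b \<tau> by (intro mult_left_mono) auto
    also have "\<dots> = 4 ^ m * \<tau> ^ m * K * (moebQ y x powr (- (n + real m)) * moebQ y x ^ m) * (\<bar>poly (A k) (moebr y x)\<bar> * (1 - moebr y x) ^ m)"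
    proof -
      have key: "\<tau> ^ (2 * m) * (z * moebQ y x / \<tau>) ^ m = \<tau> ^ m * moebQ y x ^ m * z ^ m" for z
        using \<tau> by (simp add: power_mult_distrib power_divide mult_2 power_add)
      have e: "4 ^ m * \<tau> ^ (2 * m) * (a * b * (K * w)) = 4 ^ m * a * b * K * (\<tau> ^ (2 * m) * w)" for a b w
        by (simp add: mult_ac)
      show ?thesis unfolding e key by (simp add: mult_ac)
    qed
    also have "\<dots> \<le> 4 ^ m * \<tau> ^ m * K * M2 * D"
      unfolding pq using M2(2)[OF x] D[OF r[OF True], of "Suc k"] \<tau> K(1) M2(1) C0 r[OF True]
      by (intro mult_mono mult_nonneg_nonneg) (auto simp: moebU_def A_def)
    finally show ?thesis using True by (simp add: mult_ac)
  qed (simp add: h_def)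
  have "(\<lambda>k. integral\<^sup>L lebesgue (f k)) \<longlonglongrightarrow> integral\<^sup>L lebesgue f'"
  proof (rule integral_dominated_convergence[OF _ _ intI[of "M1 * C * L"]])
    show "AE x in lebesgue. (\<lambda>k. f k x) \<longlonglongrightarrow> f' x"
    proof (rule AE_I2)
      fix x :: 'a
      show "(\<lambda>k. f k x) \<longlonglongrightarrow> f' x"
      proof (cases "x \<in> ?B")
        case True
        have "(\<lambda>k. poly (G (Suc k)) (moebr y x)) \<longlonglongrightarrow> poly g (moebr y x)" using lim[OF r[OF True]] by (rule LIMSEQ_Suc)
        then show ?thesis unfolding f_def f'_def moebU_def by (intro tendsto_intros)
      qed (simp add: f_def f'_def)
    qed
  qed (use int bf in \<open>auto intro: borel_measurable_integrable\<close>)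
  moreover have "(\<lambda>k. integral\<^sup>L lebesgue (h k)) \<longlonglongrightarrow> integral\<^sup>L lebesgue h'"
  proof (rule integral_dominated_convergence[OF _ _ intI[of "4 ^ m * \<tau> ^ m * M2 * D * K"]])
    show "AE x in lebesgue. (\<lambda>k. h k x) \<longlonglongrightarrow> h' x"
    proof (rule AE_I2)
      fix x :: 'a
      show "(\<lambda>k. h k x) \<longlonglongrightarrow> h' x"
      proof (cases "x \<in> ?B")
        case True
        have "(\<lambda>k. poly (A k) (moebr y x)) \<longlonglongrightarrow> poly (Aiter m (n - real m) g) (moebr y x)"
          unfolding A_def using limA[OF r[OF True]] by (rule LIMSEQ_Suc)
        then show ?thesis unfolding h_def h'_def moebU_def by (intro tendsto_intros)
      qed (simp add: h_def h'_def)
    qed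
  qed (use int bh in \<open>auto intro: borel_measurable_integrable\<close>)
  ultimately have "integral\<^sup>L lebesgue f' = integral\<^sup>L lebesgue h'" unfolding eq by (rule LIMSEQ_unique)
  then show ?thesis unfolding f'_def[abs_def] h'_def[abs_def] set_lebesgue_integral_def n_def \<tau>_def by simp
qed

text \<open>The image under the covariance of the radial source 4^m (1 - |z|^2)^N. The sign (-1)^m
  of the radial problem cancels against (-4)^m from \<open>moebV_top\<close>, so the source is
  nonnegative.\<close>

definition moebF :: "nat \<Rightarrow> nat \<Rightarrow> 'a::euclidean_space \<Rightarrow> 'a \<Rightarrow> real" where
  "moebF m N y x = 4 ^ m * (1 - (norm y)\<^sup>2) ^ (2 * m) * moebQ y x powr (- (real DIM('a) / 2 + real m)) * (1 - moebr y x) ^ N"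

text \<open>The two bounds of order m serve opposite ends: the lower one supplies the denominators
  u^q and v^p, the upper one the convergence of the superposition.\<close>

lemma moebius_solutions:
  assumes m: "m \<ge> 1"
  obtains g :: "real poly" and d D where "d > 0"
    "\<And>t. 0 \<le> t \<Longrightarrow> t \<le> 1 \<Longrightarrow> d * (1 - t) ^ m \<le> poly g t"
    "\<And>t. 0 \<le> t \<Longrightarrow> t \<le> 1 \<Longrightarrow> poly g t \<le> D * (1 - t) ^ m"
    "\<And>(y::'a::euclidean_space) \<phi>. norm y < 1 \<Longrightarrow> \<phi> \<in> dirichlet_test m (ball 0 1) \<Longrightarrow>
      (LINT x:ball 0 1|lebesgue. moebU y (real DIM('a) / 2 - real m) g x * polylaplacian m \<phi> x) =
      (LINT x:ball 0 1|lebesgue. moebF m N y x * \<phi> x)"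
proof -
  obtain g d where g: "d > 0" "Aiter m (real DIM('a) / 2 - real m) g = smult ((- 1) ^ m) ([:1, -1:] ^ N)"
    "[:-1, 1:] ^ m dvd g" "\<And>t. 0 \<le> t \<Longrightarrow> t \<le> 1 \<Longrightarrow> d * (1 - t) ^ m \<le> poly g t"
    using radial_polynomial_solution[OF m, of "real DIM('a) / 2" N] by auto
  obtain h where h: "g = [:-1, 1:] ^ m * h" using g(3) by blast
  obtain D where D: "\<And>t. 0 \<le> t \<Longrightarrow> t \<le> 1 \<Longrightarrow> \<bar>poly h t\<bar> \<le> D"
    using weighted_bounded_const[of h, unfolded weighted_bounded_def, rule_format, of 0] by auto
  have up: "poly g t \<le> D * (1 - t) ^ m" if "0 \<le> t" "t \<le> 1" for t
  proof -
    have "\<bar>poly g t\<bar> = (1 - t) ^ m * \<bar>poly h t\<bar>"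
      using that by (simp add: h poly_mult poly_power abs_mult power_abs)
    also have "\<dots> \<le> (1 - t) ^ m * D" using D[OF that] that by (intro mult_left_mono) auto
    finally show ?thesis by (simp add: mult.commute)
  qed
  have eq: "(LINT x:ball 0 1|lebesgue. moebU y (real DIM('a) / 2 - real m) g x * polylaplacian m \<phi> x) =
      (LINT x:ball 0 1|lebesgue. moebF m N y x * \<phi> x)"
    if "norm y < 1" "\<phi> \<in> dirichlet_test m (ball 0 1)" for y :: 'a and \<phi>
  proof -
    have "(- 4) ^ m * (- 1) ^ m = (4::real) ^ m" by (simp add: power_mult_distrib[symmetric])
    then show ?thesis unfolding green_identity[OF that(1) g(3) that(2)] unfolding g(2) moebF_def moebU_def
      by (intro set_lebesgue_integral_cong) (auto simp: poly_power mult_ac)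
  qed
  show thesis by (rule that[OF g(1) g(4) up eq])
qed

section \<open>Superposition\<close>

lemma dyadic_scale:
  fixes r :: real assumes "0 < r" "r < 2"
  shows "\<exists>j. (1/2) ^ j \<le> r \<and> r < 2 * (1/2) ^ j"
proof -
  obtain i where i: "(1/2::real) ^ i < r" using real_arch_pow_inv[of r "1/2"] assms by auto
  define j where "j = (LEAST j. (1/2::real) ^ j \<le> r)"
  have j: "(1/2::real) ^ j \<le> r" unfolding j_def by (rule LeastI[of _ i]) (use i in simp)
  have "r < 2 * (1/2) ^ j"
  proof (cases j)
    case 0 then show ?thesis using assms by simp
  next
    case (Suc l)
    then have "\<not> (1/2::real) ^ l \<le> r" using not_less_Least[of l "\<lambda>j. (1/2::real) ^ j \<le> r"] unfolding j_def by simp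
    then show ?thesis using Suc by simp
  qed
  then show ?thesis using j by blast
qed

lemma half_powr: "((1/2::real) ^ k) powr s = ((1/2) powr s) ^ k"
  by (simp add: powr_realpow[symmetric] powr_powr mult.commute)

lemma summable_half_powr:
  assumes "s > 0" shows "summable (\<lambda>k. ((1/2::real) ^ k) powr s)"
  unfolding half_powr using assms powr_less_mono2[of s "1/2" 1] by (intro summable_geometric) auto

text \<open>The singular power is dominated by a sum over j of (1/2)^(j(\<epsilon> - n)) times the
  indicator of the ball of radius 2 (1/2)^j about \<open>e\<close>. The integrals of the summands
  are constant multiples of (1/2)^(j\<epsilon>), hence summable.\<close>

lemma set_integrable_norm_powr:
  fixes e :: "'a::euclidean_space"
  assumes \<epsilon>: "0 < \<epsilon>" "\<epsilon> \<le> real DIM('a)" and e: "norm e \<le> 1"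
  shows "set_integrable lebesgue (ball 0 1) (\<lambda>x. norm (x - e) powr (\<epsilon> - real DIM('a)))"
proof -
  define n where "n = real DIM('a)"
  define h where "h j x = ((1/2::real) ^ j) powr (\<epsilon> - n) * indicator (ball e (2 * (1/2) ^ j)) x" for j x
  have int: "integrable lborel (h j)" for j
    unfolding h_def by (intro integrable_mult_right integrable_real_indicator emeasure_bounded_finite) auto
  have h0: "h j x \<ge> 0" for j x by (simp add: h_def)
  have sumx: "summable (\<lambda>j. norm (h j x))" if "x \<noteq> e" for x
  proof -
    have "0 < dist e x / 2" using that by (simp add: eq_commute)
    then obtain i where i: "(1/2::real) ^ i < dist e x / 2" using real_arch_pow_inv[of "dist e x / 2" "1/2"] by auto
    have "norm (h j x) = 0" if "j \<notin> {..<i}" for j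
    proof -
      have "(1/2::real) ^ j \<le> (1/2) ^ i" using that by (intro power_decreasing) auto
      then have "\<not> dist e x < 2 * (1/2) ^ j" using i by linarith
      then show ?thesis by (simp add: h_def)
    qed
    then show ?thesis by (intro summable_finite[of "{..<i}"]) auto
  qed
  have ne: "AE x in lborel. x \<noteq> e" by (rule AE_lborel_singleton)
  have inth: "(\<integral>x. norm (h j x) \<partial>lborel) = unit_ball_vol n * 2 powr n * ((1/2) ^ j) powr \<epsilon>" for j
  proof -
    have "(\<integral>x. norm (h j x) \<partial>lborel) = ((1/2::real) ^ j) powr (\<epsilon> - n) * measure lborel (ball e (2 * (1/2) ^ j))"
      by (simp add: h_def)
    also have "measure lborel (ball e (2 * (1/2) ^ j)) = unit_ball_vol n * (2 * (1/2) ^ j) ^ DIM('a)"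
      unfolding n_def by (rule content_ball) simp
    also have "(2 * (1/2::real) ^ j) ^ DIM('a) = 2 powr n * ((1/2) ^ j) powr n"
      unfolding n_def by (subst powr_realpow[symmetric]) (simp_all add: powr_mult)
    finally show ?thesis by (simp add: powr_diff powr_minus field_simps)
  qed
  have sumi: "summable (\<lambda>j. \<integral>x. norm (h j x) \<partial>lborel)"
    unfolding inth by (intro summable_mult summable_half_powr \<epsilon>)
  have intS: "integrable lborel (\<lambda>x. \<Sum>j. h j x)"
    by (rule integrable_suminf[OF int _ sumi]) (use ne sumx in \<open>auto elim!: eventually_mono\<close>)
  have m: "(\<lambda>x. indicator (ball 0 1) x *\<^sub>R norm (x - e) powr (\<epsilon> - n)) \<in> borel_measurable lborel"
  proof -
    have "(\<lambda>x. norm (x - e)) \<in> borel_measurable lborel"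
      by (simp add: borel_measurable_continuous_onI continuous_intros)
    then have "(\<lambda>x. norm (x - e) powr (\<epsilon> - n)) \<in> borel_measurable lborel" by measurable
    then show ?thesis by (intro borel_measurable_scaleR borel_measurable_indicator) auto
  qed
  have "integrable lborel (\<lambda>x. indicator (ball 0 1) x *\<^sub>R norm (x - e) powr (\<epsilon> - n))"
  proof (rule Bochner_Integration.integrable_bound[OF intS m])
    show "AE x in lborel. norm (indicator (ball 0 1) x *\<^sub>R norm (x - e) powr (\<epsilon> - n)) \<le> norm (\<Sum>j. h j x)"
      using ne
    proof eventually_elim
      case (elim x)
      have s: "summable (\<lambda>j. h j x)" using sumx[OF elim] by (rule summable_norm_cancel)
      show ?case
      proof (cases "x \<in> ball 0 1")
        case True
        have "norm (x - e) < 2" using True e norm_triangle_ineq4[of x e] by simp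
        then obtain j where j: "(1/2::real) ^ j \<le> norm (x - e)" "norm (x - e) < 2 * (1/2) ^ j"
          using dyadic_scale[of "norm (x - e)"] elim by auto
        have "norm (x - e) powr (\<epsilon> - n) \<le> ((1/2) ^ j) powr (\<epsilon> - n)"
          using j(1) \<epsilon> by (intro powr_mono2') (auto simp: n_def)
        also have "\<dots> = h j x" using j(2) by (simp add: h_def dist_norm norm_minus_commute)
        also have "\<dots> \<le> (\<Sum>j. h j x)" using sum_le_suminf[OF s, of "{j}"] h0 by simp
        finally show ?thesis using True by simp
      qed simp
    qed
  qed
  then show ?thesis unfolding set_integrable_def n_def[symmetric] using m by (simp add: integrable_completion)
qed

text \<open>The terms peak at the scale (1/2)^k near \<delta>. Larger scales contribute
  (1/2)^(k(a-b)), smaller ones (1/2)^(ka) \<delta>^-b up to a constant; both decay geometrically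
  away from the peak, so the sum is comparable to its largest term.\<close>

lemma dyadic_sum_bound:
  fixes a b :: real
  assumes a: "0 < a" "a < b"
  obtains C where "C \<ge> 0"
    "\<And>\<delta>. 0 < \<delta> \<Longrightarrow> \<delta> < 2 \<Longrightarrow> summable (\<lambda>k. ((1/2) ^ k) powr a * max ((1/2) ^ k) (\<delta> / 2) powr (- b))"
    "\<And>\<delta>. 0 < \<delta> \<Longrightarrow> \<delta> < 2 \<Longrightarrow> (\<Sum>k. ((1/2) ^ k) powr a * max ((1/2) ^ k) (\<delta> / 2) powr (- b)) \<le> C * \<delta> powr (a - b)"
proof -
  \<comment> \<open>The slower of the two decay rates, so that one ratio \<theta> works on both
    sides of the peak.\<close>
  define c where "c = min a (b - a)"
  define \<theta> where "\<theta> = (1/2::real) powr c"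
  have c: "c > 0" "c \<le> a" "c \<le> b - a" using a by (auto simp: c_def)
  have \<theta>: "0 < \<theta>" "\<theta> < 1" using c powr_less_mono2[of c "1/2" 1] by (auto simp: \<theta>_def)
  define C where "C = 2 powr b * 2 powr (b - a) * (2 / (1 - \<theta>))"
  show thesis
  proof (rule that[of C])
    show "C \<ge> 0" using \<theta> by (simp add: C_def)
    fix \<delta> :: real assume \<delta>: "0 < \<delta>" "\<delta> < 2"
    obtain j where j: "(1/2) ^ j \<le> \<delta>" "\<delta> < 2 * (1/2) ^ j" using dyadic_scale[OF \<delta>] by blast
    define s where "s k = ((1/2) ^ k) powr a * max ((1/2) ^ k) (\<delta> / 2) powr (- b)" for k
    define q where "q k = (if k < j then \<theta> ^ (j - k) else \<theta> ^ (k - j))" for k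
    define A where "A = 2 powr b * ((1/2) ^ j) powr (a - b)"
    have A: "A \<ge> 0" by (simp add: A_def)
    have p2: "((1/2::real) ^ i) powr r = 2 powr (- (real i * r))" for i r
      by (simp add: half_powr powr_realpow[symmetric] powr_powr powr_divide powr_minus_divide mult.commute)
    have \<theta>p: "\<theta> ^ i = 2 powr (- (c * real i))" for i
      using p2[of i c] unfolding half_powr \<theta>_def by (simp add: mult.commute)
    have sq: "s k \<le> A * q k" for k
    proof (cases "k < j")
      case True
      have "s k \<le> ((1/2) ^ k) powr a * ((1/2) ^ k) powr (- b)"
        unfolding s_def using a by (intro mult_left_mono powr_mono2') auto
      also have "\<dots> = 2 powr (real k * (b - a))" by (simp add: p2 powr_add[symmetric] algebra_simps)
      also have "\<dots> \<le> 2 powr (b + real j * (b - a) - c * real (j - k))"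
      proof (rule powr_mono)
        have "c * real (j - k) \<le> (b - a) * real (j - k)" using c by (intro mult_right_mono) auto
        also have "\<dots> = (b - a) * real j - (b - a) * real k" using True by (simp add: of_nat_diff algebra_simps)
        finally show "real k * (b - a) \<le> b + real j * (b - a) - c * real (j - k)" using a by (simp add: algebra_simps)
      qed simp
      also have "\<dots> = A * q k" using True
        by (simp add: A_def q_def p2 \<theta>p powr_add[symmetric] algebra_simps)
      finally show ?thesis .
    next
      case False
      have "(1/2) ^ Suc j \<le> max ((1/2) ^ k) (\<delta> / 2)" using j(1) by simp
      then have "s k \<le> ((1/2) ^ k) powr a * ((1/2) ^ Suc j) powr (- b)"
        unfolding s_def using a by (intro mult_left_mono powr_mono2') auto
      also have "\<dots> = 2 powr (real (Suc j) * b - real k * a)" unfolding p2 by (simp add: powr_add[symmetric] algebra_simps)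
      also have "\<dots> \<le> 2 powr (b + real j * (b - a) - c * real (k - j))"
      proof (rule powr_mono)
        have "c * real (k - j) \<le> a * real (k - j)" using c by (intro mult_right_mono) auto
        also have "\<dots> = a * real k - a * real j" using False by (simp add: of_nat_diff algebra_simps)
        finally show "real (Suc j) * b - real k * a \<le> b + real j * (b - a) - c * real (k - j)" by (simp add: algebra_simps)
      qed simp
      also have "\<dots> = A * q k" using False
        by (simp add: A_def q_def p2 \<theta>p powr_add[symmetric] algebra_simps)
      finally show ?thesis .
    qed
    have geo: "summable (\<lambda>k. \<theta> ^ k)" "(\<Sum>k. \<theta> ^ k) = 1 / (1 - \<theta>)"
      using \<theta> by (auto intro: summable_geometric suminf_geometric)
    have qj: "(\<lambda>k. q (k + j)) = (\<lambda>k. \<theta> ^ k)" by (rule ext) (simp add: q_def)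
    then have sumq: "summable q" using geo(1) summable_iff_shift[of q j] by simp
    have "(\<Sum>k<j. q k) \<le> (\<Sum>k<j. \<theta> ^ (j - Suc k))"
      using \<theta> by (intro sum_mono) (auto simp: q_def intro!: power_decreasing)
    also have "\<dots> = (\<Sum>k<j. \<theta> ^ k)" by (rule sum.nat_diff_reindex)
    also have "\<dots> \<le> (\<Sum>k. \<theta> ^ k)" using \<theta> by (intro sum_le_suminf geo) auto
    finally have qle: "(\<Sum>k. q k) \<le> 2 / (1 - \<theta>)"
      using suminf_split_initial_segment[OF sumq, of j] qj geo(2) by simp
    have s0: "s k \<ge> 0" for k by (simp add: s_def)
    have sums: "summable s"
      by (rule summable_comparison_test'[OF summable_mult[OF sumq, of A]]) (use s0 sq in auto)
    have "(\<Sum>k. s k) \<le> (\<Sum>k. A * q k)" by (intro suminf_le sq sums summable_mult sumq)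
    also have "\<dots> = A * (\<Sum>k. q k)" by (rule suminf_mult[OF sumq])
    also have "\<dots> \<le> A * (2 / (1 - \<theta>))" by (rule mult_left_mono[OF qle A])
    finally have le: "(\<Sum>k. s k) \<le> A * (2 / (1 - \<theta>))" .
    have "((1/2) ^ j) powr (a - b) \<le> (\<delta> / 2) powr (a - b)"
      using j(2) \<delta> a by (intro powr_mono2') auto
    also have "\<dots> = 2 powr (b - a) * \<delta> powr (a - b)"
      using \<delta> by (simp add: powr_divide powr_diff field_simps)
    finally have "A \<le> 2 powr b * (2 powr (b - a) * \<delta> powr (a - b))" unfolding A_def by (intro mult_left_mono) auto
    then have "A * (2 / (1 - \<theta>)) \<le> 2 powr b * (2 powr (b - a) * \<delta> powr (a - b)) * (2 / (1 - \<theta>))"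
      using \<theta> by (intro mult_right_mono) auto
    then show "summable (\<lambda>k. ((1/2) ^ k) powr a * max ((1/2) ^ k) (\<delta> / 2) powr (- b))"
      "(\<Sum>k. ((1/2) ^ k) powr a * max ((1/2) ^ k) (\<delta> / 2) powr (- b)) \<le> C * \<delta> powr (a - b)"
      using sums le unfolding s_def[abs_def] C_def by (simp_all add: mult_ac)
  qed
qed

text \<open>A majorant of product form r_k H(x) gives both requirements of termwise integration at
  once: absolute convergence at every point and summability of the integrals of |f_k|.\<close>

lemma set_integral_dominated_series:
  fixes f :: "nat \<Rightarrow> 'a::euclidean_space \<Rightarrow> real"
  assumes S: "open S" and f: "\<And>k. continuous_on S (f k)"
    and bound: "\<And>k x. x \<in> S \<Longrightarrow> \<bar>f k x\<bar> \<le> r k * H x"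
    and H: "set_integrable lebesgue S H" and r: "summable r"
  shows "set_integrable lebesgue S (\<lambda>x. \<Sum>k. f k x)"
    and "(LINT x:S|lebesgue. \<Sum>k. f k x) = (\<Sum>k. LINT x:S|lebesgue. f k x)"
proof -
  let ?f = "\<lambda>k x. indicator S x *\<^sub>R f k x" and ?H = "\<lambda>x. indicator S x *\<^sub>R H x"
  have H': "integrable lebesgue ?H" using H by (simp add: set_integrable_def)
  have b: "norm (?f k x) \<le> r k * ?H x" for k x using bound[of x k] by (auto split: split_indicator)
  have m: "?f k \<in> borel_measurable lebesgue" for k
    by (rule measurable_completion) (use borel_measurable_continuous_on_indicator[OF _ f] S in auto)
  have int: "integrable lebesgue (?f k)" for k
    by (rule Bochner_Integration.integrable_bound[OF integrable_mult_right[OF H', of "r k"] m])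
       (auto intro!: AE_I2 order_trans[OF b[unfolded real_norm_def]] abs_ge_self simp del: real_scaleR_def)
  have s: "summable (\<lambda>k. norm (?f k x))" for x
    by (rule summable_comparison_test'[OF summable_mult2[OF r, of "?H x"]]) (use b in auto)
  have si: "summable (\<lambda>k. \<integral>x. norm (?f k x) \<partial>lebesgue)"
  proof (rule summable_comparison_test'[OF summable_mult2[OF r, of "integral\<^sup>L lebesgue ?H"]])
    fix k
    have "(\<integral>x. norm (?f k x) \<partial>lebesgue) \<le> (\<integral>x. r k * ?H x \<partial>lebesgue)"
      by (intro integral_mono integrable_norm int integrable_mult_right H' b)
    then show "norm (\<integral>x. norm (?f k x) \<partial>lebesgue) \<le> r k * integral\<^sup>L lebesgue ?H" by simp
  qed
  have e: "(\<lambda>x. \<Sum>k. ?f k x) = (\<lambda>x. indicator S x *\<^sub>R (\<Sum>k. f k x))"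
    by (rule ext) (simp split: split_indicator)
  show "set_integrable lebesgue S (\<lambda>x. \<Sum>k. f k x)"
    using integrable_suminf[OF int AE_I2[OF s] si] unfolding set_integrable_def e .
  show "(LINT x:S|lebesgue. \<Sum>k. f k x) = (\<Sum>k. LINT x:S|lebesgue. f k x)"
    using integral_suminf[OF int AE_I2[OF s] si] unfolding set_lebesgue_integral_def e .
qed

lemma bdist_unit_ball_le:
  fixes x :: "'a::euclidean_space"
  assumes "norm x < 1" shows "bdist (ball 0 1) x \<le> 1 - norm x"
proof -
  obtain v :: 'a where v: "norm v = 1" "x = norm x *\<^sub>R v"
  proof (cases "x = 0")
    case True then show ?thesis using that vector_choose_size[of 1] by (metis norm_zero scaleR_zero_left zero_le_one)
  next
    case False then show ?thesis by (intro that[of "x /\<^sub>R norm x"]) auto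
  qed
  have "bdist (ball 0 1) x \<le> dist x v"
    unfolding bdist_def using v by (intro infdist_le) (simp add: frontier_ball)
  also have "\<dots> = 1 - norm x"
  proof -
    have "v - x = (1 - norm x) *\<^sub>R v" using v(2) by (simp add: scaleR_diff_left)
    then show ?thesis using v(1) assms by (simp add: dist_norm norm_minus_commute[of x])
  qed
  finally show ?thesis .
qed

text \<open>The source is controlled only after multiplication by (1 - |x|)^m. That suffices for the
  weighted space, since \<open>bdist\<close> is at most 1 - |x|, and for the pairing with a test
  function, since that decays to order m.\<close>

lemma superposition_solution:
  fixes U F :: "nat \<Rightarrow> 'a::euclidean_space \<Rightarrow> real"
  assumes cU: "\<And>k. continuous_on (ball 0 1) (U k)" and cF: "\<And>k. continuous_on (ball 0 1) (F k)"
    and U: "\<And>k x. x \<in> ball 0 1 \<Longrightarrow> 0 \<le> U k x \<and> U k x \<le> r k * H x"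
    and F: "\<And>k x. x \<in> ball 0 1 \<Longrightarrow> 0 \<le> F k x \<and> F k x * (1 - norm x) ^ m \<le> r k * H x"
    and H: "set_integrable lebesgue (ball 0 1) H" and r: "summable r"
    and sol: "\<And>k \<phi>. \<phi> \<in> dirichlet_test m (ball 0 1) \<Longrightarrow>
      (LINT x:ball 0 1|lebesgue. U k x * polylaplacian m \<phi> x) = (LINT x:ball 0 1|lebesgue. F k x * \<phi> x)"
  shows "dirichlet_solution m (ball 0 1) (\<lambda>x. \<Sum>k. F k x) (\<lambda>x. \<Sum>k. U k x)"
    and "\<And>x. x \<in> ball 0 1 \<Longrightarrow> summable (\<lambda>k. U k x)"
    and "\<And>x. x \<in> ball 0 1 \<Longrightarrow> summable (\<lambda>k. F k x)"
proof -
  let ?B = "ball (0::'a) 1"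
  show sU: "summable (\<lambda>k. U k x)" if "x \<in> ?B" for x
    by (rule summable_comparison_test'[OF summable_mult2[OF r, of "H x"]]) (use U that in auto)
  show sF: "summable (\<lambda>k. F k x)" if x: "x \<in> ?B" for x
  proof (rule summable_comparison_test'[OF summable_mult2[OF r, of "H x / (1 - norm x) ^ m"]])
    fix k
    have "(1 - norm x) ^ m > 0" using x by simp
    then show "norm (F k x) \<le> r k * (H x / (1 - norm x) ^ m)" using F[OF x, of k] by (simp add: field_simps)
  qed
  have "set_integrable lebesgue ?B (\<lambda>x. \<Sum>k. U k x)"
    by (rule set_integral_dominated_series(1)[OF open_ball cU _ H r]) (use U in auto)
  moreover have "(\<lambda>x. \<Sum>k. F k x) \<in> L1_weighted m ?B"
  proof -
    have m: "(\<lambda>x. indicator ?B x *\<^sub>R (\<Sum>k. F k x)) \<in> borel_measurable lebesgue"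
    proof -
      have e: "(\<lambda>x. \<Sum>k. indicator ?B x *\<^sub>R F k x) = (\<lambda>x. indicator ?B x *\<^sub>R (\<Sum>k. F k x))"
        by (rule ext) (simp split: split_indicator)
      have "(\<lambda>x. indicator ?B x *\<^sub>R F k x) \<in> borel_measurable borel" for k
        by (rule borel_measurable_continuous_on_indicator[OF _ cF]) simp
      then have "(\<lambda>x. \<Sum>k. indicator ?B x *\<^sub>R F k x) \<in> borel_measurable borel"
        by (intro borel_measurable_suminf)
      then show ?thesis unfolding e by (intro measurable_completion) simp
    qed
    have I: "set_integrable lebesgue ?B (\<lambda>x. \<Sum>k. F k x * (1 - norm x) ^ m)"
      by (rule set_integral_dominated_series(1)[OF open_ball _ _ H r])
         (use F cF in \<open>auto simp: abs_mult intro!: continuous_intros\<close>)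
    have mb: "(\<lambda>x. bdist ?B x) \<in> borel_measurable borel"
      unfolding bdist_def by (intro borel_measurable_continuous_onI continuous_on_infdist continuous_on_id)
    have "set_integrable lebesgue ?B (\<lambda>x. \<bar>\<Sum>k. F k x\<bar> * bdist ?B x ^ m)"
      unfolding set_integrable_def
    proof (rule Bochner_Integration.integrable_bound[OF I[unfolded set_integrable_def]])
      have "(\<lambda>x. \<bar>indicator ?B x *\<^sub>R (\<Sum>k. F k x)\<bar> * bdist ?B x ^ m) \<in> borel_measurable lebesgue"
        using m measurable_completion[of "bdist ?B" lborel borel] mb by auto
      moreover have "(\<lambda>x. indicator ?B x *\<^sub>R (\<bar>\<Sum>k. F k x\<bar> * bdist ?B x ^ m)) =
          (\<lambda>x. \<bar>indicator ?B x *\<^sub>R (\<Sum>k. F k x)\<bar> * bdist ?B x ^ m)"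
        by (rule ext) (simp split: split_indicator)
      ultimately show "(\<lambda>x. indicator ?B x *\<^sub>R (\<bar>\<Sum>k. F k x\<bar> * bdist ?B x ^ m)) \<in> borel_measurable lebesgue"
        by simp
      show "AE x in lebesgue. norm (indicator ?B x *\<^sub>R (\<bar>\<Sum>k. F k x\<bar> * bdist ?B x ^ m))
          \<le> norm (indicator ?B x *\<^sub>R (\<Sum>k. F k x * (1 - norm x) ^ m))"
      proof (rule AE_I2)
        fix x :: 'a
        show "norm (indicator ?B x *\<^sub>R (\<bar>\<Sum>k. F k x\<bar> * bdist ?B x ^ m))
          \<le> norm (indicator ?B x *\<^sub>R (\<Sum>k. F k x * (1 - norm x) ^ m))"
        proof (cases "x \<in> ?B")
          case True
          have "bdist ?B x ^ m \<le> (1 - norm x) ^ m"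
            using bdist_unit_ball_le[of x] True by (intro power_mono) (auto simp: bdist_def infdist_nonneg)
          then have "\<bar>\<Sum>k. F k x\<bar> * bdist ?B x ^ m \<le> \<bar>\<Sum>k. F k x\<bar> * (1 - norm x) ^ m" by (intro mult_left_mono) auto
          moreover have "bdist ?B x \<ge> 0" by (simp add: bdist_def infdist_nonneg)
          ultimately show ?thesis using True suminf_mult2[OF sF[OF True], of "(1 - norm x) ^ m"]
            by (simp add: abs_mult)
        qed simp
      qed
    qed
    then show ?thesis using m by (simp add: L1_weighted_def set_borel_measurable_def)
  qed
  moreover have "(LINT x:?B|lebesgue. (\<Sum>k. U k x) * polylaplacian m \<phi> x) = (LINT x:?B|lebesgue. (\<Sum>k. F k x) * \<phi> x)"
    if \<phi>: "\<phi> \<in> dirichlet_test m ?B" for \<phi>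
  proof -
    have su: "smooth_upto (0 + 2 * m) ?B \<phi>" using \<phi> by (auto simp: dirichlet_test_def Ck_closure_iff)
    have sp: "smooth_upto 0 ?B (polylaplacian m \<phi>)" by (rule smooth_upto_polylaplacian[OF open_ball su])
    obtain L where L: "0 \<le> L" "\<And>x. x \<in> ?B \<Longrightarrow> norm (polylaplacian m \<phi> x) \<le> L"
      using smooth_upto_bounded[OF sp bounded_ball] by blast
    obtain K where K: "K \<ge> 0" "\<And>x. x \<in> ?B \<Longrightarrow> \<bar>\<phi> x\<bar> \<le> K * (1 - norm x) ^ m"
      using dirichlet_test_decay[OF \<phi>] by blast
    have "(LINT x:?B|lebesgue. (\<Sum>k. U k x) * polylaplacian m \<phi> x) = (LINT x:?B|lebesgue. (\<Sum>k. U k x * polylaplacian m \<phi> x))"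
      using suminf_mult2[OF sU] by (intro set_lebesgue_integral_cong) auto
    also have "\<dots> = (\<Sum>k. LINT x:?B|lebesgue. U k x * polylaplacian m \<phi> x)"
    proof (rule set_integral_dominated_series(2)[OF open_ball _ _ H summable_mult[OF r, of L]])
      show "continuous_on ?B (\<lambda>x. U k x * polylaplacian m \<phi> x)" for k
        using cU smooth_upto_continuous_on[OF sp] by (intro continuous_intros)
      show "\<bar>U k x * polylaplacian m \<phi> x\<bar> \<le> L * r k * H x" if "x \<in> ?B" for k x
        using mult_mono[OF conjunct2[OF U[OF that, of k]] L(2)[OF that]] U[OF that, of k] by (simp add: abs_mult mult_ac)
    qed
    also have "\<dots> = (\<Sum>k. LINT x:?B|lebesgue. F k x * \<phi> x)" using sol[OF \<phi>] by simp
    also have "\<dots> = (LINT x:?B|lebesgue. (\<Sum>k. F k x * \<phi> x))"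
    proof (rule set_integral_dominated_series(2)[OF open_ball _ _ H summable_mult[OF r, of K], symmetric])
      show "continuous_on ?B (\<lambda>x. F k x * \<phi> x)" for k
        using cF smooth_upto_continuous_on[OF su] by (intro continuous_intros)
      show "\<bar>F k x * \<phi> x\<bar> \<le> K * r k * H x" if x: "x \<in> ?B" for k x
      proof -
        have "\<bar>F k x * \<phi> x\<bar> \<le> F k x * (K * (1 - norm x) ^ m)"
          using F[OF x, of k] K(2)[OF x] by (simp add: abs_mult mult_left_mono)
        also have "\<dots> = K * (F k x * (1 - norm x) ^ m)" by simp
        also have "\<dots> \<le> K * (r k * H x)" using F[OF x, of k] K(1) by (intro mult_left_mono) auto
        finally show ?thesis by (simp add: mult_ac)
      qed
    qed
    also have "\<dots> = (LINT x:?B|lebesgue. (\<Sum>k. F k x) * \<phi> x)"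
      using suminf_mult2[OF sF] by (intro set_lebesgue_integral_cong) auto
    finally show ?thesis .
  qed
  ultimately show "dirichlet_solution m ?B (\<lambda>x. \<Sum>k. F k x) (\<lambda>x. \<Sum>k. U k x)"
    unfolding dirichlet_solution_def by blast
qed

section \<open>The singular solution on the ball\<close>

text \<open>For t < 1, R is |y| times the distance from \<open>x\<close> to the reflected pole
  y/|y|^2, which explains why Q is its square. As R is comparable to |x - e| + t, all estimates near
  \<open>e\<close> can be expressed through R, t and 1 - |x|^2.\<close>

lemma moeb_radial_pole:
  fixes x e :: "'a::euclidean_space" and t :: real
  assumes e: "norm e = 1" and x: "norm x < 1" and t: "0 < t" "t \<le> 1"
  defines "R \<equiv> norm (e - (1 - t) *\<^sub>R x)" and "y \<equiv> (1 - t) *\<^sub>R e"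
  shows "moebQ y x = R\<^sup>2" "t \<le> R" "1 - norm x \<le> R" "norm (x - e) / 2 \<le> R" "R \<le> norm (x - e) + t"
    "0 < R" "norm y < 1" "t \<le> 1 - (norm y)\<^sup>2" "1 - (norm y)\<^sup>2 \<le> 2 * t"
    "1 - (norm x)\<^sup>2 \<le> 2 * R" "0 < 1 - (norm x)\<^sup>2"
    "1 - moebr y x = (1 - (norm x)\<^sup>2) * (1 - (norm y)\<^sup>2) / R\<^sup>2"
proof -
  have ny: "norm y = 1 - t" using e t by (simp add: y_def)
  show y1: "norm y < 1" using ny t by simp
  show Q: "moebQ y x = R\<^sup>2"
    unfolding moebQ_def ny unfolding R_def y_def power2_norm_eq_inner using e
    by (simp add: norm_eq_1 algebra_simps inner_commute power2_eq_square)
  have xt: "(1 - t) * norm x \<le> 1 - t" "(1 - t) * norm x \<le> norm x"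
    using x t by (auto simp: mult_left_le mult_left_le_one_le)
  have "1 - (1 - t) * norm x \<le> R"
    using norm_triangle_ineq2[of e "(1 - t) *\<^sub>R x"] e t by (simp add: R_def)
  then show tR: "t \<le> R" and xR: "1 - norm x \<le> R" using xt by auto
  show Rp: "0 < R" using tR t by simp
  have tx1: "t * norm x \<le> t" using x t by (simp add: mult_left_le)
  have "norm (e - x) \<le> R + t * norm x"
    using norm_triangle_ineq4[of "e - (1 - t) *\<^sub>R x" "t *\<^sub>R x"] t by (simp add: R_def algebra_simps)
  then show "norm (x - e) / 2 \<le> R" using tx1 tR by (simp add: norm_minus_commute)
  have "R \<le> norm (e - x) + t * norm x"
    using norm_triangle_ineq[of "e - x" "t *\<^sub>R x"] t by (simp add: R_def algebra_simps)
  then show "R \<le> norm (x - e) + t" using tx1 by (simp add: norm_minus_commute)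
  have tt: "t * t \<le> t" using t by (simp add: mult_left_le)
  show "t \<le> 1 - (norm y)\<^sup>2" "1 - (norm y)\<^sup>2 \<le> 2 * t"
    unfolding ny using t tt by (auto simp: power2_eq_square algebra_simps)
  have "1 - (norm x)\<^sup>2 = (1 - norm x) * (1 + norm x)" by (simp add: power2_eq_square algebra_simps)
  also have "\<dots> \<le> (1 - norm x) * 2" using x by (intro mult_left_mono) auto
  finally show "1 - (norm x)\<^sup>2 \<le> 2 * R" using xR by simp
  show "0 < 1 - (norm x)\<^sup>2" using x by (simp add: power_less_one_iff abs_square_less_1)
  show "1 - moebr y x = (1 - (norm x)\<^sup>2) * (1 - (norm y)\<^sup>2) / R\<^sup>2"
    using one_minus_moebr[of x y] x y1 Q by simp
qed

text \<open>The quotient (1 - |x|^2) / |x - e| measures how tangentially \<open>e\<close> is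
  approached. The lower bound on \<open>u\<close> carries its m-th power, while the order M at which
  \<open>f\<close> vanishes can be prescribed; this freedom is what later makes the sources
  comparable with v^p and u^q.\<close>

lemma ball_singular_solution:
  fixes e :: "'a::euclidean_space"
  assumes m: "m \<ge> 1" and \<gamma>: "0 < \<gamma>" "\<gamma> < real DIM('a) - real m" and M: "0 \<le> M" and e: "norm e = 1"
  obtains f u c C where "c > 0" "dirichlet_solution m (ball 0 1) f u"
    "\<And>x. x \<in> ball 0 1 \<Longrightarrow> 0 \<le> f x" "\<And>x. x \<in> ball 0 1 \<Longrightarrow> 0 \<le> u x"
    "\<And>x. x \<in> ball 0 1 \<Longrightarrow> c * (((1 - (norm x)\<^sup>2) / norm (x - e)) ^ m * norm (x - e) powr (- \<gamma>)) \<le> u x"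
    "\<And>x. x \<in> ball 0 1 \<Longrightarrow> f x \<le> C * (((1 - (norm x)\<^sup>2) / norm (x - e)) powr M * norm (x - e) powr (- (\<gamma> + 2 * real m)))"
proof -
  let ?B = "ball (0::'a) 1"
  define n where "n = real DIM('a)"
  \<comment> \<open>The radial source must be a polynomial, so the real order M is rounded up to a
    natural N.\<close>
  obtain N :: nat where N: "M \<le> real N" using real_arch_simple by blast
  obtain g :: "real poly" and d D where d: "d > 0"
    and gl: "\<And>t. 0 \<le> t \<Longrightarrow> t \<le> 1 \<Longrightarrow> d * (1 - t) ^ m \<le> poly g t"
    and gu: "\<And>t. 0 \<le> t \<Longrightarrow> t \<le> 1 \<Longrightarrow> poly g t \<le> D * (1 - t) ^ m"
    and sol: "\<And>(y::'a::euclidean_space) \<phi>. norm y < 1 \<Longrightarrow> \<phi> \<in> dirichlet_test m (ball 0 1) \<Longrightarrow>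
      (LINT x:ball 0 1|lebesgue. moebU y (real DIM('a) / 2 - real m) g x * polylaplacian m \<phi> x) =
      (LINT x:ball 0 1|lebesgue. moebF m N y x * \<phi> x)"
    by (rule moebius_solutions[OF m]) (rule that)
  have D: "D > 0" using gl[of 0] gu[of 0] d by simp
  define t where "t k = (1/2::real) ^ k" for k :: nat
  have t: "0 < t k" "t k \<le> 1" for k by (auto simp: t_def power_le_one)
  define y where "y k = (1 - t k) *\<^sub>R e" for k
  define R where "R k x = norm (e - (1 - t k) *\<^sub>R x)" for k x
  define w where "w x = 1 - (norm x)\<^sup>2" for x :: 'a
  define \<tau> where "\<tau> k = 1 - (norm (y k))\<^sup>2" for k
  define \<delta> where "\<delta> x = norm (x - e)" for x
  define \<zeta> where "\<zeta> k x = w x * \<tau> k / (R k x)\<^sup>2" for k x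
  have geo: "moebQ (y k) x = (R k x)\<^sup>2" "t k \<le> R k x" "1 - norm x \<le> R k x" "\<delta> x / 2 \<le> R k x" "R k x \<le> \<delta> x + t k"
    "0 < R k x" "norm (y k) < 1" "t k \<le> \<tau> k" "\<tau> k \<le> 2 * t k" "w x \<le> 2 * R k x"
    "1 - moebr (y k) x = \<zeta> k x" if "x \<in> ?B" for k x
    using moeb_radial_pole[OF e _ t(1)[of k] t(2)[of k], of x] that
    unfolding R_def y_def \<delta>_def w_def \<tau>_def \<zeta>_def by simp_all
  have w0: "0 < w x" if "x \<in> ?B" for x
    using that by (simp add: w_def power_less_one_iff abs_square_less_1)
  have ny: "norm (y k) < 1" for k using e t[of k] by (simp add: y_def)
  have \<delta>: "0 < \<delta> x" "\<delta> x < 2" if "x \<in> ?B" for x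
  proof -
    show "0 < \<delta> x" using that e by (auto simp: \<delta>_def)
    show "\<delta> x < 2" using that e norm_triangle_ineq4[of x e] by (simp add: \<delta>_def)
  qed
  have rr: "0 \<le> moebr (y k) x" "moebr (y k) x \<le> 1" "1 - moebr (y k) x = \<zeta> k x" if "x \<in> ?B" for k x
    using moebr_range[OF _ ny[of k], of x] geo(11)[OF that, of k] that by auto
  have \<zeta>: "0 < \<zeta> k x" "\<zeta> k x \<le> 1" if "x \<in> ?B" for k x
  proof -
    show "0 < \<zeta> k x" unfolding \<zeta>_def using geo[OF that, of k] w0[OF that] t[of k] by (intro divide_pos_pos mult_pos_pos) auto
    show "\<zeta> k x \<le> 1" using rr(1,3)[OF that, of k] by linarith
  qed
  \<comment> \<open>Near its own scale, where R is comparable to t_k, the unweighted solution has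
    size t_k^-(n - 2m). This weight turns it into t_k^-\<gamma>, and the source into t_k^-(\<gamma>
    + 2m).\<close>
  define l where "l k = t k powr (n - 2 * real m - \<gamma>)" for k
  define U where "U k x = l k * moebU (y k) (n / 2 - real m) g x" for k x
  define F where "F k x = l k * moebF m N (y k) x" for k x
  have R2: "((R k x)\<^sup>2) powr s = R k x powr (2 * s)" if "x \<in> ?B" for k x s
  proof -
    have "(R k x)\<^sup>2 = R k x powr 2" using geo(6)[OF that, of k] by (simp add: powr_numeral)
    then show ?thesis by (simp only: powr_powr)
  qed
  have P: "(R k x)\<^sup>2 powr (- (n / 2 - real m)) * \<zeta> k x ^ m = w x ^ m * \<tau> k ^ m * R k x powr (- n)"
    if x: "x \<in> ?B" for k x
  proof -
    have "\<zeta> k x ^ m = w x ^ m * \<tau> k ^ m * R k x powr (- 2 * real m)"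
    proof -
      have "((R k x)\<^sup>2) ^ m = R k x powr (2 * real m)"
        using geo(6)[OF x, of k] powr_realpow[of "R k x" "2 * m"] by (simp add: power_mult[symmetric])
      then show ?thesis by (simp add: \<zeta>_def power_divide power_mult_distrib powr_minus divide_inverse power_inverse)
    qed
    then show ?thesis unfolding R2[OF x] by (simp add: powr_add[symmetric] algebra_simps)
  qed
  have Ulow: "d * l k * (w x ^ m * \<tau> k ^ m * R k x powr (- n)) \<le> U k x" if x: "x \<in> ?B" for k x
  proof -
    have "d * \<zeta> k x ^ m \<le> poly g (moebr (y k) x)"
      using gl[OF rr(1,2)[OF x], of k] unfolding rr(3)[OF x] .
    then have "l k * ((R k x)\<^sup>2 powr (- (n / 2 - real m)) * (d * \<zeta> k x ^ m)) \<le> U k x"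
      unfolding U_def moebU_def geo(1)[OF x] by (intro mult_left_mono) (auto simp: l_def)
    then show ?thesis using P[OF x, of k] by (simp add: mult_ac)
  qed
  have Uup: "U k x \<le> D * l k * (w x ^ m * \<tau> k ^ m * R k x powr (- n))" if x: "x \<in> ?B" for k x
  proof -
    have "poly g (moebr (y k) x) \<le> D * \<zeta> k x ^ m"
      using gu[OF rr(1,2)[OF x], of k] unfolding rr(3)[OF x] .
    then have "U k x \<le> l k * ((R k x)\<^sup>2 powr (- (n / 2 - real m)) * (D * \<zeta> k x ^ m))"
      unfolding U_def moebU_def geo(1)[OF x] by (intro mult_left_mono) (auto simp: l_def)
    then show ?thesis using P[OF x, of k] by (simp add: mult_ac)
  qed
  have U0: "0 \<le> U k x" if x: "x \<in> ?B" for k x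
    by (rule order_trans[OF _ Ulow[OF x]])
       (use d geo[OF x, of k] w0[OF x] t[of k] in \<open>auto intro!: mult_nonneg_nonneg simp: l_def\<close>)
  have Feq: "F k x = 4 ^ m * l k * \<tau> k ^ (2 * m) * R k x powr (- (n + 2 * real m)) * \<zeta> k x ^ N" if x: "x \<in> ?B" for k x
  proof -
    have "2 * (- (real DIM('a) / 2 + real m)) = - (n + 2 * real m)" by (simp add: n_def)
    then show ?thesis unfolding F_def moebF_def geo(1)[OF x] rr(3)[OF x] R2[OF x]
      by (simp add: \<tau>_def mult_ac)
  qed
  have F0: "0 \<le> F k x" if x: "x \<in> ?B" for k x
    unfolding Feq[OF x] using geo[OF x, of k] w0[OF x] t[of k] \<zeta>[OF x, of k] by (intro mult_nonneg_nonneg) (auto simp: l_def)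
  have Fup: "F k x \<le> 16 ^ m * t k powr (n - \<gamma>) * R k x powr (- (n + 2 * real m)) * \<zeta> k x ^ N" if x: "x \<in> ?B" for k x
  proof -
    have "\<tau> k ^ (2 * m) \<le> (2 * t k) ^ (2 * m)" using geo[OF x, of k] w0[OF x] t[of k] by (intro power_mono) auto
    also have "\<dots> = 4 ^ m * t k powr (2 * real m)"
      using t[of k] powr_realpow[of "t k" "2 * m"] by (simp add: power_mult_distrib power_mult)
    finally have "4 ^ m * l k * \<tau> k ^ (2 * m) \<le> 4 ^ m * l k * (4 ^ m * t k powr (2 * real m))"
      by (intro mult_left_mono) (auto simp: l_def)
    also have "\<dots> = (4 ^ m * 4 ^ m) * (l k * t k powr (2 * real m))" by (simp only: mult_ac)
    also have "\<dots> = 16 ^ m * t k powr (n - \<gamma>)"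
      by (simp add: l_def powr_add[symmetric] power_mult_distrib[symmetric])
    finally show ?thesis unfolding Feq[OF x]
      using \<zeta>[OF x, of k] by (intro mult_right_mono) auto
  qed
  \<comment> \<open>At most half of the room between \<gamma> and n - m. In the bound for
    \<open>F\<close> one \<epsilon> makes |x - e|^(\<epsilon> - n) integrable and the other makes
    t_k^\<epsilon> summable.\<close>
  define \<epsilon> where "\<epsilon> = min 1 (n - real m - \<gamma>) / 2"
  have \<epsilon>: "0 < \<epsilon>" "\<epsilon> \<le> 1" "2 * \<epsilon> \<le> n - real m - \<gamma>" "\<epsilon> < n" "\<epsilon> \<le> real m"
    using \<gamma> m by (auto simp: \<epsilon>_def n_def)
  define K where "K = (D * 4 ^ m * 3 powr real m + 16 ^ m) * 2 powr (n - \<epsilon>)"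
  define H where "H x = K * norm (x - e) powr (\<epsilon> - n)" for x
  define r where "r k = t k powr \<epsilon>" for k
  have RH: "R k x powr (\<epsilon> - n) \<le> 2 powr (n - \<epsilon>) * \<delta> x powr (\<epsilon> - n)" if x: "x \<in> ?B" for k x
  proof -
    have "R k x powr (\<epsilon> - n) \<le> (\<delta> x / 2) powr (\<epsilon> - n)"
      using geo(4)[OF x, of k] \<delta>[OF x] \<epsilon> by (intro powr_mono2') auto
    also have "\<dots> = 2 powr (n - \<epsilon>) * \<delta> x powr (\<epsilon> - n)"
      using \<delta>[OF x] by (simp add: powr_divide powr_diff field_simps)
    finally show ?thesis .
  qed
  have tpow: "t k powr s \<le> r k" if "\<epsilon> \<le> s" for k s
    unfolding r_def using t[of k] that by (intro powr_mono') auto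
  have UH: "U k x \<le> r k * H x" if x: "x \<in> ?B" for k x
  proof -
    note G = geo[OF x, of k] w0[OF x]
    have "w x ^ m \<le> (2 * R k x) ^ m" by (rule power_mono) (use G in auto)
    moreover have "\<tau> k ^ m \<le> (2 * t k) ^ m" by (rule power_mono) (use G t[of k] in auto)
    ultimately have "w x ^ m * \<tau> k ^ m * R k x powr (- n) \<le> (2 * R k x) ^ m * (2 * t k) ^ m * R k x powr (- n)"
      using G t[of k] by (intro mult_mono mult_right_mono) auto
    also have "\<dots> = (2 ^ m * 2 ^ m) * t k ^ m * (R k x ^ m * R k x powr (- n))"
      by (simp add: power_mult_distrib mult_ac)
    also have "\<dots> = 4 ^ m * t k powr real m * R k x powr (real m - n)"
    proof -
      have "R k x ^ m * R k x powr (- n) = R k x powr (real m - n)"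
        using powr_realpow[OF G(6), of m] powr_add[of "R k x" "real m" "- n"] by simp
      moreover have "2 ^ m * 2 ^ m = (4::real) ^ m" by (simp add: power_mult_distrib[symmetric])
      ultimately show ?thesis unfolding powr_realpow[OF t(1)] by simp
    qed
    finally have "D * l k * (w x ^ m * \<tau> k ^ m * R k x powr (- n)) \<le> D * l k * (4 ^ m * t k powr real m * R k x powr (real m - n))"
      using D by (intro mult_left_mono) (auto simp: l_def)
    also have "\<dots> = D * 4 ^ m * (l k * t k powr real m) * R k x powr (real m - n)" by (simp only: mult_ac)
    also have "l k * t k powr real m = t k powr (n - real m - \<gamma>)"
      unfolding l_def powr_add[symmetric] by (rule arg_cong[where f="(powr) (t k)"]) simp
    also have "R k x powr (real m - n) = R k x powr (\<epsilon> - n) * R k x powr (real m - \<epsilon>)"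
      by (simp add: powr_add[symmetric])
    also have "D * 4 ^ m * t k powr (n - real m - \<gamma>) * (R k x powr (\<epsilon> - n) * R k x powr (real m - \<epsilon>))
       \<le> D * 4 ^ m * r k * ((2 powr (n - \<epsilon>) * \<delta> x powr (\<epsilon> - n)) * 3 powr real m)"
    proof (intro mult_mono mult_nonneg_nonneg RH[OF x] tpow)
      have "R k x \<le> 3" using G(5) \<delta>[OF x] t[of k] by simp
      then have "R k x powr (real m - \<epsilon>) \<le> 3 powr (real m - \<epsilon>)" using G(6) \<epsilon> by (intro powr_mono2) auto
      also have "\<dots> \<le> 3 powr real m" using \<epsilon> by (intro powr_mono) auto
      finally show "R k x powr (real m - \<epsilon>) \<le> 3 powr real m" .
    qed (use D \<epsilon> in \<open>auto simp: r_def\<close>)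
    also have "\<dots> = r k * ((D * 4 ^ m * 3 powr real m) * 2 powr (n - \<epsilon>) * \<delta> x powr (\<epsilon> - n))" by (simp add: mult_ac)
    also have "\<dots> \<le> r k * H x"
      unfolding H_def K_def \<delta>_def by (intro mult_left_mono mult_right_mono) (auto simp: r_def)
    finally show ?thesis using Uup[OF x, of k] by linarith
  qed
  have FH: "F k x * (1 - norm x) ^ m \<le> r k * H x" if x: "x \<in> ?B" for k x
  proof -
    note G = geo[OF x, of k] w0[OF x]
    have "\<zeta> k x ^ N \<le> 1" using \<zeta>[OF x, of k] by (intro power_le_one) auto
    then have "16 ^ m * t k powr (n - \<gamma>) * R k x powr (- (n + 2 * real m)) * \<zeta> k x ^ N \<le>
        16 ^ m * t k powr (n - \<gamma>) * R k x powr (- (n + 2 * real m)) * 1" by (intro mult_left_mono) auto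
    then have "F k x \<le> 16 ^ m * t k powr (n - \<gamma>) * R k x powr (- (n + 2 * real m))"
      using Fup[OF x, of k] unfolding mult_1_right by linarith
    moreover have "(1 - norm x) ^ m \<le> R k x ^ m" using G(3) x by (intro power_mono) auto
    ultimately have "F k x * (1 - norm x) ^ m \<le> 16 ^ m * t k powr (n - \<gamma>) * R k x powr (- (n + 2 * real m)) * R k x ^ m"
      using F0[OF x, of k] x by (intro mult_mono) auto
    also have "\<dots> = 16 ^ m * t k powr (n - \<gamma>) * (R k x powr (\<epsilon> - n) * R k x powr (- real m - \<epsilon>))"
    proof -
      have "R k x powr (- (n + 2 * real m)) * R k x ^ m = R k x powr (\<epsilon> - n) * R k x powr (- real m - \<epsilon>)"
        unfolding powr_realpow[OF G(6), symmetric] powr_add[symmetric]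
        by (rule arg_cong[where f="(powr) (R k x)"]) simp
      then show ?thesis by (simp add: mult.assoc)
    qed
    also have "\<dots> \<le> 16 ^ m * t k powr (n - \<gamma>) * ((2 powr (n - \<epsilon>) * \<delta> x powr (\<epsilon> - n)) * t k powr (- real m - \<epsilon>))"
    proof (intro mult_left_mono mult_mono RH[OF x])
      show "R k x powr (- real m - \<epsilon>) \<le> t k powr (- real m - \<epsilon>)" using G(2) t[of k] \<epsilon> by (intro powr_mono2') auto
    qed auto
    also have "\<dots> = t k powr (n - \<gamma> - real m - \<epsilon>) * (16 ^ m * 2 powr (n - \<epsilon>) * \<delta> x powr (\<epsilon> - n))"
    proof -
      have "t k powr (n - \<gamma> - real m - \<epsilon>) = t k powr (n - \<gamma>) * t k powr (- real m - \<epsilon>)"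
        unfolding powr_add[symmetric] by (rule arg_cong[where f="(powr) (t k)"]) simp
      then show ?thesis by (simp add: mult_ac)
    qed
    also have "\<dots> \<le> r k * (16 ^ m * 2 powr (n - \<epsilon>) * \<delta> x powr (\<epsilon> - n))"
      using \<epsilon> by (intro mult_right_mono tpow) auto
    also have "\<dots> \<le> r k * H x"
      unfolding H_def K_def \<delta>_def using D by (intro mult_left_mono mult_right_mono) (auto simp: r_def)
    finally show ?thesis .
  qed
  have H: "set_integrable lebesgue ?B H"
    unfolding H_def using set_integrable_norm_powr[of \<epsilon> e] \<epsilon> e
    by (intro set_integrable_mult_right) (simp_all add: n_def)
  have r: "summable r" unfolding r_def t_def by (rule summable_half_powr[OF \<epsilon>(1)])
  have cU: "continuous_on ?B (U k)" for k
    unfolding U_def by (intro continuous_intros smooth_upto_continuous_on[OF smooth_upto_moebU[OF ny, of 0]])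
  have cF: "continuous_on ?B (F k)" for k
  proof -
    have "continuous_on ?B (\<lambda>x. l k * (4 ^ m * \<tau> k ^ (2 * m) * moebU (y k) (n / 2 + real m) ([:1, -1:] ^ N) x))"
      by (intro continuous_intros smooth_upto_continuous_on[OF smooth_upto_moebU[OF ny, of 0]])
    then show ?thesis
      by (simp add: F_def[abs_def] moebF_def moebU_def \<tau>_def n_def mult.assoc)
  qed
  have solk: "(LINT x:?B|lebesgue. U k x * polylaplacian m \<phi> x) = (LINT x:?B|lebesgue. F k x * \<phi> x)"
    if "\<phi> \<in> dirichlet_test m ?B" for k \<phi>
    using sol[OF ny[of k] that] unfolding U_def F_def n_def by (simp add: mult.assoc)
  have UU: "0 \<le> U k x \<and> U k x \<le> r k * H x" if "x \<in> ?B" for k x using U0 UH that by blast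
  have FF: "0 \<le> F k x \<and> F k x * (1 - norm x) ^ m \<le> r k * H x" if "x \<in> ?B" for k x using F0 FH that by blast
  have S1: "dirichlet_solution m ?B (\<lambda>x. \<Sum>k. F k x) (\<lambda>x. \<Sum>k. U k x)"
    by (rule superposition_solution(1)[OF cU cF UU FF H r solk])
  have S2: "summable (\<lambda>k. U k x)" if "x \<in> ?B" for x
    by (rule superposition_solution(2)[OF cU cF UU FF H r solk]) (use that in auto)
  have S3: "summable (\<lambda>k. F k x)" if "x \<in> ?B" for x
    by (rule superposition_solution(3)[OF cU cF UU FF H r solk]) (use that in auto)
  define c where "c = d * (1/2) powr (n - real m - \<gamma>) * 2 powr (- n)"
  have low: "c * ((w x / \<delta> x) ^ m * \<delta> x powr (- \<gamma>)) \<le> (\<Sum>k. U k x)" if x: "x \<in> ?B" for x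
  proof -
    \<comment> \<open>For the lower bound one summand suffices: the one whose scale t_j is that of
      |x - e|.\<close>
    obtain j where j: "(1/2) ^ j \<le> \<delta> x" "\<delta> x < 2 * (1/2) ^ j" using dyadic_scale[OF \<delta>[OF x]] by blast
    note G = geo[OF x, of j] w0[OF x]
    have "(\<delta> x / 2) powr (n - real m - \<gamma>) \<le> t j powr (n - real m - \<gamma>)"
      using j \<delta>[OF x] \<epsilon> by (intro powr_mono2) (auto simp: t_def)
    moreover have "(2 * \<delta> x) powr (- n) \<le> R j x powr (- n)"
      using j G(5,6) by (intro powr_mono2') (auto simp: n_def t_def)
    ultimately have "(\<delta> x / 2) powr (n - real m - \<gamma>) * (2 * \<delta> x) powr (- n) \<le> t j powr (n - real m - \<gamma>) * R j x powr (- n)"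
      by (intro mult_mono) auto
    then have "d * w x ^ m * ((\<delta> x / 2) powr (n - real m - \<gamma>) * (2 * \<delta> x) powr (- n)) \<le> d * w x ^ m * (t j powr (n - real m - \<gamma>) * R j x powr (- n))"
      using d G by (intro mult_left_mono) auto
    also have "\<dots> = d * l j * (w x ^ m * t j ^ m * R j x powr (- n))"
    proof -
      have "t j powr (n - real m - \<gamma>) = l j * t j ^ m"
        unfolding powr_realpow[OF t(1), symmetric] l_def powr_add[symmetric]
        by (rule arg_cong[where f="(powr) (t j)"]) simp
      then show ?thesis by (simp add: mult_ac)
    qed
    also have "\<dots> \<le> d * l j * (w x ^ m * \<tau> j ^ m * R j x powr (- n))"
      using d G t[of j] by (intro mult_left_mono mult_right_mono power_mono) (auto simp: l_def)
    also have "\<dots> \<le> U j x" by (rule Ulow[OF x])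
    also have "\<dots> \<le> (\<Sum>k. U k x)" using sum_le_suminf[OF S2[OF x], of "{j}"] U0[OF x] by simp
    finally have "d * w x ^ m * ((\<delta> x / 2) powr (n - real m - \<gamma>) * (2 * \<delta> x) powr (- n)) \<le> (\<Sum>k. U k x)" .
    moreover have "(\<delta> x / 2) powr (n - real m - \<gamma>) * (2 * \<delta> x) powr (- n) =
        (1/2) powr (n - real m - \<gamma>) * 2 powr (- n) * (\<delta> x powr (- \<gamma>) / \<delta> x ^ m)"
    proof -
      have 1: "\<delta> x powr (- \<gamma>) / \<delta> x ^ m = \<delta> x powr (n - real m - \<gamma>) * \<delta> x powr (- n)"
        unfolding powr_realpow[OF \<delta>(1)[OF x], symmetric] powr_add[symmetric] powr_diff[symmetric]
        by (rule arg_cong[where f="(powr) (\<delta> x)"]) simp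
      have 2: "(\<delta> x / 2) powr (n - real m - \<gamma>) = (1/2) powr (n - real m - \<gamma>) * \<delta> x powr (n - real m - \<gamma>)"
        using powr_mult[of "1/2" "\<delta> x"] by simp
      have 3: "(2 * \<delta> x) powr (- n) = 2 powr (- n) * \<delta> x powr (- n)"
        by (rule powr_mult)
      show ?thesis unfolding 1 2 3 by (simp only: mult_ac)
    qed
    moreover have "c * ((w x / \<delta> x) ^ m * \<delta> x powr (- \<gamma>)) =
        d * w x ^ m * ((1/2) powr (n - real m - \<gamma>) * 2 powr (- n) * (\<delta> x powr (- \<gamma>) / \<delta> x ^ m))"
      unfolding c_def divide_inverse by (simp only: mult_ac power_mult_distrib power_inverse)
    ultimately show ?thesis by (simp only:)
  qed
  \<comment> \<open>With \<zeta> at most 2 w t / R^2, a source bounded by t^(n - \<gamma>) R^-(n +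
    2m) \<zeta>^M has powers t^a and R^-b. The difference a - b = -(\<gamma> + 2m) - M supplies the
    singularity together with the \<delta>^-M that turns w^M into (w/\<delta>)^M.\<close>
  define a where "a = n - \<gamma> + M"
  define b where "b = n + 2 * real m + 2 * M"
  have ab: "0 < a" "a < b" using \<gamma> M by (auto simp: a_def b_def n_def)
  obtain C where C: "C \<ge> 0" "\<And>\<delta>. 0 < \<delta> \<Longrightarrow> \<delta> < 2 \<Longrightarrow> summable (\<lambda>k. t k powr a * max (t k) (\<delta> / 2) powr (- b))"
     "\<And>\<delta>. 0 < \<delta> \<Longrightarrow> \<delta> < 2 \<Longrightarrow> (\<Sum>k. t k powr a * max (t k) (\<delta> / 2) powr (- b)) \<le> C * \<delta> powr (a - b)"
    by (rule dyadic_sum_bound[OF ab, folded t_def]) (rule that)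
  have up: "(\<Sum>k. F k x) \<le> (16 ^ m * 2 powr M * C) * ((w x / \<delta> x) powr M * \<delta> x powr (- (\<gamma> + 2 * real m)))" if x: "x \<in> ?B" for x
  proof -
    define A where "A = 16 ^ m * 2 powr M * w x powr M"
    have A: "A \<ge> 0" by (simp add: A_def)
    let ?s = "\<lambda>k. t k powr a * max (t k) (\<delta> x / 2) powr (- b)"
    \<comment> \<open>Since \<zeta> \<le> 1, the exponent N may be lowered to M. Then R is replaced
      by its lower bound max(t_k, \<delta>/2), which produces the dyadic sum.\<close>
    have F1: "F k x \<le> A * ?s k" for k
    proof -
      note G = geo[OF x, of k] w0[OF x]
      have "\<zeta> k x ^ N = \<zeta> k x powr real N" using \<zeta>[OF x, of k] by (simp add: powr_realpow)
      also have "\<dots> \<le> \<zeta> k x powr M" by (rule powr_mono') (use \<zeta>[OF x, of k] N in auto)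
      also have "\<dots> \<le> (w x * (2 * t k) / (R k x)\<^sup>2) powr M"
      proof (rule powr_mono2[OF M])
        show "\<zeta> k x \<le> w x * (2 * t k) / (R k x)\<^sup>2"
          unfolding \<zeta>_def by (rule divide_right_mono, rule mult_left_mono) (use G in auto)
      qed (use \<zeta>[OF x, of k] in simp)
      also have "\<dots> = (w x * (2 * t k)) powr M / ((R k x)\<^sup>2) powr M" by (rule powr_divide)
      also have "\<dots> = (w x * (2 * t k)) powr M * R k x powr (- 2 * M)"
        unfolding R2[OF x] by (simp add: powr_minus divide_inverse)
      also have "(w x * (2 * t k)) powr M = 2 powr M * w x powr M * t k powr M"
        by (simp only: powr_mult mult_ac)
      finally have "16 ^ m * t k powr (n - \<gamma>) * R k x powr (- (n + 2 * real m)) * \<zeta> k x ^ N \<le>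
          16 ^ m * t k powr (n - \<gamma>) * R k x powr (- (n + 2 * real m)) * (2 powr M * w x powr M * t k powr M * R k x powr (- 2 * M))"
        by (intro mult_left_mono) auto
      also have "\<dots> = A * ((t k powr (n - \<gamma>) * t k powr M) * (R k x powr (- (n + 2 * real m)) * R k x powr (- 2 * M)))"
        unfolding A_def by (simp only: mult_ac)
      also have "\<dots> = A * (t k powr a * R k x powr (- b))"
      proof -
        have "n - \<gamma> + M = a" "- (n + 2 * real m) + - 2 * M = - b" by (simp_all add: a_def b_def)
        then show ?thesis unfolding powr_add[symmetric] by simp
      qed
      also have "\<dots> \<le> A * ?s k"
      proof (intro mult_left_mono powr_mono2' A)
        show "0 < max (t k) (\<delta> x / 2)" using t(1)[of k] by simp
        show "max (t k) (\<delta> x / 2) \<le> R k x" using G by simp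
      qed (use ab in auto)
      finally show ?thesis using Fup[OF x, of k] by linarith
    qed
    have "(\<Sum>k. F k x) \<le> (\<Sum>k. A * ?s k)"
      by (intro suminf_le F1 S3[OF x] summable_mult C(2) \<delta>[OF x])
    also have "\<dots> = A * (\<Sum>k. ?s k)" by (rule suminf_mult[OF C(2)[OF \<delta>[OF x]]])
    also have "\<dots> \<le> A * (C * \<delta> x powr (a - b))" by (intro mult_left_mono C(3) \<delta>[OF x] A)
    also have "\<delta> x powr (a - b) = \<delta> x powr (- (\<gamma> + 2 * real m)) * \<delta> x powr (- M)"
      unfolding powr_add[symmetric] a_def b_def by (rule arg_cong[where f="(powr) (\<delta> x)"]) simp
    also have "A * (C * (\<delta> x powr (- (\<gamma> + 2 * real m)) * \<delta> x powr (- M))) = (16 ^ m * 2 powr M * C) * ((w x / \<delta> x) powr M * \<delta> x powr (- (\<gamma> + 2 * real m)))"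
      unfolding A_def powr_divide unfolding powr_minus divide_inverse by (simp only: mult_ac)
    finally show ?thesis .
  qed
  show thesis
  proof (rule that)
    show "c > 0" using d by (simp add: c_def)
    show "dirichlet_solution m ?B (\<lambda>x. \<Sum>k. F k x) (\<lambda>x. \<Sum>k. U k x)" by (rule S1)
    show "0 \<le> (\<Sum>k. F k x)" "0 \<le> (\<Sum>k. U k x)" if "x \<in> ?B" for x
      using suminf_nonneg[OF S3[OF that] F0[OF that]] suminf_nonneg[OF S2[OF that] U0[OF that]] by auto
    show "c * (((1 - (norm x)\<^sup>2) / norm (x - e)) ^ m * norm (x - e) powr (- \<gamma>)) \<le> (\<Sum>k. U k x)" if "x \<in> ?B" for x
      using low[OF that] by (simp add: w_def \<delta>_def)
    show "(\<Sum>k. F k x) \<le> (16 ^ m * 2 powr M * C) * (((1 - (norm x)\<^sup>2) / norm (x - e)) powr M * norm (x - e) powr (- (\<gamma> + 2 * real m)))"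
      if "x \<in> ?B" for x using up[OF that] by (simp add: w_def \<delta>_def)
  qed
qed

section \<open>The system on the ball\<close>

lemma not_in_L_infinity:
  fixes u :: "'a::euclidean_space \<Rightarrow> real"
  assumes "\<And>M. \<exists>S. open S \<and> S \<noteq> {} \<and> S \<subseteq> \<Omega> \<and> (\<forall>x\<in>S. M < u x)"
  shows "u \<notin> L_infinity \<Omega>"
proof
  assume "u \<in> L_infinity \<Omega>"
  then obtain M where M: "AE x in lebesgue. x \<in> \<Omega> \<longrightarrow> \<bar>u x\<bar> \<le> M" by (auto simp: L_infinity_def)
  obtain S where S: "open S" "S \<noteq> {}" "S \<subseteq> \<Omega>" "\<forall>x\<in>S. M < u x" using assms by blast
  obtain N where N: "N \<in> null_sets lebesgue" "{x \<in> space lebesgue. \<not> (x \<in> \<Omega> \<longrightarrow> \<bar>u x\<bar> \<le> M)} \<subseteq> N"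
    using M unfolding eventually_ae_filter by blast
  have "S \<subseteq> N" using S N(2) by fastforce
  then have "negligible S" using N(1) negligible_iff_null_sets negligible_subset by blast
  then show False using open_not_negligible S by blast
qed

lemma dirichlet_solution_cong:
  assumes "dirichlet_solution m \<Omega> f u" "\<And>x. x \<in> \<Omega> \<Longrightarrow> f x = g x"
  shows "dirichlet_solution m \<Omega> g u"
proof -
  have e: "(\<lambda>x. indicator \<Omega> x *\<^sub>R f x) = (\<lambda>x. indicator \<Omega> x *\<^sub>R g x)"
    "(\<lambda>x. indicator \<Omega> x *\<^sub>R (\<bar>f x\<bar> * bdist \<Omega> x ^ m)) = (\<lambda>x. indicator \<Omega> x *\<^sub>R (\<bar>g x\<bar> * bdist \<Omega> x ^ m))"
    "(\<lambda>x. indicator \<Omega> x *\<^sub>R (f x * \<phi> x)) = (\<lambda>x. indicator \<Omega> x *\<^sub>R (g x * \<phi> x))" for \<phi>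
    using assms(2) by (auto simp: fun_eq_iff split: split_indicator)
  show ?thesis using assms(1)
    unfolding dirichlet_solution_def L1_weighted_def set_borel_measurable_def set_integrable_def
      set_lebesgue_integral_def mem_Collect_eq e .
qed

text \<open>The coefficients are the quotients \<open>f / v\<^sup>p\<close> and \<open>h / u\<^sup>q\<close>; where the denominator vanishes,
  so does the numerator, and the quotient is \<open>0\<close>.\<close>

lemma system_of_solutions:
  fixes f h u v :: "'a::euclidean_space \<Rightarrow> real"
  assumes fu: "dirichlet_solution m \<Omega> f u" and hv: "dirichlet_solution m \<Omega> h v"
    and pos: "\<And>x. x \<in> \<Omega> \<Longrightarrow> 0 \<le> f x \<and> 0 \<le> h x \<and> 0 \<le> u x \<and> 0 \<le> v x"
    and f: "\<And>x. x \<in> \<Omega> \<Longrightarrow> f x \<le> C * v x powr p" and h: "\<And>x. x \<in> \<Omega> \<Longrightarrow> h x \<le> D * u x powr q"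
    and unb: "u \<notin> L_infinity \<Omega>" "v \<notin> L_infinity \<Omega>"
  shows "\<exists>a b :: 'a \<Rightarrow> real.
           set_borel_measurable lebesgue \<Omega> a \<and> set_borel_measurable lebesgue \<Omega> b \<and>
           (\<forall>x\<in>\<Omega>. 0 \<le> a x) \<and> (\<forall>x\<in>\<Omega>. 0 \<le> b x) \<and>
           bounded (a ` \<Omega>) \<and> bounded (b ` \<Omega>) \<and>
           (\<exists>u v. nonneg_system_solution m \<Omega> p q a b u v \<and>
              u \<notin> L_infinity \<Omega> \<and> v \<notin> L_infinity \<Omega>)"
proof -
  have coeff: "set_borel_measurable lebesgue \<Omega> (\<lambda>x. f x / v x powr p) \<and> (\<forall>x\<in>\<Omega>. 0 \<le> f x / v x powr p) \<and>
      bounded ((\<lambda>x. f x / v x powr p) ` \<Omega>) \<and> (\<forall>x\<in>\<Omega>. f x = f x / v x powr p * v x powr p)"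
    if s: "dirichlet_solution m \<Omega> f u" "dirichlet_solution m \<Omega> h v"
      and pos: "\<And>x. x \<in> \<Omega> \<Longrightarrow> 0 \<le> f x \<and> 0 \<le> v x" and f: "\<And>x. x \<in> \<Omega> \<Longrightarrow> f x \<le> C * v x powr p"
    for f h u v :: "'a \<Rightarrow> real" and C p
  proof (intro conjI ballI)
    have m: "(\<lambda>x. indicator \<Omega> x *\<^sub>R f x) \<in> borel_measurable lebesgue" "(\<lambda>x. indicator \<Omega> x *\<^sub>R v x) \<in> borel_measurable lebesgue"
      using s by (auto simp: dirichlet_solution_def L1_weighted_def set_borel_measurable_def set_integrable_def
          intro: borel_measurable_integrable)
    have "(\<lambda>x. (indicator \<Omega> x *\<^sub>R f x) / (indicator \<Omega> x *\<^sub>R v x) powr p) \<in> borel_measurable lebesgue"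
      by (intro borel_measurable_divide powr_real_measurable m borel_measurable_const)
    moreover have "(\<lambda>x. (indicator \<Omega> x *\<^sub>R f x) / (indicator \<Omega> x *\<^sub>R v x) powr p) = (\<lambda>x. indicator \<Omega> x *\<^sub>R (f x / v x powr p))"
      by (rule ext) (simp split: split_indicator)
    ultimately show "set_borel_measurable lebesgue \<Omega> (\<lambda>x. f x / v x powr p)"
      by (simp add: set_borel_measurable_def)
    show "0 \<le> f x / v x powr p" if "x \<in> \<Omega>" for x using pos[OF that] by simp
    show "f x = f x / v x powr p * v x powr p" if "x \<in> \<Omega>" for x
      using pos[OF that] f[OF that] by (cases "v x = 0") auto
    have "\<bar>f x / v x powr p\<bar> \<le> \<bar>C\<bar>" if "x \<in> \<Omega>" for x
    proof (cases "v x powr p = 0")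
      case False
      then have v: "0 < v x powr p" by simp
      have "f x \<le> \<bar>C\<bar> * v x powr p" by (rule order_trans[OF f[OF that]]) (intro mult_right_mono, auto)
      then show ?thesis using v pos[OF that] by (simp add: field_simps)
    qed simp
    then show "bounded ((\<lambda>x. f x / v x powr p) ` \<Omega>)" unfolding bounded_iff by auto
  qed
  have A: "set_borel_measurable lebesgue \<Omega> (\<lambda>x. f x / v x powr p)" "\<forall>x\<in>\<Omega>. 0 \<le> f x / v x powr p"
      "bounded ((\<lambda>x. f x / v x powr p) ` \<Omega>)" "\<And>x. x \<in> \<Omega> \<Longrightarrow> f x = f x / v x powr p * v x powr p"
    using coeff[OF fu hv _ f] pos by auto
  have B: "set_borel_measurable lebesgue \<Omega> (\<lambda>x. h x / u x powr q)" "\<forall>x\<in>\<Omega>. 0 \<le> h x / u x powr q"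
      "bounded ((\<lambda>x. h x / u x powr q) ` \<Omega>)" "\<And>x. x \<in> \<Omega> \<Longrightarrow> h x = h x / u x powr q * u x powr q"
    using coeff[OF hv fu _ h] pos by auto
  have "nonneg_system_solution m \<Omega> p q (\<lambda>x. f x / v x powr p) (\<lambda>x. h x / u x powr q) u v"
    unfolding nonneg_system_solution_def
    using dirichlet_solution_cong[OF fu A(4)] dirichlet_solution_cong[OF hv B(4)] pos by simp
  then show ?thesis using A(1-3) B(1-3) unb by blast
qed

text \<open>On the ball of radius s/2 about (1 - s) e both 1 - |x|^2 and |x - e| are comparable to
  s, so the boundary factor is harmless and the lower bound is a constant times s^-\<gamma>. The
  estimate holds on an open set, so null sets cannot hide it.\<close>

lemma profile_not_in_L_infinity:
  fixes e :: "'a::euclidean_space"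
  assumes e: "norm e = 1" and c: "c > 0" and \<gamma>: "\<gamma> > 0"
    and low: "\<And>x. x \<in> ball 0 1 \<Longrightarrow> c * (((1 - (norm x)\<^sup>2) / norm (x - e)) ^ m * norm (x - e) powr (- \<gamma>)) \<le> u x"
  shows "u \<notin> L_infinity (ball 0 1)"
proof (rule not_in_L_infinity)
  fix M :: real
  \<comment> \<open>Chosen so that c (1/3)^m K = 2c/3^m + |M| exceeds M. The radius \<open>s\<close>
    is then fixed by (3s/2)^-\<gamma> = K, with 3s/2 the largest possible |x - e| on the
    ball.\<close>
  define K where "K = 2 + \<bar>M\<bar> * 3 ^ m / c"
  have K: "K > 1" using c by (simp add: K_def add_pos_nonneg)
  define s where "s = (2/3) * K powr (- (1 / \<gamma>))"
  have "K powr (- (1 / \<gamma>)) < 1" using K \<gamma> powr_less_mono[of "- (1 / \<gamma>)" 0 K] by simp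
  then have s: "0 < s" "s < 1" using K by (auto simp: s_def)
  have sK: "(3 * s / 2) powr (- \<gamma>) = K" using K \<gamma> by (simp add: s_def powr_powr)
  let ?S = "ball ((1 - s) *\<^sub>R e) (s / 2)"
  have S: "x \<in> ball 0 1 \<and> M < u x" if "x \<in> ?S" for x
  proof -
    have d: "norm (x - (1 - s) *\<^sub>R e) < s / 2" using that by (simp add: dist_norm norm_minus_commute)
    have nx: "norm x \<le> norm (x - (1 - s) *\<^sub>R e) + (1 - s)"
      using norm_triangle_ineq[of "x - (1 - s) *\<^sub>R e" "(1 - s) *\<^sub>R e"] e s by simp
    then have x: "norm x < 1 - s / 2" using d by simp
    have "norm (x - e) \<le> norm (x - (1 - s) *\<^sub>R e) + norm (s *\<^sub>R e)"
      using norm_triangle_ineq4[of "x - (1 - s) *\<^sub>R e" "s *\<^sub>R e"] by (simp add: algebra_simps)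
    then have up: "norm (x - e) \<le> 3 * s / 2" using d e s by simp
    have xB: "x \<in> ball 0 1" using x s by simp
    have \<delta>: "norm (x - e) > 0" using xB e by auto
    have "norm x * norm x \<le> norm x" using x s by (simp add: mult_left_le)
    then have w: "s / 2 \<le> 1 - (norm x)\<^sup>2" using x by (simp add: power2_eq_square)
    have "(s / 2) / (3 * s / 2) \<le> (1 - (norm x)\<^sup>2) / norm (x - e)"
      using w up \<delta> s by (intro frac_le) auto
    then have "(1 / 3) ^ m \<le> ((1 - (norm x)\<^sup>2) / norm (x - e)) ^ m" using s by (intro power_mono) (auto simp: field_simps)
    moreover have "K \<le> norm (x - e) powr (- \<gamma>)" unfolding sK[symmetric] using up \<delta> \<gamma> by (intro powr_mono2') auto
    ultimately have "c * ((1 / 3) ^ m * K) \<le> c * (((1 - (norm x)\<^sup>2) / norm (x - e)) ^ m * norm (x - e) powr (- \<gamma>))"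
      using c K w s by (intro mult_left_mono mult_mono zero_le_power divide_nonneg_nonneg) auto
    then have "c * ((1 / 3) ^ m * K) \<le> u x" using low[OF xB] by linarith
    moreover have "c * ((1 / 3) ^ m * K) = 2 * c / 3 ^ m + \<bar>M\<bar>" using c by (simp add: K_def power_divide field_simps)
    moreover have "2 * c / 3 ^ m > 0" using c by simp
    ultimately show ?thesis using xB by linarith
  qed
  show "\<exists>S. open S \<and> S \<noteq> {} \<and> S \<subseteq> ball 0 1 \<and> (\<forall>x\<in>S. M < u x)"
    using S s by (intro exI[of _ ?S]) auto
qed

text \<open>Both singular solutions sit at the same point \<open>e\<close>. The source of
  \<open>u\<close> is asked to vanish to order mp because v^p does, that of \<open>v\<close> to
  order mq; with \<beta>p = \<alpha> + 2m and \<alpha>q = \<beta> + 2m the powers of |x - e| agree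
  as well.\<close>

lemma system_solution_unit_ball:
  fixes p q \<alpha> \<beta> :: real
  assumes m: "m \<ge> 1" and pq: "p > 0" "q > 0"
    and \<alpha>: "0 < \<alpha>" "\<alpha> < real DIM('a) - real m" "\<beta> * p = \<alpha> + 2 * real m"
    and \<beta>: "0 < \<beta>" "\<beta> < real DIM('a) - real m" "\<alpha> * q = \<beta> + 2 * real m"
  shows "\<exists>a b :: 'a::euclidean_space \<Rightarrow> real.
           set_borel_measurable lebesgue (ball 0 1) a \<and> set_borel_measurable lebesgue (ball 0 1) b \<and>
           (\<forall>x\<in>ball 0 1. 0 \<le> a x) \<and> (\<forall>x\<in>ball 0 1. 0 \<le> b x) \<and>
           bounded (a ` ball 0 1) \<and> bounded (b ` ball 0 1) \<and>
           (\<exists>u v. nonneg_system_solution m (ball 0 1) p q a b u v \<and>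
              u \<notin> L_infinity (ball 0 1) \<and> v \<notin> L_infinity (ball 0 1))"
proof -
  obtain e :: 'a where e: "norm e = 1" using vector_choose_size[of 1] by auto
  have M: "0 \<le> real m * p" "0 \<le> real m * q" using pq by auto
  obtain f u c C where c: "c > 0" and fu: "dirichlet_solution m (ball 0 1) f u"
    and f0: "\<And>x. x \<in> ball 0 1 \<Longrightarrow> 0 \<le> f x" and u0: "\<And>x. x \<in> ball 0 1 \<Longrightarrow> 0 \<le> u x"
    and ul: "\<And>x. x \<in> ball 0 1 \<Longrightarrow> c * (((1 - (norm x)\<^sup>2) / norm (x - e)) ^ m * norm (x - e) powr (- \<alpha>)) \<le> u x"
    and fup: "\<And>x. x \<in> ball 0 1 \<Longrightarrow> f x \<le> C * (((1 - (norm x)\<^sup>2) / norm (x - e)) powr (real m * p) * norm (x - e) powr (- (\<alpha> + 2 * real m)))"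
    by (rule ball_singular_solution[OF m \<alpha>(1,2) M(1) e]) (rule that)
  obtain h v d D where d: "d > 0" and hv: "dirichlet_solution m (ball 0 1) h v"
    and h0: "\<And>x. x \<in> ball 0 1 \<Longrightarrow> 0 \<le> h x" and v0: "\<And>x. x \<in> ball 0 1 \<Longrightarrow> 0 \<le> v x"
    and vl: "\<And>x. x \<in> ball 0 1 \<Longrightarrow> d * (((1 - (norm x)\<^sup>2) / norm (x - e)) ^ m * norm (x - e) powr (- \<beta>)) \<le> v x"
    and hup: "\<And>x. x \<in> ball 0 1 \<Longrightarrow> h x \<le> D * (((1 - (norm x)\<^sup>2) / norm (x - e)) powr (real m * q) * norm (x - e) powr (- (\<beta> + 2 * real m)))"
    by (rule ball_singular_solution[OF m \<beta>(1,2) M(2) e]) (rule that)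
  have cross: "s \<le> \<bar>C\<bar> / d powr p * r powr p"
    if x: "x \<in> ball 0 1" and p: "p > 0" and d: "d > 0" and ab: "\<beta> * p = \<alpha> + 2 * real m"
      and vl: "d * (((1 - (norm x)\<^sup>2) / norm (x - e)) ^ m * norm (x - e) powr (- \<beta>)) \<le> r"
      and fup: "s \<le> C * (((1 - (norm x)\<^sup>2) / norm (x - e)) powr (real m * p) * norm (x - e) powr (- (\<alpha> + 2 * real m)))"
    for x :: 'a and p d C \<alpha> \<beta> and r s :: real
  proof -
    define z where "z = (1 - (norm x)\<^sup>2) / norm (x - e)"
    define \<delta> where "\<delta> = norm (x - e)"
    have \<delta>: "\<delta> > 0" using x e by (auto simp: \<delta>_def)
    have z: "z > 0" using x \<delta> unfolding z_def \<delta>_def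
      by (intro divide_pos_pos) (auto simp: power_less_one_iff abs_square_less_1)
    have "(d * (z ^ m * \<delta> powr (- \<beta>))) powr p \<le> r powr p"
      using vl p d z unfolding z_def[symmetric] unfolding \<delta>_def[symmetric] by (intro powr_mono2) auto
    moreover have "(d * (z ^ m * \<delta> powr (- \<beta>))) powr p = d powr p * (z powr (real m * p) * \<delta> powr (- (\<alpha> + 2 * real m)))"
      unfolding powr_realpow[OF z, symmetric] powr_mult powr_powr ab[symmetric] by simp
    ultimately have "z powr (real m * p) * \<delta> powr (- (\<alpha> + 2 * real m)) \<le> r powr p / d powr p"
      using d by (simp add: field_simps)
    then have "\<bar>C\<bar> * (z powr (real m * p) * \<delta> powr (- (\<alpha> + 2 * real m))) \<le> \<bar>C\<bar> * (r powr p / d powr p)"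
      by (intro mult_left_mono) auto
    moreover have "C * (z powr (real m * p) * \<delta> powr (- (\<alpha> + 2 * real m))) \<le> \<bar>C\<bar> * (z powr (real m * p) * \<delta> powr (- (\<alpha> + 2 * real m)))"
      by (intro mult_right_mono) auto
    ultimately show ?thesis using fup unfolding z_def[symmetric] unfolding \<delta>_def[symmetric] by simp
  qed
  show ?thesis
  proof (rule system_of_solutions[OF fu hv])
    show "f x \<le> \<bar>C\<bar> / d powr p * v x powr p" if "x \<in> ball 0 1" for x
      by (rule cross[OF that pq(1) d \<alpha>(3) vl[OF that] fup[OF that]])
    show "h x \<le> \<bar>D\<bar> / c powr q * u x powr q" if "x \<in> ball 0 1" for x
      by (rule cross[OF that pq(2) c \<beta>(3) ul[OF that] hup[OF that]])
    show "u \<notin> L_infinity (ball 0 1)" by (rule profile_not_in_L_infinity[OF e c \<alpha>(1) ul])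
    show "v \<notin> L_infinity (ball 0 1)" by (rule profile_not_in_L_infinity[OF e d \<beta>(1) vl])
  qed (use f0 h0 u0 v0 in auto)
qed

section \<open>A supersolution on perturbed balls\<close>

text \<open>A large \<open>K\<close> is needed only on the compact set where R \<le> 0; there P has
  a positive minimum, while R is bounded below. Compactness then turns positivity into a uniform
  constant.\<close>

lemma compact_combination_pos:
  fixes P R :: "'a::topological_space \<Rightarrow> real"
  assumes S: "compact S" and P: "continuous_on S P" and R: "continuous_on S R"
    and nonneg: "\<And>z. z \<in> S \<Longrightarrow> 0 \<le> P z" and pos: "\<And>z. z \<in> S \<Longrightarrow> P z = 0 \<Longrightarrow> 0 < R z"
  obtains K c where "K > 0" "c > 0" "\<And>z. z \<in> S \<Longrightarrow> c \<le> K * P z + R z"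
proof (cases "S = {}")
  case True then show ?thesis using that[of 1 1] by auto
next
  case False
  obtain K where K: "K > 0" "\<And>z. z \<in> S \<Longrightarrow> 0 < K * P z + R z"
  proof (cases "\<exists>z\<in>S. R z \<le> 0")
    case F: False
    show ?thesis
    proof (rule that[of 1])
      fix z assume "z \<in> S" then show "0 < 1 * P z + R z" using F nonneg[of z] by force
    qed simp
  next
    case T: True
    define T where "T = {z \<in> S. R z \<le> 0}"
    have T_eq: "T = S \<inter> R -` {..0}" by (auto simp: T_def)
    have cT: "compact T"
    proof -
      obtain C where C: "closed C" "C \<inter> S = R -` {..0} \<inter> S"
        using R unfolding continuous_on_closed_invariant by (metis closed_atMost)
      then have "T = S \<inter> C" unfolding T_eq by blast
      then show ?thesis using compact_Int_closed[OF S C(1)] by simp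
    qed
    have "T \<noteq> {}" using T by (auto simp: T_def)
    then obtain z0 where z0: "z0 \<in> T" "\<And>z. z \<in> T \<Longrightarrow> P z0 \<le> P z"
      using continuous_attains_inf[OF cT _ continuous_on_subset[OF P]] by (auto simp: T_def)
    obtain z1 where z1: "z1 \<in> S" "\<And>z. z \<in> S \<Longrightarrow> R z1 \<le> R z" using continuous_attains_inf[OF S False R] by auto
    have p0: "P z0 > 0" using z0(1) nonneg[of z0] pos[of z0] by (force simp: T_def)
    have r1: "R z1 \<le> 0" using T z1(2) order_trans by blast
    show ?thesis
    \<comment> \<open>With \<open>R z1\<close> the minimum of R, this factor gives K * P \<ge> 1 -
      min R where R \<le> 0, hence K * P + R \<ge> 1 there.\<close>
    proof (rule that[of "(1 - R z1) / P z0"])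
      show "0 < (1 - R z1) / P z0" using p0 r1 by simp
      fix z assume z: "z \<in> S"
      show "0 < (1 - R z1) / P z0 * P z + R z"
      proof (cases "z \<in> T")
        case True
        have "1 - R z1 = (1 - R z1) / P z0 * P z0" using p0 by simp
        also have "\<dots> \<le> (1 - R z1) / P z0 * P z" using z0(2)[OF True] p0 r1 by (intro mult_left_mono) auto
        finally show ?thesis using z1(2)[OF z] by linarith
      next
        case False
        then have "R z > 0" using z by (auto simp: T_def)
        moreover have "(1 - R z1) / P z0 * P z \<ge> 0" using nonneg[OF z] p0 r1 by simp
        ultimately show ?thesis by linarith
      qed
    qed
  qed
  have "continuous_on S (\<lambda>z. K * P z + R z)" using P R by (intro continuous_intros)
  then obtain z where "z \<in> S" "\<And>z'. z' \<in> S \<Longrightarrow> K * P z + R z \<le> K * P z' + R z'"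
    using continuous_attains_inf[OF S False] by blast
  then show ?thesis using that[of K "K * P z + R z"] K by blast
qed

lemma frontier_boundary_distance:
  fixes x :: "'a::euclidean_space"
  assumes S: "open S" "bounded S" and x: "x \<in> S"
  obtains z where "z \<in> frontier S" "dist x z = bdist S x" "ball x (bdist S x) \<subseteq> S" "0 < bdist S x"
proof -
  have "S \<noteq> UNIV" using S(2) not_bounded_UNIV by auto
  then have ne: "frontier S \<noteq> {}" using x frontier_eq_empty[of S] by auto
  obtain z where z: "z \<in> frontier S" "infdist x (frontier S) = dist x z"
    using infdist_attains_inf[OF frontier_closed ne] by blast
  have sub: "ball x (bdist S x) \<subseteq> S"
  proof (rule ccontr)
    assume n: "\<not> ball x (bdist S x) \<subseteq> S"
    then have "ball x (bdist S x) \<noteq> {}" by (metis empty_subsetI)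
    then have "x \<in> ball x (bdist S x)" unfolding ball_eq_empty by simp
    then have "ball x (bdist S x) \<inter> frontier S \<noteq> {}"
      using connected_Int_frontier[of "ball x (bdist S x)" S] x n by blast
    then obtain w where "w \<in> frontier S" "dist x w < infdist x (frontier S)" by (auto simp: bdist_def)
    then show False using infdist_le[of w "frontier S" x] by simp
  qed
  have "z \<notin> S" using z(1) S(1) by (simp add: frontier_def interior_open)
  then have "0 < bdist S x" using z(2) x unfolding bdist_def by (metis zero_less_dist_iff)
  then show thesis using that z sub by (simp add: bdist_def)
qed

text \<open>The open ball about \<open>x\<close> with radius its boundary distance lies in
  \<open>S\<close>, so the segment to a nearest boundary point stays in \<open>S\<close> up to its
  endpoint. This takes the place of convexity in the mean value inequality.\<close>

lemma lipschitz_to_boundary: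
  fixes h :: "'a::euclidean_space \<Rightarrow> 'b::real_normed_vector"
  assumes S: "open S" "bounded S" and h: "Ck_closure 1 S h"
  obtains L where "L \<ge> 0" "\<And>x. x \<in> S \<Longrightarrow> \<exists>z\<in>frontier S. norm (h z - h x) \<le> L * bdist S x"
proof -
  have ch: "continuous_on (closure S) h" and su: "smooth_upto (Suc 0) S h" using h by (auto simp: Ck_closure_iff)
  have "\<exists>M\<ge>0. \<forall>x\<in>S. norm (dir_deriv b h x) \<le> M" if "b \<in> Basis" for b
    using smooth_upto_bounded[OF smooth_upto_dir_deriv[OF su that] S(2)] by metis
  then obtain M where M: "\<And>b. b \<in> Basis \<Longrightarrow> 0 \<le> M b" "\<And>b x. b \<in> Basis \<Longrightarrow> x \<in> S \<Longrightarrow> norm (dir_deriv b h x) \<le> M b"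
    by metis
  define L where "L = (\<Sum>b\<in>Basis. M b)"
  have dd: "norm (dir_deriv v h x) \<le> L * norm v" if x: "x \<in> S" for v x
  proof -
    have "norm (dir_deriv v h x) \<le> (\<Sum>b\<in>Basis. M b * norm v)"
      unfolding dir_deriv_expand[OF smooth_upto_differentiable[OF su x], of v]
    proof (rule sum_norm_le)
      fix b :: 'a assume b: "b \<in> Basis"
      show "norm ((v \<bullet> b) *\<^sub>R dir_deriv b h x) \<le> M b * norm v"
        using mult_mono[OF Basis_le_norm[OF b, of v] M(2)[OF b x]] by (simp add: mult.commute)
    qed
    then show ?thesis by (simp add: L_def sum_distrib_right)
  qed
  show thesis
  proof (rule that)
    show "L \<ge> 0" unfolding L_def by (intro sum_nonneg M(1))
    fix x assume x: "x \<in> S"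
    obtain z where z: "z \<in> frontier S" "dist x z = bdist S x" "ball x (bdist S x) \<subseteq> S" "0 < bdist S x"
      by (rule frontier_boundary_distance[OF S x])
    have seg: "x + s *\<^sub>R (z - x) \<in> S" if "0 \<le> s" "s < 1" for s
    proof -
      have "dist x (x + s *\<^sub>R (z - x)) = s * bdist S x" using that z(2) by (simp add: dist_norm norm_minus_commute)
      also have "\<dots> < bdist S x" using that z(4) by simp
      finally show ?thesis using z(3) by auto
    qed
    have "norm (h (x + 1 *\<^sub>R (z - x)) - h (x + 0 *\<^sub>R (z - x))) \<le> L * norm (z - x) * 1 - L * norm (z - x) * 0"
    proof (rule differentiable_bound_general[where f="\<lambda>s. h (x + s *\<^sub>R (z - x))" and \<phi>="\<lambda>s. L * norm (z - x) * s" and f'="\<lambda>s. dir_deriv (z - x) h (x + s *\<^sub>R (z - x))" and \<phi>'="\<lambda>s. L * norm (z - x)"])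
      show "continuous_on {0..1} (\<lambda>s. h (x + s *\<^sub>R (z - x)))"
      proof (rule continuous_on_compose2[OF ch])
        show "(\<lambda>s. x + s *\<^sub>R (z - x)) ` {0..1} \<subseteq> closure S"
        proof (safe, goal_cases)
          case (1 _ s)
          show ?case
          proof (cases "s = 1")
            case True then show ?thesis using z(1) by (simp add: frontier_def)
          next
            case False then show ?thesis using seg[of s] 1 closure_subset[of S] by auto
          qed
        qed
      qed (intro continuous_intros)
      show "((\<lambda>s. h (x + s *\<^sub>R (z - x))) has_vector_derivative dir_deriv (z - x) h (x + s *\<^sub>R (z - x))) (at s)"
        if "0 < s" "s < 1" for s
        by (rule dir_deriv_line) (use smooth_upto_differentiable[OF su seg[of s]] that in auto)
      show "((\<lambda>s. L * norm (z - x) * s) has_vector_derivative L * norm (z - x)) (at s)" for s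
        by (auto intro!: derivative_eq_intros simp: has_real_derivative_iff_has_vector_derivative[symmetric])
      show "norm (dir_deriv (z - x) h (x + s *\<^sub>R (z - x))) \<le> L * norm (z - x)" if "0 < s" "s < 1" for s
        by (rule dd[OF seg]) (use that in auto)
    qed (auto intro!: continuous_intros)
    then have "norm (h z - h x) \<le> L * bdist S x" using z(2) by (simp add: dist_norm norm_minus_commute)
    then show "\<exists>z\<in>frontier S. norm (h z - h x) \<le> L * bdist S x" using z(1) by blast
  qed
qed

text \<open>For m = 1 the only condition is j = 0, and the zeroth normal derivative is the limit
  from inside, which by continuity is the boundary value.\<close>

lemma dirichlet_test_1I:
  fixes \<phi> :: "'a::euclidean_space \<Rightarrow> real"
  assumes S: "open S" and \<phi>: "Ck_closure 2 S \<phi>" and 0: "\<And>x. x \<in> frontier S \<Longrightarrow> \<phi> x = 0"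
  shows "\<phi> \<in> dirichlet_test 1 S"
proof -
  have "normal_deriv S 0 \<phi> x = 0" if x: "x \<in> frontier S" for x
  proof -
    have xc: "x \<in> closure S" "x \<notin> S" using x S by (auto simp: frontier_def interior_open)
    then have lp: "x islimpt S" by (auto simp: closure_def)
    have "(\<phi> \<longlongrightarrow> \<phi> x) (at x within closure S)"
      using \<phi> xc(1) by (auto simp: Ck_closure_iff continuous_on_def)
    then have "(\<phi> \<longlongrightarrow> \<phi> x) (at x within S)" by (rule tendsto_within_subset) (rule closure_subset)
    then have "Lim (at x within S) \<phi> = \<phi> x" using lp by (intro tendsto_Lim) (auto simp: trivial_limit_within)
    then show ?thesis using 0[OF x] by (simp add: normal_deriv_def)
  qed
  then show ?thesis using \<phi> by (auto simp: dirichlet_test_def)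
qed

text \<open>With \<open>h\<close> the inverse diffeomorphism, \<open>1 - exp (K (|h|\<^sup>2 - 1))\<close> is strictly superharmonic for
  large \<open>K\<close>: where the gradient of \<open>|h|\<^sup>2\<close> vanishes, \<open>h\<close> itself vanishes, and there the
  Laplacian of \<open>|h|\<^sup>2\<close> is positive.\<close>

lemma perturbed_ball_supersolution:
  fixes \<Omega> :: "'a::euclidean_space set"
  assumes "perturbed_ball m \<epsilon> \<Omega>"
  obtains \<phi> c C where "open \<Omega>" "bounded \<Omega>" "\<Omega> \<noteq> {}" "\<phi> \<in> dirichlet_test 1 \<Omega>" "c > 0"
    "\<And>x. x \<in> \<Omega> \<Longrightarrow> c \<le> polylaplacian 1 \<phi> x" "\<And>x. x \<in> \<Omega> \<Longrightarrow> 0 \<le> \<phi> x"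
    "\<And>x. x \<in> \<Omega> \<Longrightarrow> \<phi> x \<le> C * bdist \<Omega> x"
proof -
  let ?B = "ball (0::'a) 1"
  obtain g h where \<Omega>: "\<Omega> = g ` ?B" and hom: "homeomorphism (closure ?B) (closure \<Omega>) g h"
    and g: "\<And>k. Ck_closure k ?B g" and h: "\<And>k. Ck_closure k \<Omega> h"
    using assms unfolding perturbed_ball_def by blast
  have hom': "homeomorphism (cball 0 1) (closure \<Omega>) g h" using hom by (simp add: closure_unit_ball)
  have hg: "\<And>y. y \<in> cball 0 1 \<Longrightarrow> h (g y) = y" and gh: "\<And>z. z \<in> closure \<Omega> \<Longrightarrow> g (h z) = z"
    and himg: "h ` closure \<Omega> = cball 0 1" and gimg: "g ` cball 0 1 = closure \<Omega>"
    and cg: "continuous_on (cball 0 1) g" and ch: "continuous_on (closure \<Omega>) h"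
    using hom' by (auto simp: homeomorphism_def)
  have inj: "inj_on g (cball 0 1)" using hg by (metis inj_onI)
  have "open (g ` ?B)"
    by (rule invariance_of_domain) (use cg inj in \<open>auto intro: continuous_on_subset inj_on_subset\<close>)
  then have op: "open \<Omega>" using \<Omega> by simp
  have cpt: "compact (closure \<Omega>)"
    unfolding gimg[symmetric] by (intro compact_continuous_image cg compact_cball)
  have bd: "bounded \<Omega>" by (rule bounded_subset[OF compact_imp_bounded[OF cpt] closure_subset])
  have ne: "\<Omega> \<noteq> {}" using \<Omega> by simp
  have hin: "h x \<in> ?B" if "x \<in> \<Omega>" for x using that hg unfolding \<Omega> by force
  have hcl: "h z \<in> cball 0 1" if "z \<in> closure \<Omega>" for z using himg that by blast
  have hfr: "norm (h z) = 1" if "z \<in> frontier \<Omega>" for z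
  proof -
    have z: "z \<in> closure \<Omega>" "z \<notin> \<Omega>" using that op by (auto simp: frontier_def interior_open)
    have "h z \<notin> ?B"
    proof
      assume "h z \<in> ?B"
      then have "g (h z) \<in> \<Omega>" unfolding \<Omega> by blast
      then show False using gh[OF z(1)] z(2) by simp
    qed
    then show ?thesis using hcl[OF z(1)] by simp
  qed
  have suh: "smooth_upto k \<Omega> h" for k using h by (simp add: Ck_closure_iff)
  have sug: "smooth_upto k ?B g" for k using g by (simp add: Ck_closure_iff)
  have dh: "smooth_upto k \<Omega> (dir_deriv b h)" if "b \<in> Basis" for k b using suh[of "Suc k"] that by simp
  have ddh: "smooth_upto k \<Omega> (dir_deriv b (dir_deriv b h))" if "b \<in> Basis" for k b using dh[OF that, of "Suc k"] that by simp
  \<comment> \<open>\<open>H1\<close>, \<open>H2\<close> and later \<open>G1\<close> are continuous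
    extensions of the derivatives to the closure. They are needed because the positivity argument
    runs over a compact set that includes the boundary.\<close>
  define H1 where "H1 b = (SOME H. continuous_on (closure \<Omega>) H \<and> (\<forall>x\<in>\<Omega>. H x = dir_deriv b h x))" for b
  have H1': "continuous_on (closure \<Omega>) (H1 b) \<and> (\<forall>x\<in>\<Omega>. H1 b x = dir_deriv b h x)" if "b \<in> Basis" for b
    using someI_ex[OF smooth_upto_extends[OF dh[OF that, of 0]]] unfolding H1_def .
  have H1: "continuous_on (closure \<Omega>) (H1 b)" "x \<in> \<Omega> \<Longrightarrow> H1 b x = dir_deriv b h x" if "b \<in> Basis" for b x
    using H1'[OF that] by auto
  define H2 where "H2 b = (SOME H. continuous_on (closure \<Omega>) H \<and> (\<forall>x\<in>\<Omega>. H x = dir_deriv b (dir_deriv b h) x))" for b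
  have H2': "continuous_on (closure \<Omega>) (H2 b) \<and> (\<forall>x\<in>\<Omega>. H2 b x = dir_deriv b (dir_deriv b h) x)" if "b \<in> Basis" for b
    using someI_ex[OF smooth_upto_extends[OF ddh[OF that, of 0]]] unfolding H2_def .
  have H2: "continuous_on (closure \<Omega>) (H2 b)" "x \<in> \<Omega> \<Longrightarrow> H2 b x = dir_deriv b (dir_deriv b h) x" if "b \<in> Basis" for b x
    using H2'[OF that] by auto
  define G1 where "G1 c = (SOME H. continuous_on (cball 0 1) H \<and> (\<forall>x\<in>?B. H x = dir_deriv c g x))" for c
  have G1': "continuous_on (cball 0 1) (G1 c) \<and> (\<forall>x\<in>?B. G1 c x = dir_deriv c g x)" if "c \<in> Basis" for c
    using someI_ex[OF smooth_upto_extends[OF smooth_upto_dir_deriv[OF sug that, of 0], unfolded closure_unit_ball]]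
    unfolding G1_def .
  have G1: "continuous_on (cball 0 1) (G1 c)" "x \<in> ?B \<Longrightarrow> G1 c x = dir_deriv c g x" if "c \<in> Basis" for c x
    using G1'[OF that] by auto
  \<comment> \<open>The chain rule for h(g(y)) = y says that Dh sends Dg(c) to c. By continuity this
    persists on the closure, so Dh is onto even at boundary points.\<close>
  have inv: "(\<Sum>b\<in>Basis. (G1 c (h z) \<bullet> b) *\<^sub>R H1 b z) = c" if c: "c \<in> Basis" and z: "z \<in> closure \<Omega>" for c z
  proof (rule continuous_constant_on_closure[OF _ _ z])
    show "continuous_on (closure \<Omega>) (\<lambda>z. \<Sum>b\<in>Basis. (G1 c (h z) \<bullet> b) *\<^sub>R H1 b z)"
      by (intro continuous_intros H1 continuous_on_compose2[OF G1(1)[OF c] ch]) (use himg in auto)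
    fix x assume x: "x \<in> \<Omega>"
    have hx: "h x \<in> ?B" "g (h x) = x" using hin[OF x] gh x closure_subset by auto
    have dg: "(g has_derivative (\<lambda>v. dir_deriv v g (h x))) (at (h x))"
      using smooth_upto_differentiable[OF sug hx(1)] by (rule dir_deriv_works)
    have dh': "(h has_derivative (\<lambda>v. dir_deriv v h x)) (at (g (h x)))"
      unfolding hx(2) using smooth_upto_differentiable[OF suh x] by (rule dir_deriv_works)
    have "((\<lambda>y. h (g y)) has_derivative (\<lambda>v. dir_deriv (dir_deriv v g (h x)) h x)) (at (h x))"
      using has_derivative_compose[OF dg dh'] .
    moreover have "((\<lambda>y. h (g y)) has_derivative (\<lambda>v. v)) (at (h x))"
      by (rule has_derivative_transform_within_open[OF has_derivative_ident open_ball hx(1)]) (use hg in auto)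
    ultimately have "dir_deriv (dir_deriv c g (h x)) h x = c" using has_derivative_unique by metis
    then show "(\<Sum>b\<in>Basis. (G1 c (h x) \<bullet> b) *\<^sub>R H1 b x) = c"
      using dir_deriv_expand[OF smooth_upto_differentiable[OF suh x], of "dir_deriv c g (h x)"] c hx x
      by (simp add: H1(2) G1(2))
  qed
  define P where "P z = (\<Sum>b\<in>Basis. (2 * (h z \<bullet> H1 b z))\<^sup>2)" for z
  define R where "R z = (\<Sum>b\<in>Basis. 2 * (H1 b z \<bullet> H1 b z + h z \<bullet> H2 b z))" for z
  have PR: "R z > 0" if z: "z \<in> closure \<Omega>" and P0: "P z = 0" for z
  proof -
    have "\<forall>b\<in>Basis. (2 * (h z \<bullet> H1 b z))\<^sup>2 = 0"
      using P0 unfolding P_def by (subst (asm) sum_nonneg_eq_0_iff) auto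
    then have orth: "h z \<bullet> H1 b z = 0" if "b \<in> Basis" for b using that by simp
    have hzc: "h z \<bullet> c = 0" if c: "c \<in> Basis" for c
    proof -
      have "h z \<bullet> c = h z \<bullet> (\<Sum>b\<in>Basis. (G1 c (h z) \<bullet> b) *\<^sub>R H1 b z)" using inv[OF c z] by simp
      then show ?thesis using orth by (simp add: inner_sum_right)
    qed
    have hz: "h z = 0" by (rule euclidean_eqI) (simp add: hzc)
    obtain c :: 'a where c: "c \<in> Basis" using nonempty_Basis by blast
    have "\<exists>b\<in>Basis. H1 b z \<noteq> 0"
    proof (rule ccontr)
      assume "\<not> (\<exists>b\<in>Basis. H1 b z \<noteq> 0)"
      then have "c = 0" using inv[OF c z] by simp
      then show False using c nonzero_Basis by blast
    qed
    then obtain b where b: "b \<in> Basis" "H1 b z \<noteq> 0" by blast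
    have "0 < (\<Sum>b\<in>Basis. 2 * (H1 b z \<bullet> H1 b z))"
      by (rule sum_pos2[OF finite_Basis b(1)]) (use b in auto)
    then show ?thesis using hz by (simp add: R_def)
  qed
  have contP: "continuous_on (closure \<Omega>) P" unfolding P_def by (intro continuous_intros H1 ch)
  have contR: "continuous_on (closure \<Omega>) R" unfolding R_def by (intro continuous_intros H1 H2 ch)
  have P0: "0 \<le> P z" for z unfolding P_def by (intro sum_nonneg) auto
  obtain K c where K: "K > 0" "c > 0" "\<And>z. z \<in> closure \<Omega> \<Longrightarrow> c \<le> K * P z + R z"
    by (rule compact_combination_pos[OF cpt contP contR P0 PR]) (auto intro: that)
  define \<rho> where "\<rho> x = h x \<bullet> h x" for x
  have su\<rho>: "smooth_upto k \<Omega> \<rho>" for k unfolding \<rho>_def by (intro smooth_upto_inner op suh)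
  define E where "E x = exp (K * (\<rho> x + - 1))" for x
  have suE: "smooth_upto k \<Omega> E" for k unfolding E_def
    by (intro smooth_upto_exp smooth_upto_mult smooth_upto_add op smooth_upto_const su\<rho>)
  define \<phi> where "\<phi> x = 1 + - E x" for x
  have su\<phi>: "smooth_upto k \<Omega> \<phi>" for k unfolding \<phi>_def by (intro smooth_upto_add smooth_upto_const smooth_upto_minus op suE)
  have c\<phi>: "continuous_on (closure \<Omega>) \<phi>" unfolding \<phi>_def E_def \<rho>_def by (intro continuous_intros ch)
  have d\<rho>: "dir_deriv b \<rho> x = 2 * (h x \<bullet> dir_deriv b h x)" if "x \<in> \<Omega>" for b x
    unfolding \<rho>_def using dir_deriv_inner[OF smooth_upto_differentiable[OF suh that] smooth_upto_differentiable[OF suh that]]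
    by (simp add: inner_commute)
  have dd\<rho>: "dir_deriv b (dir_deriv b \<rho>) x = 2 * (dir_deriv b h x \<bullet> dir_deriv b h x + h x \<bullet> dir_deriv b (dir_deriv b h) x)"
    if x: "x \<in> \<Omega>" and b: "b \<in> Basis" for b x
  proof -
    have "dir_deriv b (dir_deriv b \<rho>) x = dir_deriv b (\<lambda>x. (2 *\<^sub>R h x) \<bullet> dir_deriv b h x) x"
      by (rule dir_deriv_cong_open[OF op x]) (simp add: d\<rho>)
    also have "\<dots> = (2 *\<^sub>R h x) \<bullet> dir_deriv b (dir_deriv b h) x + (2 *\<^sub>R dir_deriv b h x) \<bullet> dir_deriv b h x"
      using smooth_upto_differentiable[OF suh x] smooth_upto_differentiable[OF dh[OF b] x]
      by (subst dir_deriv_inner) (auto simp: dir_deriv_scaleR intro: differentiable_scaleR)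
    finally show ?thesis by (simp add: algebra_simps)
  qed
  have dE: "dir_deriv b E x = K * dir_deriv b \<rho> x * E x" if x: "x \<in> \<Omega>" for b x
    by (rule dir_deriv_eq[of E "\<lambda>v. K * dir_deriv v \<rho> x * E x"])
       (unfold E_def, auto intro!: derivative_eq_intros dir_deriv_works smooth_upto_differentiable[OF su\<rho> x])
  have d\<phi>: "dir_deriv b \<phi> x = (- K) *\<^sub>R (dir_deriv b \<rho> x * E x)" if x: "x \<in> \<Omega>" for b x
  proof -
    have "(\<phi> has_derivative (\<lambda>v. - dir_deriv v E x)) (at x)"
      unfolding \<phi>_def by (auto intro!: derivative_eq_intros dir_deriv_works smooth_upto_differentiable[OF suE x])
    then show ?thesis using dir_deriv_eq dE[OF x] by fastforce
  qed
  have dd\<phi>: "dir_deriv b (dir_deriv b \<phi>) x = - K * E x * (K * (dir_deriv b \<rho> x)\<^sup>2 + dir_deriv b (dir_deriv b \<rho>) x)"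
    if x: "x \<in> \<Omega>" and b: "b \<in> Basis" for b x
  proof -
    have di: "dir_deriv b \<rho> differentiable (at x)" "E differentiable (at x)"
      using smooth_upto_differentiable[OF smooth_upto_dir_deriv[OF su\<rho> b] x] smooth_upto_differentiable[OF suE x] by auto
    have "dir_deriv b (dir_deriv b \<phi>) x = dir_deriv b (\<lambda>x. (- K) *\<^sub>R (dir_deriv b \<rho> x * E x)) x"
      by (rule dir_deriv_cong_open[OF op x]) (rule d\<phi>)
    also have "\<dots> = - K * (dir_deriv b \<rho> x * dir_deriv b E x + dir_deriv b (dir_deriv b \<rho>) x * E x)"
      using dir_deriv_scaleR[OF differentiable_mult[OF di], of b "- K"] dir_deriv_mult[OF di, of b] by simp
    finally show ?thesis unfolding dE[OF x] by (simp add: algebra_simps power2_eq_square)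
  qed
  have lap: "polylaplacian 1 \<phi> x = K * E x * (K * P x + R x)" if x: "x \<in> \<Omega>" for x
  proof -
    have "P x = (\<Sum>b\<in>Basis. (dir_deriv b \<rho> x)\<^sup>2)" unfolding P_def using x by (intro sum.cong) (auto simp: d\<rho> H1)
    moreover have "R x = (\<Sum>b\<in>Basis. dir_deriv b (dir_deriv b \<rho>) x)" unfolding R_def using x by (intro sum.cong) (auto simp: dd\<rho> H1 H2)
    moreover have "laplacian \<phi> x = (\<Sum>b\<in>Basis. - K * E x * (K * (dir_deriv b \<rho> x)\<^sup>2 + dir_deriv b (dir_deriv b \<rho>) x))"
      unfolding laplacian_def by (intro sum.cong refl dd\<phi> x)
    ultimately have "laplacian \<phi> x = - K * E x * (K * P x + R x)"
      by (simp only: sum_distrib_left[symmetric] sum.distrib)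
    then show ?thesis using polylaplacian_Suc[of 0 \<phi>] by simp
  qed
  have \<rho>01: "0 \<le> \<rho> x" "\<rho> x \<le> 1" "1 - \<rho> x \<le> 2 * (1 - norm (h x))" if "x \<in> \<Omega>" for x
  proof -
    have n: "norm (h x) < 1" using hin[OF that] by simp
    have r: "\<rho> x = (norm (h x))\<^sup>2" by (simp add: \<rho>_def power2_norm_eq_inner)
    show "0 \<le> \<rho> x" "\<rho> x \<le> 1" unfolding r using n by (auto simp: power_le_one)
    have "1 - \<rho> x = (1 - norm (h x)) * (1 + norm (h x))" unfolding r by (simp add: power2_eq_square algebra_simps)
    also have "\<dots> \<le> (1 - norm (h x)) * 2" using n by (intro mult_left_mono) auto
    finally show "1 - \<rho> x \<le> 2 * (1 - norm (h x))" by simp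
  qed
  obtain L where L: "L \<ge> 0" "\<And>x. x \<in> \<Omega> \<Longrightarrow> \<exists>z\<in>frontier \<Omega>. norm (h z - h x) \<le> L * bdist \<Omega> x"
    by (rule lipschitz_to_boundary[OF op bd h]) (rule that)
  show thesis
  proof (rule that[OF op bd ne])
    show "\<phi> \<in> dirichlet_test 1 \<Omega>"
    proof (rule dirichlet_test_1I[OF op])
      show "Ck_closure 2 \<Omega> \<phi>" using su\<phi>[of 2] c\<phi> by (simp add: Ck_closure_iff)
      show "\<phi> x = 0" if "x \<in> frontier \<Omega>" for x
        using hfr[OF that] by (simp add: \<phi>_def E_def \<rho>_def norm_eq_1)
    qed
    \<comment> \<open>As \<rho> \<ge> 0, the factor \<open>E\<close> is at least exp(-K); the
      remaining factor of the formula for the Laplacian is at least \<open>c\<close>.\<close>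
    show "0 < K * exp (- K) * c" using K by simp
    show "K * exp (- K) * c \<le> polylaplacian 1 \<phi> x" if x: "x \<in> \<Omega>" for x
    proof -
      have "K * - 1 \<le> K * (\<rho> x + - 1)" using \<rho>01[OF x] K by (intro mult_left_mono) auto
      then have "exp (- K) \<le> E x" by (simp add: E_def)
      then show ?thesis unfolding lap[OF x] using K x closure_subset[of \<Omega>]
        by (intro mult_mono mult_nonneg_nonneg) (auto simp: E_def)
    qed
    show "0 \<le> \<phi> x" if x: "x \<in> \<Omega>" for x
      using \<rho>01[OF x] K by (simp add: \<phi>_def E_def mult_nonneg_nonpos)
    show "\<phi> x \<le> (2 * K * L) * bdist \<Omega> x" if x: "x \<in> \<Omega>" for x
    proof -
      have "\<phi> x \<le> K * (1 - \<rho> x)" using exp_ge_add_one_self[of "K * (\<rho> x + - 1)"] by (simp add: \<phi>_def E_def algebra_simps)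
      also have "\<dots> \<le> K * (2 * (1 - norm (h x)))" using \<rho>01[OF x] K by (intro mult_left_mono) auto
      also have "\<dots> \<le> K * (2 * (L * bdist \<Omega> x))"
      proof -
        obtain z where "z \<in> frontier \<Omega>" "norm (h z - h x) \<le> L * bdist \<Omega> x" using L(2)[OF x] by blast
        then have "1 - norm (h x) \<le> L * bdist \<Omega> x" using hfr norm_triangle_ineq2[of "h z" "h x"] by force
        then show ?thesis using K by (intro mult_left_mono) auto
      qed
      finally show ?thesis by (simp add: mult_ac)
    qed
  qed
qed

section \<open>Green potentials on perturbed discs\<close>

lemma disjoint_indicator_series:
  fixes a :: "nat \<Rightarrow> real"
  assumes disj: "\<And>i j. i \<noteq> j \<Longrightarrow> B i \<inter> B j = {}"
  shows "summable (\<lambda>k. a k * indicator (B k) x)"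
    and "x \<in> B k \<Longrightarrow> (\<Sum>k. a k * indicator (B k) x) = a k"
    and "x \<notin> (\<Union>k. B k) \<Longrightarrow> (\<Sum>k. a k * indicator (B k) x) = 0"
proof -
  have one: "a j * indicator (B j) x = 0" if "x \<in> B i" "j \<notin> {i}" for i j
    using disj[of i j] that by (auto split: split_indicator)
  show "summable (\<lambda>k. a k * indicator (B k) x)"
  proof (cases "x \<in> (\<Union>k. B k)")
    case True
    then obtain i where "x \<in> B i" by blast
    then show ?thesis by (intro summable_finite[of "{i}"] one) auto
  next
    case False then show ?thesis by (intro summable_finite[of "{}"]) auto
  qed
  show "(\<Sum>k. a k * indicator (B k) x) = a k" if "x \<in> B k"
    by (subst suminf_finite[of "{k}"]) (use one[OF that] that in auto)
  show "(\<Sum>k. a k * indicator (B k) x) = 0" if "x \<notin> (\<Union>k. B k)"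
    by (subst suminf_finite[of "{}"]) (use that in auto)
qed

text \<open>On B_k the source is t_k^-(\<gamma> + 2), G is at least \<open>K\<close>, and the area
  is of order t_k^2, which yields the lower bound t_k^-\<gamma>. Integrability comes from testing G
  against \<psi>: the integral of G(x,y) over x is at most \<psi>(y)/c0, hence at most a multiple of
  the boundary distance of y.\<close>

lemma green_singular_solution:
  fixes \<Omega> :: "'a::euclidean_space set" and z :: "nat \<Rightarrow> 'a" and \<rho> :: real
  defines "t \<equiv> \<lambda>k::nat. (1/2::real) ^ k"
  defines "B \<equiv> \<lambda>k. ball (z k) (\<rho> * t k)"
  assumes dim: "DIM('a) = 2" and \<Omega>: "open \<Omega>" "bounded \<Omega>"
    and green: "is_green_function 1 \<Omega> G" and G0: "\<And>x y. x \<in> \<Omega> \<Longrightarrow> y \<in> \<Omega> \<Longrightarrow> x \<noteq> y \<Longrightarrow> 0 < G x y"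
    and \<psi>: "\<psi> \<in> dirichlet_test 1 \<Omega>" "c0 > 0" "\<And>x. x \<in> \<Omega> \<Longrightarrow> c0 \<le> polylaplacian 1 \<psi> x"
      "\<And>x. x \<in> \<Omega> \<Longrightarrow> 0 \<le> \<psi> x" "\<And>x. x \<in> \<Omega> \<Longrightarrow> \<psi> x \<le> C0 * bdist \<Omega> x"
    and \<rho>: "\<rho> > 0" and Bsub: "\<And>k. B k \<subseteq> \<Omega>" and disj: "\<And>i j. i \<noteq> j \<Longrightarrow> B i \<inter> B j = {}"
    and dB: "\<And>k x. x \<in> B k \<Longrightarrow> bdist \<Omega> x \<le> C1 * t k"
    and K: "K > 0" "\<And>k x y. x \<in> B k \<Longrightarrow> y \<in> B k \<Longrightarrow> x \<noteq> y \<Longrightarrow> K \<le> G x y"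
    and \<gamma>: "\<gamma> < 1"
  obtains f u c where "c > 0" "dirichlet_solution 1 \<Omega> f u" "\<And>x. 0 \<le> f x" "\<And>x. 0 \<le> u x"
    "\<And>k x. x \<in> B k \<Longrightarrow> f x = t k powr (- (\<gamma> + 2))" "\<And>x. x \<notin> (\<Union>k. B k) \<Longrightarrow> f x = 0"
    "\<And>k x. x \<in> B k \<Longrightarrow> c * t k powr (- \<gamma>) \<le> u x"
proof -
  have t: "t k > 0" for k by (simp add: t_def)
  have Bo: "open (B k)" for k by (simp add: B_def)
  have Bm: "B k \<in> sets borel" for k using Bo by simp
  have Bv: "measure lborel (B k) = unit_ball_vol 2 * (\<rho> * t k)\<^sup>2" for k
    unfolding B_def using content_ball[of "\<rho> * t k" "z k"] dim \<rho> t[of k] by simp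
  have Bi: "integrable lborel (\<lambda>x. c * indicator (B k) x :: real)" for c k
    unfolding B_def by (intro integrable_mult_right integrable_real_indicator emeasure_bounded_finite) auto
  have DS1: "summable (\<lambda>k. a k * indicator (B k) x)" for a :: "nat \<Rightarrow> real" and x
    by (rule disjoint_indicator_series(1)[OF disj])
  have DS2: "(\<Sum>k. a k * indicator (B k) x) = a k" if "x \<in> B k" for a :: "nat \<Rightarrow> real" and x k
    by (rule disjoint_indicator_series(2)[OF disj]) (use that in auto)
  have DS3: "(\<Sum>k. a k * indicator (B k) x) = 0" if "x \<notin> (\<Union>k. B k)" for a :: "nat \<Rightarrow> real" and x
    by (rule disjoint_indicator_series(3)[OF disj]) (use that in auto)
  have sm: "(\<lambda>x. \<Sum>k. a k * indicator (B k) x :: real) \<in> borel_measurable borel" for a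
    using Bm by (intro borel_measurable_suminf borel_measurable_times borel_measurable_indicator borel_measurable_const)
  have nn: "0 \<le> (\<Sum>k. a k * indicator (B k) x :: real)" if "\<And>k. 0 \<le> a k" for a x
    by (intro suminf_nonneg DS1) (use that in auto)
  define s where "s k = t k powr (- (\<gamma> + 2))" for k
  define f where "f x = (\<Sum>k. s k * indicator (B k) x)" for x
  have f0: "0 \<le> f x" for x unfolding f_def by (intro nn) (simp add: s_def)
  have fB: "f x = s k" if "x \<in> B k" for x k unfolding f_def by (rule DS2[OF that]) 
  have fo: "f x = 0" if "x \<notin> (\<Union>k. B k)" for x unfolding f_def by (rule DS3[OF that])
  have fout: "f x = 0" if "x \<notin> \<Omega>" for x using fo[of x] that Bsub by blast
  have fm: "f \<in> borel_measurable borel" unfolding f_def by (rule sm)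
  have bm: "bdist \<Omega> \<in> borel_measurable borel"
    unfolding bdist_def[abs_def] by (intro borel_measurable_continuous_onI continuous_on_infdist continuous_on_id)
  have b0: "0 \<le> bdist \<Omega> x" for x by (simp add: bdist_def infdist_nonneg)
  have fd: "integrable lborel (\<lambda>x. f x * bdist \<Omega> x)"
  proof -
    \<comment> \<open>A bound for the source times the boundary distance on B_k. Multiplied by the
      area it is a constant times t_k^(1 - \<gamma>), which is summable because \<gamma> <
      1.\<close>
    define r where "r k = \<bar>C1\<bar> * t k powr (- (\<gamma> + 1))" for k
    have r0: "0 \<le> r k" for k by (simp add: r_def)
    have ni: "(\<integral>x. norm (r k * indicator (B k) x) \<partial>lborel) = \<bar>C1\<bar> * unit_ball_vol 2 * \<rho>\<^sup>2 * t k powr (1 - \<gamma>)" for k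
    proof -
      have "(\<integral>x. norm (r k * indicator (B k) x) \<partial>lborel) = r k * measure lborel (B k)"
        using r0[of k] by simp
      also have "\<dots> = \<bar>C1\<bar> * unit_ball_vol 2 * \<rho>\<^sup>2 * (t k powr (- (\<gamma> + 1)) * t k powr 2)"
        unfolding Bv r_def using t[of k] by (simp add: powr_numeral power_mult_distrib)
      also have "t k powr (- (\<gamma> + 1)) * t k powr 2 = t k powr (1 - \<gamma>)"
        unfolding powr_add[symmetric] by (rule arg_cong[where f="(powr) (t k)"]) simp
      finally show ?thesis .
    qed
    have "integrable lborel (\<lambda>x. \<Sum>k. r k * indicator (B k) x)"
    proof (rule integrable_suminf[OF Bi AE_I2])
      show "summable (\<lambda>k. norm (r k * indicator (B k) x))" for x
        using DS1[of r x] r0 by (simp add: abs_mult)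
      show "summable (\<lambda>k. \<integral>x. norm (r k * indicator (B k) x) \<partial>lborel)"
        unfolding ni t_def by (intro summable_mult summable_half_powr) (use \<gamma> in simp)
    qed
    then show ?thesis
    proof (rule Bochner_Integration.integrable_bound)
      show "AE x in lborel. norm (f x * bdist \<Omega> x) \<le> norm (\<Sum>k. r k * indicator (B k) x)"
      proof (rule AE_I2)
        fix x
        show "norm (f x * bdist \<Omega> x) \<le> norm (\<Sum>k. r k * indicator (B k) x)"
        proof (cases "x \<in> (\<Union>k. B k)")
          case True
          then obtain k where k: "x \<in> B k" by blast
          have "bdist \<Omega> x \<le> \<bar>C1\<bar> * t k" using dB[OF k] t[of k] by (meson abs_ge_self mult_right_mono order_trans less_imp_le)
          then have "s k * bdist \<Omega> x \<le> s k * (\<bar>C1\<bar> * t k)" by (intro mult_left_mono) (auto simp: s_def)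
          also have "\<dots> = \<bar>C1\<bar> * (s k * t k powr 1)" using t[of k] by simp
          also have "s k * t k powr 1 = t k powr (- (\<gamma> + 1))"
            unfolding s_def powr_add[symmetric] by (rule arg_cong[where f="(powr) (t k)"]) simp
          finally show ?thesis using fB[OF k] DS2[OF k, of r] b0[of x] r0[of k] by (simp add: s_def r_def abs_mult)
        next
          case False then show ?thesis using fo[OF False] by simp
        qed
      qed
    qed (use fm bm in auto)
  qed
  define W where "W = (\<Omega> \<times> \<Omega>) \<inter> {p :: 'a \<times> 'a. fst p \<noteq> snd p}"
  have Wo: "open W" unfolding W_def
    by (intro open_Int open_Times \<Omega> open_Collect_neq continuous_intros)
  \<comment> \<open>G cut off to zero on the diagonal and outside \<Omega>. Being continuous on the
    open set \<open>W\<close>, it becomes jointly Borel measurable, as Fubini's theorem requires;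
    the diagonal does not affect the integrals.\<close>
  define H where "H y x = indicator W (x, y) * G x y" for y x
  have cG: "continuous_on W (\<lambda>(x, y). G x y)"
  proof -
    have "W = {(x, y). x \<in> \<Omega> \<and> y \<in> \<Omega> \<and> x \<noteq> y}" by (auto simp: W_def)
    then show ?thesis using green unfolding is_green_function_def by simp
  qed
  have Gm: "(\<lambda>p. indicator W p *\<^sub>R (case p of (x, y) \<Rightarrow> G x y)) \<in> borel_measurable (borel :: ('a \<times> 'a) measure)"
    by (rule borel_measurable_continuous_on_indicator[OF _ cG]) (use Wo in simp)
  have Hm2: "(\<lambda>(y, x). H y x) \<in> borel_measurable (borel :: ('a \<times> 'a) measure)"
  proof -
    have "(\<lambda>p::'a \<times> 'a. (snd p, fst p)) \<in> borel_measurable borel"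
      by (intro borel_measurable_continuous_onI continuous_intros)
    from measurable_compose[OF this Gm] show ?thesis by (simp add: H_def case_prod_beta)
  qed
  have Hm: "H y \<in> borel_measurable borel" for y
  proof -
    have "(\<lambda>x::'a. (y, x)) \<in> borel_measurable borel"
      by (intro borel_measurable_continuous_onI continuous_intros)
    from measurable_compose[OF this Hm2] show ?thesis by simp
  qed
  have H0: "0 \<le> H y x" for y x using G0[of x y] by (auto simp: H_def W_def split: split_indicator)
  define P where "P \<phi> x = indicator \<Omega> x * polylaplacian 1 \<phi> x" for \<phi> :: "'a \<Rightarrow> real" and x
  have Pfacts: "P \<phi> \<in> borel_measurable borel \<and> (\<exists>L\<ge>0. \<forall>x. \<bar>P \<phi> x\<bar> \<le> L)" if "\<phi> \<in> dirichlet_test 1 \<Omega>" for \<phi>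
  proof -
    have su: "smooth_upto (0 + 2 * 1) \<Omega> \<phi>"
      using that by (simp add: dirichlet_test_def Ck_closure_iff numeral_2_eq_2 del: smooth_upto.simps)
    have sp: "smooth_upto 0 \<Omega> (polylaplacian 1 \<phi>)" by (rule smooth_upto_polylaplacian[OF \<Omega>(1) su])
    obtain L where L: "0 \<le> L" "\<And>x. x \<in> \<Omega> \<Longrightarrow> norm (polylaplacian 1 \<phi> x) \<le> L"
      using smooth_upto_bounded[OF sp \<Omega>(2)] by blast
    have "P \<phi> \<in> borel_measurable borel"
      using borel_measurable_continuous_on_indicator[OF _ smooth_upto_continuous_on[OF sp]] \<Omega>(1)
      by (simp add: P_def[abs_def])
    moreover have "\<bar>P \<phi> x\<bar> \<le> L" for x using L by (auto simp: P_def split: split_indicator)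
    ultimately show ?thesis using L(1) by blast
  qed
  have AEne: "AE x in lebesgue. x \<noteq> y" for y :: 'a
    by (rule AE_completion) (rule AE_lborel_singleton)
  have Hint: "integrable lborel (H y)" if y: "y \<in> \<Omega>" for y
  proof -
    have g: "integrable lebesgue (\<lambda>x. indicator \<Omega> x *\<^sub>R G x y)"
      using green y by (simp add: is_green_function_def set_integrable_def)
    have "integrable lebesgue (H y) \<longleftrightarrow> integrable lebesgue (\<lambda>x. indicator \<Omega> x *\<^sub>R G x y)"
    proof (rule integrable_cong_AE)
      show "H y \<in> borel_measurable lebesgue" using Hm[of y] by (intro measurable_completion) simp
      show "AE x in lebesgue. H y x = indicator \<Omega> x *\<^sub>R G x y"
        using AEne[of y] by eventually_elim (use y in \<open>auto simp: H_def W_def split: split_indicator\<close>)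
    qed (use g in auto)
    then show ?thesis using g Hm[of y] integrable_completion[of "H y" lborel] by simp
  qed
  have HP: "integrable lborel (\<lambda>x. H y x * P \<phi> x)" "(\<integral>x. H y x * P \<phi> x \<partial>lborel) = \<phi> y"
    if y: "y \<in> \<Omega>" and \<phi>: "\<phi> \<in> dirichlet_test 1 \<Omega>" for y \<phi>
  proof -
    obtain L where P: "P \<phi> \<in> borel_measurable borel" and L: "L \<ge> 0" "\<And>x. \<bar>P \<phi> x\<bar> \<le> L" using Pfacts[OF \<phi>] by blast
    have m: "(\<lambda>x. H y x * P \<phi> x) \<in> borel_measurable borel" using Hm P by (intro borel_measurable_times)
    show i: "integrable lborel (\<lambda>x. H y x * P \<phi> x)"
    proof (rule Bochner_Integration.integrable_bound)
      show "integrable lborel (\<lambda>x. L * H y x)" using Hint[OF y] by simp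
      show "AE x in lborel. norm (H y x * P \<phi> x) \<le> norm (L * H y x)"
        by (rule AE_I2) (use L H0 in \<open>auto simp: abs_mult mult.commute[of L] intro!: mult_left_mono\<close>)
    qed (use m in simp)
    have "(\<integral>x. H y x * P \<phi> x \<partial>lborel) = (\<integral>x. H y x * P \<phi> x \<partial>lebesgue)"
      using m by (simp add: integral_completion)
    also have "\<dots> = (\<integral>x. indicator \<Omega> x *\<^sub>R (G x y * polylaplacian 1 \<phi> x) \<partial>lebesgue)"
    proof (rule integral_cong_AE)
      show mm: "(\<lambda>x. H y x * P \<phi> x) \<in> borel_measurable lebesgue" using m by (intro measurable_completion) simp
      show ae: "AE x in lebesgue. H y x * P \<phi> x = indicator \<Omega> x *\<^sub>R (G x y * polylaplacian 1 \<phi> x)"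
        using AEne[of y] by eventually_elim (use y in \<open>auto simp: H_def W_def P_def split: split_indicator\<close>)
      have g: "(\<lambda>x. indicator \<Omega> x *\<^sub>R G x y) \<in> borel_measurable lebesgue"
        using green y by (auto simp: is_green_function_def set_integrable_def)
      have "(\<lambda>x. (indicator \<Omega> x *\<^sub>R G x y) * P \<phi> x) \<in> borel_measurable lebesgue"
        by (intro borel_measurable_times g measurable_completion) (use P in simp)
      then show "(\<lambda>x. indicator \<Omega> x *\<^sub>R (G x y * polylaplacian 1 \<phi> x)) \<in> borel_measurable lebesgue"
        by (rule measurable_cong[THEN iffD1, rotated]) (simp add: P_def split: split_indicator)
    qed
    also have "\<dots> = \<phi> y" using green y \<phi> unfolding is_green_function_def set_lebesgue_integral_def by blast
    finally show "(\<integral>x. H y x * P \<phi> x \<partial>lborel) = \<phi> y" .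
  qed
  have Hbound: "c0 * (\<integral>x. H y x \<partial>lborel) \<le> \<psi> y" if y: "y \<in> \<Omega>" for y
  proof -
    have "c0 * (\<integral>x. H y x \<partial>lborel) = (\<integral>x. c0 * H y x \<partial>lborel)" by simp
    also have "\<dots> \<le> (\<integral>x. H y x * P \<psi> x \<partial>lborel)"
    proof (rule integral_mono)
      show "integrable lborel (\<lambda>x. c0 * H y x)" using Hint[OF y] by simp
      show "c0 * H y x \<le> H y x * P \<psi> x" for x
      proof (cases "x \<in> \<Omega>")
        case True then show ?thesis using mult_right_mono[OF \<psi>(3)[OF True] H0[of y x]] by (simp add: P_def mult.commute)
      qed (simp add: H_def W_def)
    qed (rule HP[OF y \<psi>(1)])
    also have "\<dots> = \<psi> y" by (rule HP[OF y \<psi>(1)])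
    finally show ?thesis .
  qed
  have test_bound: "\<bar>\<phi> y\<bar> \<le> L * (\<integral>x. H y x \<partial>lborel)"
    if y: "y \<in> \<Omega>" and \<phi>: "\<phi> \<in> dirichlet_test 1 \<Omega>" and L: "\<And>x. \<bar>P \<phi> x\<bar> \<le> L" for y \<phi> L
  proof -
    have "\<bar>\<phi> y\<bar> = norm (\<integral>x. H y x * P \<phi> x \<partial>lborel)" using HP(2)[OF y \<phi>] by simp
    also have "\<dots> \<le> (\<integral>x. norm (H y x * P \<phi> x) \<partial>lborel)" by (rule integral_norm_bound)
    also have "\<dots> \<le> (\<integral>x. L * H y x \<partial>lborel)"
    proof (rule integral_mono)
      show "integrable lborel (\<lambda>x. norm (H y x * P \<phi> x))" by (rule integrable_norm[OF HP(1)[OF y \<phi>]])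
      show "integrable lborel (\<lambda>x. L * H y x)" using Hint[OF y] by simp
      show "norm (H y x * P \<phi> x) \<le> L * H y x" for x
        using mult_left_mono[OF L[of x] H0[of y x]] H0[of y x] by (simp add: abs_mult mult.commute[of L])
    qed
    finally show ?thesis by simp
  qed
  have lp: "lborel \<Otimes>\<^sub>M lborel = (lborel :: ('a \<times> 'a) measure)" by (rule lborel_prod)
  have fstm: "(\<lambda>p. f (fst p)) \<in> borel_measurable (borel :: ('a \<times> 'a) measure)"
    by (rule measurable_compose[OF _ fm]) (intro borel_measurable_continuous_onI continuous_intros)
  have fHm: "(\<lambda>(y, x). f y * H y x) \<in> borel_measurable (borel :: ('a \<times> 'a) measure)"
    using borel_measurable_times[OF fstm Hm2] by (simp add: case_prod_beta)
  have fHi: "integrable (lborel \<Otimes>\<^sub>M lborel) (\<lambda>(y, x). f y * H y x)"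
  proof (rule lborel_pair.Fubini_integrable)
    show "(\<lambda>(y, x). f y * H y x) \<in> borel_measurable (lborel \<Otimes>\<^sub>M lborel)" unfolding lp using fHm by simp
    have fy: "f y = 0" if "y \<notin> \<Omega>" for y using fout[OF that] .
    show "AE y in lborel. integrable lborel (\<lambda>x. case (y, x) of (y, x) \<Rightarrow> f y * H y x)"
    proof (rule AE_I2)
      fix y show "integrable lborel (\<lambda>x. case (y, x) of (y, x) \<Rightarrow> f y * H y x)"
        using Hint[of y] fy[of y] by (cases "y \<in> \<Omega>") auto
    qed
    have e: "(\<lambda>y. \<integral>x. norm (case (y, x) of (y, x) \<Rightarrow> f y * H y x) \<partial>lborel) = (\<lambda>y. f y * (\<integral>x. H y x \<partial>lborel))"
      using f0 H0 by (simp add: abs_mult)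
    show "integrable lborel (\<lambda>y. \<integral>x. norm (case (y, x) of (y, x) \<Rightarrow> f y * H y x) \<partial>lborel)"
    proof (rule Bochner_Integration.integrable_bound)
      show "integrable lborel (\<lambda>y. (C0 / c0) * (f y * bdist \<Omega> y))" using fd by simp
      have "(\<lambda>(y, x). norm (f y * H y x)) \<in> borel_measurable (lborel \<Otimes>\<^sub>M lborel)"
        unfolding lp using measurable_compose[OF fHm borel_measurable_norm] by (simp add: case_prod_beta)
      then have "(\<lambda>y. \<integral>x. norm (f y * H y x) \<partial>lborel) \<in> borel_measurable lborel"
        by (intro lborel.borel_measurable_lebesgue_integral)
      then show "(\<lambda>y. \<integral>x. norm (case (y, x) of (y, x) \<Rightarrow> f y * H y x) \<partial>lborel) \<in> borel_measurable lborel" by simp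
      show "AE y in lborel. norm (\<integral>x. norm (case (y, x) of (y, x) \<Rightarrow> f y * H y x) \<partial>lborel) \<le> norm ((C0 / c0) * (f y * bdist \<Omega> y))"
      proof (rule AE_I2)
        fix y
        have "f y * (\<integral>x. H y x \<partial>lborel) \<le> (C0 / c0) * (f y * bdist \<Omega> y)"
        proof (cases "y \<in> \<Omega>")
          case True
          have "c0 * (\<integral>x. H y x \<partial>lborel) \<le> C0 * bdist \<Omega> y" using Hbound[OF True] \<psi>(5)[OF True] by linarith
          then have "(\<integral>x. H y x \<partial>lborel) \<le> (C0 / c0) * bdist \<Omega> y" using \<psi>(2) by (simp add: field_simps)
          then have "f y * (\<integral>x. H y x \<partial>lborel) \<le> f y * ((C0 / c0) * bdist \<Omega> y)" using f0 by (intro mult_left_mono)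
          then show ?thesis by (simp only: mult_ac)
        qed (simp add: fy)
        moreover have "0 \<le> f y * (\<integral>x. H y x \<partial>lborel)"
          using f0 H0 by (intro mult_nonneg_nonneg integral_nonneg) auto
        moreover have "norm (\<integral>x. norm (case (y, x) of (y, x) \<Rightarrow> f y * H y x) \<partial>lborel) = \<bar>f y * (\<integral>x. H y x \<partial>lborel)\<bar>"
          using f0 H0 by (simp add: abs_mult)
        ultimately show "norm (\<integral>x. norm (case (y, x) of (y, x) \<Rightarrow> f y * H y x) \<partial>lborel) \<le> norm ((C0 / c0) * (f y * bdist \<Omega> y))"
          using abs_ge_self[of "(C0 / c0) * (f y * bdist \<Omega> y)"] unfolding real_norm_def by linarith
      qed
    qed
  qed
  define u0 where "u0 x = (\<integral>y. f y * H y x \<partial>lborel)" for x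
  have u0i: "integrable lborel u0" unfolding u0_def using lborel_pair.integrable_snd[OF fHi] .
  have AEfin: "AE x in lborel. integrable lborel (\<lambda>y. f y * H y x)" using lborel_pair.AE_integrable_snd[OF fHi] .
  define c where "c = K * unit_ball_vol 2 * \<rho>\<^sup>2"
  have c: "c > 0" using K \<rho> by (simp add: c_def)
  define low where "low x = (\<Sum>k. (c * t k powr (- \<gamma>)) * indicator (B k) x)" for x
  have lowm: "low \<in> borel_measurable borel" unfolding low_def by (rule sm)
  have low0: "0 \<le> low x" for x unfolding low_def by (intro nn) (use c in simp)
  have lowle: "AE x in lborel. low x \<le> u0 x"
    using AEfin
  proof eventually_elim
    case (elim x)
    show ?case
    proof (cases "x \<in> (\<Union>k. B k)")
      case True
      then obtain k where k: "x \<in> B k" by blast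
      have "low x = c * t k powr (- \<gamma>)" unfolding low_def by (rule DS2[OF k])
      also have "\<dots> = s k * K * measure lborel (B k)"
      proof -
        have "t k powr (- \<gamma>) = s k * t k powr 2"
          unfolding s_def powr_add[symmetric] by (rule arg_cong[where f="(powr) (t k)"]) simp
        then show ?thesis unfolding Bv c_def using t[of k] by (simp add: powr_numeral power_mult_distrib)
      qed
      also have "\<dots> = (\<integral>y. (s k * K) * indicator (B k) y \<partial>lborel)" by simp
      also have "\<dots> \<le> u0 x" unfolding u0_def
      proof (rule integral_mono_AE[OF Bi elim])
        show "AE y in lborel. s k * K * indicator (B k) y \<le> f y * H y x"
          using AE_lborel_singleton[of x]
        proof eventually_elim
          case (elim y)
          show ?case
          proof (cases "y \<in> B k")
            case True
            have "(x, y) \<in> W"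
              using subsetD[OF Bsub k] subsetD[OF Bsub True] elim by (auto simp: W_def)
            then have "H y x = G x y" by (simp add: H_def)
            moreover have "K \<le> G x y" using K(2)[OF k True] elim by simp
            ultimately show ?thesis using True fB[OF True] by (auto simp: s_def intro!: mult_left_mono)
          next
            case False then show ?thesis using f0 H0 by simp
          qed
        qed
      qed
      finally show ?thesis .
    next
      case False
      then have "low x = 0" unfolding low_def by (intro DS3)
      moreover have "0 \<le> u0 x" unfolding u0_def using f0 H0 by (intro Bochner_Integration.integral_nonneg) auto
      ultimately show ?thesis by simp
    qed
  qed
  \<comment> \<open>The Bochner integral defaults to 0 where it does not converge, so
    \<open>u0\<close> satisfies the lower bound only almost everywhere. The maximum changes
    \<open>u0\<close> on a null set and makes the bound hold at every point, which the pointwise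
    comparison of source and solution relies on.\<close>
  define u where "u x = max (u0 x) (low x)" for x
  have u0m: "u0 \<in> borel_measurable borel" using borel_measurable_integrable[OF u0i] by simp
  have um: "u \<in> borel_measurable borel" unfolding u_def[abs_def] using u0m lowm by (intro borel_measurable_max)
  have ueq: "AE x in lborel. u x = u0 x" using lowle by eventually_elim (simp add: u_def)
  have ui: "integrable lborel u"
    using u0i integrable_cong_AE[of u lborel u0] um u0m ueq by simp
  have sol: "(LINT x:\<Omega>|lebesgue. u x * polylaplacian 1 \<phi> x) = (LINT x:\<Omega>|lebesgue. f x * \<phi> x)"
    if \<phi>: "\<phi> \<in> dirichlet_test 1 \<Omega>" for \<phi>
  proof -
    obtain L where P: "P \<phi> \<in> borel_measurable borel" and L: "L \<ge> 0" "\<And>x. \<bar>P \<phi> x\<bar> \<le> L" using Pfacts[OF \<phi>] by blast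
    have Pm: "(\<lambda>p. P \<phi> (snd p)) \<in> borel_measurable (borel :: ('a \<times> 'a) measure)"
      by (rule measurable_compose[OF _ P]) (intro borel_measurable_continuous_onI continuous_intros)
    have fHP: "integrable (lborel \<Otimes>\<^sub>M lborel) (\<lambda>(y, x). f y * H y x * P \<phi> x)"
    proof (rule Bochner_Integration.integrable_bound)
      show "integrable (lborel \<Otimes>\<^sub>M lborel) (\<lambda>p. L * (case p of (y, x) \<Rightarrow> f y * H y x))"
        using fHi by (rule integrable_mult_right)
      show "(\<lambda>(y, x). f y * H y x * P \<phi> x) \<in> borel_measurable (lborel \<Otimes>\<^sub>M lborel)"
        unfolding lp using borel_measurable_times[OF fHm Pm] by (simp add: case_prod_beta)
      show "AE p in lborel \<Otimes>\<^sub>M lborel. norm (case p of (y, x) \<Rightarrow> f y * H y x * P \<phi> x) \<le> norm (L * (case p of (y, x) \<Rightarrow> f y * H y x))"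
      proof (rule AE_I2)
        fix p :: "'a \<times> 'a"
        obtain y x where p: "p = (y, x)" by fastforce
        have "\<bar>f y * H y x\<bar> * \<bar>P \<phi> x\<bar> \<le> \<bar>f y * H y x\<bar> * L" using L by (intro mult_left_mono) auto
        then show "norm (case p of (y, x) \<Rightarrow> f y * H y x * P \<phi> x) \<le> norm (L * (case p of (y, x) \<Rightarrow> f y * H y x))"
          using L(1) by (simp add: p abs_mult mult_ac)
      qed
    qed
    have uP: "(\<lambda>x. u x * P \<phi> x) \<in> borel_measurable borel" using um P by (intro borel_measurable_times)
    have "(LINT x:\<Omega>|lebesgue. u x * polylaplacian 1 \<phi> x) = (\<integral>x. u x * P \<phi> x \<partial>lebesgue)"
      unfolding set_lebesgue_integral_def P_def by (simp add: mult_ac)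
    also have "\<dots> = (\<integral>x. u x * P \<phi> x \<partial>lborel)" using uP by (simp add: integral_completion)
    also have "\<dots> = (\<integral>x. u0 x * P \<phi> x \<partial>lborel)"
    proof (rule integral_cong_AE)
      show "AE x in lborel. u x * P \<phi> x = u0 x * P \<phi> x" using ueq by eventually_elim simp
    qed (use uP u0m P in auto)
    also have "\<dots> = (\<integral>x. (\<integral>y. f y * H y x * P \<phi> x \<partial>lborel) \<partial>lborel)" unfolding u0_def by simp
    \<comment> \<open>After the exchange the inner integral tests G(.,y) against \<phi>, and the
      defining property of the Green function returns \<phi>(y).\<close>
    also have "\<dots> = (\<integral>y. (\<integral>x. f y * H y x * P \<phi> x \<partial>lborel) \<partial>lborel)" by (rule lborel_pair.Fubini_integral[OF fHP])
    also have "\<dots> = (\<integral>y. indicator \<Omega> y * (f y * \<phi> y) \<partial>lborel)"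
    proof (rule Bochner_Integration.integral_cong[OF refl])
      fix y
      show "(\<integral>x. f y * H y x * P \<phi> x \<partial>lborel) = indicator \<Omega> y * (f y * \<phi> y)"
      proof (cases "y \<in> \<Omega>")
        case True
        have "(\<integral>x. f y * H y x * P \<phi> x \<partial>lborel) = f y * (\<integral>x. H y x * P \<phi> x \<partial>lborel)" by (simp add: mult.assoc)
        then show ?thesis using HP(2)[OF True \<phi>] True by simp
      qed (simp add: fout)
    qed
    also have "\<dots> = (\<integral>y. indicator \<Omega> y * (f y * \<phi> y) \<partial>lebesgue)"
    proof -
      have "continuous_on \<Omega> \<phi>"
        using \<phi> smooth_upto_continuous_on by (fastforce simp: dirichlet_test_def Ck_closure_iff)
      then have "(\<lambda>y. indicator \<Omega> y *\<^sub>R \<phi> y) \<in> borel_measurable borel"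
        using \<Omega>(1) by (intro borel_measurable_continuous_on_indicator) auto
      then have "(\<lambda>y. f y * (indicator \<Omega> y *\<^sub>R \<phi> y)) \<in> borel_measurable borel" using fm by (intro borel_measurable_times)
      then have "(\<lambda>y. indicator \<Omega> y * (f y * \<phi> y)) \<in> borel_measurable lborel" by (simp add: mult_ac)
      then show ?thesis by (simp add: integral_completion)
    qed
    finally show ?thesis by (simp add: set_lebesgue_integral_def)
  qed
  have \<Omega>m: "\<Omega> \<in> sets lborel" using \<Omega>(1) by simp
  have "dirichlet_solution 1 \<Omega> f u"
    unfolding dirichlet_solution_def
  proof (intro conjI ballI sol)
    have "(\<lambda>x. indicator \<Omega> x *\<^sub>R f x) \<in> borel_measurable lborel"
      using fm \<Omega>m by (intro borel_measurable_scaleR borel_measurable_indicator) auto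
    then have "(\<lambda>x. indicator \<Omega> x *\<^sub>R f x) \<in> borel_measurable lebesgue" by (rule measurable_completion)
    moreover have "integrable lborel (\<lambda>x. indicator \<Omega> x *\<^sub>R (f x * bdist \<Omega> x))" by (rule integrable_mult_indicator[OF \<Omega>m fd])
    then have "integrable lebesgue (\<lambda>x. indicator \<Omega> x *\<^sub>R (f x * bdist \<Omega> x))" by (simp add: integrable_completion)
    ultimately show "f \<in> L1_weighted 1 \<Omega>"
      using f0 by (simp add: L1_weighted_def set_borel_measurable_def set_integrable_def)
    have "integrable lborel (\<lambda>x. indicator \<Omega> x *\<^sub>R u x)" by (rule integrable_mult_indicator[OF \<Omega>m ui])
    then show "set_integrable lebesgue \<Omega> u" unfolding set_integrable_def by (simp add: integrable_completion)
  qed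
  moreover have "0 \<le> u x" for x using low0[of x] by (simp add: u_def max.coboundedI2)
  moreover have "c * t k powr (- \<gamma>) \<le> u x" if "x \<in> B k" for k x
    unfolding u_def low_def using DS2[OF that, of "\<lambda>k. c * t k powr (- \<gamma>)"] by simp
  ultimately show thesis using that[OF c, of f u] f0 fB fo unfolding s_def by blast
qed

text \<open>The largest open ball about an interior point \<open>o'\<close> inside \<Omega> touches
  the frontier at some \<open>x0\<close>, and the balls B_k approach \<open>x0\<close> along the
  segment from \<open>o'\<close>. On these balls distance to the boundary and distance to
  \<open>x0\<close> are comparable. Both sources vanish off the B_k, so they need comparing with v^p
  and u^q only there.\<close>

lemma system_solution_perturbed_ball:
  fixes \<Omega> :: "'a::euclidean_space set" and p q \<alpha> \<beta> :: real
  assumes dim: "DIM('a) = 2" and pert: "perturbed_ball k \<epsilon> \<Omega>" and green: "green_lower_bound 1 \<Omega>"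
    and pq: "p > 0" "q > 0"
    and \<alpha>: "0 < \<alpha>" "\<alpha> < 1" "\<beta> * p = \<alpha> + 2" and \<beta>: "0 < \<beta>" "\<beta> < 1" "\<alpha> * q = \<beta> + 2"
  shows "\<exists>a b :: 'a \<Rightarrow> real.
           set_borel_measurable lebesgue \<Omega> a \<and> set_borel_measurable lebesgue \<Omega> b \<and>
           (\<forall>x\<in>\<Omega>. 0 \<le> a x) \<and> (\<forall>x\<in>\<Omega>. 0 \<le> b x) \<and>
           bounded (a ` \<Omega>) \<and> bounded (b ` \<Omega>) \<and>
           (\<exists>u v. nonneg_system_solution 1 \<Omega> p q a b u v \<and>
              u \<notin> L_infinity \<Omega> \<and> v \<notin> L_infinity \<Omega>)"
proof -
  obtain \<psi> c0 C0 where \<Omega>: "open \<Omega>" "bounded \<Omega>" "\<Omega> \<noteq> {}" and \<psi>: "\<psi> \<in> dirichlet_test 1 \<Omega>" "c0 > 0"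
    "\<And>x. x \<in> \<Omega> \<Longrightarrow> c0 \<le> polylaplacian 1 \<psi> x" "\<And>x. x \<in> \<Omega> \<Longrightarrow> 0 \<le> \<psi> x"
    "\<And>x. x \<in> \<Omega> \<Longrightarrow> \<psi> x \<le> C0 * bdist \<Omega> x"
    by (rule perturbed_ball_supersolution[OF pert]) (rule that)
  obtain G C where G: "is_green_function 1 \<Omega> G" and Gpos: "\<And>x y. x \<in> \<Omega> \<Longrightarrow> y \<in> \<Omega> \<Longrightarrow> x \<noteq> y \<Longrightarrow> 0 < G x y"
    and C: "C > 0" and Glow: "\<And>x y. x \<in> \<Omega> \<Longrightarrow> y \<in> \<Omega> \<Longrightarrow> x \<noteq> y \<Longrightarrow>
        C * ln (1 + bdist \<Omega> x * bdist \<Omega> y / (norm (x - y))\<^sup>2) \<le> G x y"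
    using green unfolding green_lower_bound_def by auto
  obtain o' where o: "o' \<in> \<Omega>" using \<Omega>(3) by blast
  obtain x0 where x0: "x0 \<in> frontier \<Omega>" "dist o' x0 = bdist \<Omega> o'" "ball o' (bdist \<Omega> o') \<subseteq> \<Omega>" "0 < bdist \<Omega> o'"
    by (rule frontier_boundary_distance[OF \<Omega>(1,2) o])
  define r where "r = bdist \<Omega> o'"
  have r: "r > 0" using x0 by (simp add: r_def)
  have no: "norm (o' - x0) = r" using x0(2) by (simp add: r_def dist_norm)
  define t where "t = (\<lambda>k::nat. (1/2::real) ^ k)"
  have t: "0 < t k" "t k \<le> 1" for k by (auto simp: t_def power_le_one)
  define z where "z k = x0 + t k *\<^sub>R (o' - x0)" for k
  \<comment> \<open>The centres have distance r t_k to \<open>x0\<close> and t_k halves at each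
    step, so the radius r t_k / 4 keeps the balls disjoint. Two points of one ball are less than r
    t_k / 2 apart, whereas both stay at least 3/4 r t_k away from the frontier.\<close>
  define B where "B k = ball (z k) (r / 4 * t k)" for k
  have zo: "dist (z k) o' = (1 - t k) * r" for k
  proof -
    have "z k - o' = (t k - 1) *\<^sub>R (o' - x0)" by (simp add: z_def algebra_simps)
    then show ?thesis using no t[of k] by (simp add: dist_norm)
  qed
  have zx: "dist (z k) x0 = t k * r" for k using no t[of k] by (simp add: z_def dist_norm)
  have yo: "dist y o' < r / 4 * t k + (1 - t k) * r" if "y \<in> B k" for y k
    using that zo[of k] dist_triangle[of y o' "z k"] by (simp add: B_def dist_commute)
  have Bsub: "B k \<subseteq> \<Omega>" for k
  proof
    fix y assume "y \<in> B k"
    moreover have "r / 4 * t k + (1 - t k) * r \<le> r" using r t[of k] by (simp add: field_simps)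
    ultimately have "dist o' y < r" using yo[of y k] by (simp add: dist_commute)
    then show "y \<in> \<Omega>" using x0(3) by (auto simp: r_def)
  qed
  have dlow: "3 / 4 * r * t k \<le> bdist \<Omega> y" if "y \<in> B k" for y k
  proof -
    have "r \<le> bdist \<Omega> y + dist o' y" unfolding r_def bdist_def by (rule infdist_triangle)
    then show ?thesis using yo[OF that] by (simp add: dist_commute algebra_simps)
  qed
  have dup: "bdist \<Omega> y \<le> 5 / 4 * r * t k" if "y \<in> B k" for y k
  proof -
    have "bdist \<Omega> y \<le> dist y x0" unfolding bdist_def by (rule infdist_le[OF x0(1)])
    also have "\<dots> \<le> dist (z k) y + dist (z k) x0" by (metis dist_commute dist_triangle)
    also have "\<dots> \<le> 5 / 4 * r * t k" using that zx[of k] by (simp add: B_def algebra_simps)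
    finally show ?thesis .
  qed
  have disj': "B i \<inter> B j = {}" if "i < j" for i j
  proof (rule ccontr)
    assume "B i \<inter> B j \<noteq> {}"
    then obtain y where y: "dist (z i) y < r / 4 * t i" "dist (z j) y < r / 4 * t j" by (auto simp: B_def)
    have "t j \<le> (1/2) ^ Suc i" unfolding t_def using that by (intro power_decreasing) auto
    then have tj: "t j \<le> t i / 2" by (simp add: t_def)
    have "z i - z j = (t i - t j) *\<^sub>R (o' - x0)" by (simp add: z_def algebra_simps)
    then have "dist (z i) (z j) = (t i - t j) * r" using no tj t(1)[of i] by (simp add: dist_norm)
    moreover have "dist (z i) (z j) < r / 4 * t i + r / 4 * t j" using y by (meson add_strict_mono dist_triangle2 order_le_less_trans)
    ultimately have "(t i - t j) * r < (t i / 4 + t j / 4) * r" by (simp add: algebra_simps)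
    then have "t i - t j < t i / 4 + t j / 4" by (rule mult_right_less_imp_less) (use r in simp)
    then show False using tj t(1)[of i] by linarith
  qed
  have disj: "B i \<inter> B j = {}" if "i \<noteq> j" for i j using disj' that by (metis Int_commute linorder_neqE_nat)
  \<comment> \<open>Within one ball the product of the boundary distances is at least |x - y|^2, so
    the logarithm in the Green function bound is at least ln 2, independently of
    \<open>k\<close>.\<close>
  have K: "C * ln 2 \<le> G x y" if xy: "x \<in> B k" "y \<in> B k" "x \<noteq> y" for k x y
  proof -
    have "dist x y < r / 2 * t k" using xy dist_triangle2[of x y "z k"] dist_triangle3[of x y "z k"] by (simp add: B_def)
    then have n: "norm (x - y) \<le> r / 2 * t k" by (simp add: dist_norm)
    have "(norm (x - y))\<^sup>2 \<le> (r / 2 * t k)\<^sup>2" using n by (intro power_mono) auto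
    also have "\<dots> \<le> (3 / 4 * r * t k) * (3 / 4 * r * t k)" using r by (simp add: power2_eq_square)
    also have "\<dots> \<le> bdist \<Omega> x * bdist \<Omega> y"
      using dlow[OF xy(1)] dlow[OF xy(2)] r t[of k] by (intro mult_mono) (auto intro: order_trans[OF _ dlow[OF xy(1)]])
    finally have "1 \<le> bdist \<Omega> x * bdist \<Omega> y / (norm (x - y))\<^sup>2" using xy(3) by (simp add: le_divide_eq)
    then have "ln 2 \<le> ln (1 + bdist \<Omega> x * bdist \<Omega> y / (norm (x - y))\<^sup>2)" by simp
    then have "C * ln 2 \<le> C * ln (1 + bdist \<Omega> x * bdist \<Omega> y / (norm (x - y))\<^sup>2)" using C by (intro mult_left_mono) auto
    then show ?thesis using Glow[of x y] xy Bsub by force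
  qed
  have K0: "C * ln 2 > 0" using C by simp
  have r4: "0 < r / 4" using r by simp
  \<comment> \<open>All data except \<gamma> are frozen, so that the exponents \<alpha> and \<beta>
    are realised on the same balls.\<close>
  have sing: thesis
    if \<gamma>: "\<gamma> < 1" and that': "\<And>f u c. c > 0 \<Longrightarrow> dirichlet_solution 1 \<Omega> f u \<Longrightarrow> (\<And>x. 0 \<le> f x) \<Longrightarrow> (\<And>x. 0 \<le> u x) \<Longrightarrow>
      (\<And>k x. x \<in> B k \<Longrightarrow> f x = t k powr (- (\<gamma> + 2))) \<Longrightarrow> (\<And>x. x \<notin> (\<Union>k. B k) \<Longrightarrow> f x = 0) \<Longrightarrow>
      (\<And>k x. x \<in> B k \<Longrightarrow> c * t k powr (- \<gamma>) \<le> u x) \<Longrightarrow> thesis" for \<gamma> thesis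
    by (rule green_singular_solution[of \<Omega> G \<psi> c0 C0 "r / 4" z "5 / 4 * r" "C * ln 2" \<gamma>, folded t_def, folded B_def,
          OF dim \<Omega>(1,2) G Gpos \<psi> r4 Bsub disj dup K0 K \<gamma>]) (assumption | rule that')+
  obtain f u c where c: "c > 0" and fu: "dirichlet_solution 1 \<Omega> f u" and f0: "\<And>x. 0 \<le> f x" and u0: "\<And>x. 0 \<le> u x"
    and fB: "\<And>k x. x \<in> B k \<Longrightarrow> f x = t k powr (- (\<alpha> + 2))" and fo: "\<And>x. x \<notin> (\<Union>k. B k) \<Longrightarrow> f x = 0"
    and ul: "\<And>k x. x \<in> B k \<Longrightarrow> c * t k powr (- \<alpha>) \<le> u x"
    by (rule sing[OF \<alpha>(2)]) (rule that)
  obtain h v d where d: "d > 0" and hv: "dirichlet_solution 1 \<Omega> h v" and h0: "\<And>x. 0 \<le> h x" and v0: "\<And>x. 0 \<le> v x"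
    and hB: "\<And>k x. x \<in> B k \<Longrightarrow> h x = t k powr (- (\<beta> + 2))" and ho: "\<And>x. x \<notin> (\<Union>k. B k) \<Longrightarrow> h x = 0"
    and vl: "\<And>k x. x \<in> B k \<Longrightarrow> d * t k powr (- \<beta>) \<le> v x"
    by (rule sing[OF \<beta>(2)]) (rule that)
  have cross: "t k powr (- (\<alpha> + 2)) \<le> 1 / d powr p * s powr p"
    if "p > 0" "d > 0" "\<beta> * p = \<alpha> + 2" "d * t k powr (- \<beta>) \<le> s" for p d \<alpha> \<beta> s k
  proof -
    have "(d * t k powr (- \<beta>)) powr p \<le> s powr p" using that by (intro powr_mono2) auto
    moreover have "(d * t k powr (- \<beta>)) powr p = d powr p * t k powr (- (\<alpha> + 2))"
      unfolding that(3)[symmetric] powr_mult powr_powr by simp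
    ultimately show ?thesis using that(2) by (simp add: field_simps)
  qed
  have unb: "w \<notin> L_infinity \<Omega>" if \<gamma>: "0 < \<gamma>" and e: "e > 0" and w: "\<And>k x. x \<in> B k \<Longrightarrow> e * t k powr (- \<gamma>) \<le> w x" for w \<gamma> e
  proof (rule not_in_L_infinity)
    fix M :: real
    have "(1/2::real) powr (- \<gamma>) > 1" using \<gamma> powr_less_mono2_neg[of "- \<gamma>" "1/2" 1] by simp
    then obtain k where k: "M / e < ((1/2::real) powr (- \<gamma>)) ^ k" using real_arch_pow by blast
    then have k': "M < e * t k powr (- \<gamma>)" using e unfolding t_def half_powr by (simp add: field_simps)
    have "z k \<in> B k" using r t[of k] by (simp add: B_def)
    then show "\<exists>S. open S \<and> S \<noteq> {} \<and> S \<subseteq> \<Omega> \<and> (\<forall>x\<in>S. M < w x)"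
      using Bsub[of k] w[of _ k] k' by (intro exI[of _ "B k"]) (auto simp: B_def intro: less_le_trans)
  qed
  show ?thesis
  proof (rule system_of_solutions[OF fu hv])
    show "f x \<le> 1 / d powr p * v x powr p" for x
    proof (cases "x \<in> (\<Union>k. B k)")
      case True
      then obtain k where "x \<in> B k" by blast
      then show ?thesis using cross[OF pq(1) d \<alpha>(3) vl] fB by simp
    next
      case False then show ?thesis using fo by simp
    qed
    show "h x \<le> 1 / c powr q * u x powr q" for x
    proof (cases "x \<in> (\<Union>k. B k)")
      case True
      then obtain k where "x \<in> B k" by blast
      then show ?thesis using cross[OF pq(2) c \<beta>(3) ul] hB by simp
    next
      case False then show ?thesis using ho by simp
    qed
    show "u \<notin> L_infinity \<Omega>" by (rule unb[OF \<alpha>(1) c ul])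
    show "v \<notin> L_infinity \<Omega>" by (rule unb[OF \<beta>(1) d vl])
  qed (use f0 h0 u0 v0 in auto)
qed

theorem theorem3p2:
  fixes \<Omega> :: "(real ^ 'n) set" and m :: nat and p q \<alpha> \<beta> :: real
  assumes "m \<ge> 1" and "CARD('n) \<ge> 2"
    and "admissible_domain m \<Omega>"
    and "p > 0" and "q > 0" and "p * q > 1"
    and "\<alpha> = 2 * real m * (p + 1) / (p * q - 1)"
    and "\<beta> = 2 * real m * (q + 1) / (p * q - 1)"
    and "max \<alpha> \<beta> < real CARD('n) - real m"
  shows "\<exists>a b :: real ^ 'n \<Rightarrow> real.
           set_borel_measurable lebesgue \<Omega> a \<and> set_borel_measurable lebesgue \<Omega> b \<and>
           (\<forall>x\<in>\<Omega>. 0 \<le> a x) \<and> (\<forall>x\<in>\<Omega>. 0 \<le> b x) \<and>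
           bounded (a ` \<Omega>) \<and> bounded (b ` \<Omega>) \<and>
           (\<exists>u v. nonneg_system_solution m \<Omega> p q a b u v \<and>
              u \<notin> L_infinity \<Omega> \<and> v \<notin> L_infinity \<Omega>)"
proof -
  have pos: "0 < \<alpha>" "0 < \<beta>" using assms by simp_all
  have lt: "\<alpha> < real CARD('n) - real m" "\<beta> < real CARD('n) - real m" using assms(9) by auto
  have id: "\<beta> * p = \<alpha> + 2 * real m" "\<alpha> * q = \<beta> + 2 * real m"
    using assms(6) unfolding assms(7,8) by (simp_all add: field_simps)
  show ?thesis
  proof (cases "\<Omega> = ball 0 1")
    case True
    show ?thesis unfolding True
      by (rule system_solution_unit_ball[OF assms(1,4,5) pos(1) _ id(1) pos(2) _ id(2)]) (use lt in simp_all)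
  next
    case False
    then obtain \<epsilon> where dim: "CARD('n) = 2" and pert: "perturbed_ball m \<epsilon> \<Omega>" and green: "green_lower_bound m \<Omega>"
      using assms(3) unfolding admissible_domain_def by auto
    \<comment> \<open>With n = 2 the hypothesis reads 0 < \<alpha> < 2 - m.\<close>
    have m: "m = 1" using lt pos assms(1) dim by simp
    show ?thesis unfolding m
      by (rule system_solution_perturbed_ball[OF _ pert green[unfolded m] assms(4,5) pos(1) _ _ pos(2)])
        (use lt id dim m in simp_all)
  qed
qed

end
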